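(* Let $m \geq 2$. For $1\leq \ell \leq m$, let $(\sigma^{\ell}_n)_{n\geq 1}$ be a sequence of random permutations such that $\sigma^{\ell}_n \in \mathfrak{S}_n$ for every $n\geq 1$. Assume that: (1) for every $n\geq 1$, the random permutations $\sigma^1_n, \dots, \sigma^{m}_n$ are independent; (2) for all $\ell\in\{1,\dots,m\}$ except possibly one, the following holds: for every $n\geq 1$ and every $\sigma \in \mathfrak{S}_n$, $\sigma^{-1}\sigma_n^\ell\sigma\overset{d}{=}\sigma_n^\ell$; (3) there exist $1\leq i < j\leq m$ such that for every $k \geq 1$, $$\lim_{n\to\infty} \mathbb{E}\left(\left(\frac{\#_1 \,\sigma^{i}_n}{\sqrt n}\right)^k\right)=0, \qquad \lim_{n\to\infty} \mathbb{E}\left(\left(\frac{\#_1 \,\sigma^{j}_n}{\sqrt n}\right)^k\right) =0,$$ and moreover $$\lim_{n\to\infty} \frac{\mathbb{E}(\#_2\,\sigma^i_n)}{n} =0, \qquad \lim_{n\to\infty} \frac{\mathbb{E}(\#_2\,\sigma^j_n)}{n} =0.$$ Then for every $k\geq 1$, the random vector $$\left(\mathrm{tr}\Big(\prod_{\ell=1}^m\sigma_n^\ell\Big),\ \mathrm{tr}\Big(\Big(\prod_{\ell=1}^m\sigma_n^\ell\Big)^2\Big),\dots,\mathrm{tr}\Big(\Big(\prod_{\ell=1}^m\sigma_n^\ell\Big)^k\Big)\right)$$ converges in distribution, as $n\to\infty$, to $\left(\xi_1,\ \xi_1+ 2\xi_2,\dots,\sum_{d|k} d\,\xi_d\right)$,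 where $\xi_1,\xi_2,\dots$ are independent and $\xi_d$ has the Poisson distribution with parameter $\frac 1d$ (the $r$-th coordinate of the limit being $\sum_{d|r} d\,\xi_d$).
   Context: $\mathfrak{S}_n$ is the group of permutations of $\{1,\dots,n\}$. For $\sigma\in\mathfrak{S}_n$ and $k\ge 1$, $\#_k\,\sigma$ is the number of cycles of $\sigma$ of length $k$, and $\mathrm{tr}(\sigma):=\#_1\,\sigma$ is the number of fixed points of $\sigma$. $\overset{d}{=}$ denotes equality in distribution. The product $\prod_{\ell=1}^m\sigma_n^\ell$ is the composition $\sigma_n^1\sigma_n^2\cdots\sigma_n^m$ in this order; powers are taken in the group $\mathfrak{S}_n$. *)

theory Defs
  imports "HOL-Probability.Probability" "HOL-Combinatorics.Orbits"
begin

abbreviation perms :: "nat \<Rightarrow> (nat \<Rightarrow> nat) set" where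
  "perms n \<equiv> {p. p permutes {1..n}}"

text \<open>For a permutation the cycles are the orbits; fixed points are cycles of length 1.\<close>

definition cycle_count :: "nat \<Rightarrow> nat \<Rightarrow> (nat \<Rightarrow> nat) \<Rightarrow> nat" where
  "cycle_count n k p = card {C \<in> orbit p ` {1..n}. card C = k}"

definition perm_tr :: "nat \<Rightarrow> (nat \<Rightarrow> nat) \<Rightarrow> nat" where
  "perm_tr n p = cycle_count n 1 p"

lemma perm_tr_eq_card_fixed_points:
  assumes "p permutes {1..n}"
  shows "perm_tr n p = card {x \<in> {1..n}. p x = x}"
proof -
  have self: "x \<in> orbit p x" for x
  proof (rule permutation_self_in_orbit)
    show "permutation p"
      unfolding permutation_permutes using assms by (intro exI[of _ "{1..n}"]) simp
  qed
  have "{C \<in> orbit p ` {1..n}. card C = 1} = (\<lambda>x. {x}) ` {x \<in> {1..n}. p x = x}"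
  proof (intro equalityI subsetI)
    fix C assume "C \<in> {C \<in> orbit p ` {1..n}. card C = 1}"
    then obtain x y where x: "x \<in> {1..n}" "C = orbit p x" "C = {y}"
      by (auto simp: card_1_singleton_iff)
    have "x = y" "p x = y"
      using self[of x] orbit.base[of p x] x by auto
    then show "C \<in> (\<lambda>x. {x}) ` {x \<in> {1..n}. p x = x}"
      using x by auto
  next
    fix C assume "C \<in> (\<lambda>x. {x}) ` {x \<in> {1..n}. p x = x}"
    then obtain x where x: "x \<in> {1..n}" "p x = x" "C = {x}" by auto
    have "y = x" if "y \<in> orbit p x" for y
      using that by (induction rule: orbit.induct) (use x in simp_all)
    then have "orbit p x = {x}" using self[of x] by blast
    then show "C \<in> {C \<in> orbit p ` {1..n}. card C = 1}" using x by (auto intro!: image_eqI[of _ _ x])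
  qed
  then show ?thesis
    unfolding perm_tr_def cycle_count_def by (simp add: card_image)
qed

text \<open>The product \<open>s 1 \<circ> s 2 \<circ> \<dots> \<circ> s m\<close>.\<close>

definition perm_prod :: "nat \<Rightarrow> (nat \<Rightarrow> 'a \<Rightarrow> 'a) \<Rightarrow> 'a \<Rightarrow> 'a" where
  "perm_prod m s = foldr (\<circ>) (map s [1..<Suc m]) id"

text \<open>
  Convergence in distribution of random vectors with coordinates indexed by a finite set \<open>I\<close>:
  expectations of bounded continuous functions converge. The vectors are expected to be
  measurable functions into \<open>PiM I (\<lambda>_. borel)\<close>, hence extensional on \<open>I\<close>; they may live
  on different probability spaces.
\<close>

definition conv_in_distr ::
  "'i set \<Rightarrow> (nat \<Rightarrow> 'a measure) \<Rightarrow> (nat \<Rightarrow> 'a \<Rightarrow> 'i \<Rightarrow> real) \<Rightarrow>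
   'b measure \<Rightarrow> ('b \<Rightarrow> 'i \<Rightarrow> real) \<Rightarrow> bool" where
  "conv_in_distr I M X N Y \<longleftrightarrow>
    (\<forall>f. continuous_map (powertop_real I) euclideanreal f \<longrightarrow>
         bounded (f ` topspace (powertop_real I)) \<longrightarrow>
         (\<lambda>n. \<integral>\<omega>. f (X n \<omega>) \<partial>M n) \<longlonglongrightarrow> (\<integral>\<omega>. f (Y \<omega>) \<partial>N))"

end

theory Submission
  imports Defs "HOL-Combinatorics.Cycles"
begin

text \<open>
  Let \<open>\<pi>\<close> be the product. For a permutation \<open>\<rho>\<close> of a finite index set \<open>I\<close>, consider the
  injections \<open>x\<close> of \<open>I\<close> into \<open>{1..n}\<close> with \<open>\<pi> \<circ> x = x \<circ> \<rho>\<close>. If \<open>\<rho>\<close> has \<open>\<alpha> d\<close> cycles of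
  length \<open>d\<close>, their number is \<open>\<Prod>d. d ^ \<alpha> d * C\<^sub>d * (C\<^sub>d - 1) * \<dots> * (C\<^sub>d - \<alpha> d + 1)\<close>, where \<open>C\<^sub>d\<close>
  counts the \<open>d\<close>-cycles of \<open>\<pi>\<close> (\<open>card_equivariant_cycle_type\<close>). So the joint factorial
  moments of the cycle counts converge to those of independent Poisson variables with
  parameters \<open>1 / d\<close> as soon as, for every \<open>\<rho>\<close>, the expected number of such \<open>x\<close> tends to \<open>1\<close>
  (\<open>expectation_equivariant_tendsto_1\<close>).

  The trace of a power does not change under conjugation, so the product may be rotated
  cyclically and bracketed as \<open>s \<circ> t\<close>, where \<open>s\<close> and \<open>t\<close> are independent, \<open>s\<close> starts with
  \<open>\<sigma> n i\<close> and \<open>t\<close> starts with \<open>\<sigma> n j\<close>, and at least one of \<open>s\<close>, \<open>t\<close> has a conjugation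
  invariant law. An equivariant injection for \<open>s \<circ> t\<close> is a pair of injections \<open>(x, y)\<close> with
  \<open>t \<circ> x = y\<close> and \<open>s \<circ> y = x \<circ> \<rho>\<close>. Sort these pairs by their kernel \<open>K\<close>, which records the
  coincidences among the values of \<open>x\<close> and \<open>y\<close>. Conjugation acts transitively on the pairs
  with kernel \<open>K\<close>; hence for the invariant factor all of them are equally likely to satisfy
  their equation, and the expectation factorises into
  \<open>\<Sum>K. A\<^sub>K * B\<^sub>K / N\<^sub>K\<close> (\<open>expectation_equivariant\<close>). Here \<open>A\<^sub>K\<close> and \<open>B\<^sub>K\<close> are the expected numbers
  of pairs with kernel \<open>K\<close> that satisfy the equation of \<open>s\<close>, respectively of \<open>t\<close>, and \<open>N\<^sub>K\<close> is
  the number of all pairs with kernel \<open>K\<close>, about \<open>n ^ v\<close> if \<open>K\<close> has \<open>v\<close> classes.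

  The equation of \<open>s\<close> turns the \<open>v\<close> classes into the vertices of a graph that has to be
  embedded into the functional graph of \<open>s\<close>, and an embedding is determined by one value per
  connected component. A component with at least three vertices contributes a factor \<open>n\<close>, less
  than \<open>sqrt n\<close> per vertex; an isolated loop has to be sent to a fixed point and a two-cycle to
  a two-cycle, which \<open>s\<close> has too few of. Therefore \<open>A\<^sub>K\<close> is negligible against \<open>sqrt n ^ v\<close>
  unless all components are single edges (\<open>card_embs_cases\<close>, \<open>embs_negligible\<close>). This
  exception means that \<open>K\<close> is discrete and \<open>v = 2 * card I\<close>; then \<open>A\<^sub>K\<close>, being the only relevant
  contribution to the number of injections of \<open>I\<close>, is asymptotic to \<open>n ^ card I\<close>. The same holds for
  \<open>t\<close>, so the sum tends to \<open>1\<close>.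

  The bracketing is harmless because the hypotheses on \<open>\<sigma> n i\<close> pass to \<open>s\<close>, and likewise
  for \<open>t\<close>: if only the first factor of a product is known to have few short cycles, the
  same formula bounds the expected number of equivariant injections by
  \<open>o (sqrt n ^ card I)\<close>, and fixed points and two-cycles are themselves counted by equivariant
  injections (\<open>few_short_cycles_conv\<close>).

  Finally the convergence of factorial moments is turned into convergence of point
  probabilities by Bonferroni inequalities, hence into convergence of the expectations of
  bounded functions of the cycle counts, and \<open>tr (\<pi> ^ r)\<close> is the sum of \<open>d * C\<^sub>d\<close> over the
  divisors \<open>d\<close> of \<open>r\<close>.
\<close>

section \<open>Injective maps carried along a permutation\<close>

definition inj_funs :: "'v set \<Rightarrow> 'x set \<Rightarrow> ('v \<Rightarrow> 'x) set" where
  "inj_funs V S = {w \<in> V \<rightarrow>\<^sub>E S. inj_on w V}"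

text \<open>
  A set \<open>E\<close> of pairs is read as the edges of a directed graph, which \<open>w\<close> sends into the
  functional graph \<open>x \<mapsto> s x\<close>.
\<close>

definition carries :: "('v \<times> 'v) set \<Rightarrow> ('x \<Rightarrow> 'x) \<Rightarrow> ('v \<Rightarrow> 'x) \<Rightarrow> bool" where
  "carries E s w \<longleftrightarrow> (\<forall>(a, b)\<in>E. s (w a) = w b)"

definition embs :: "'v set \<Rightarrow> ('v \<times> 'v) set \<Rightarrow> nat \<Rightarrow> (nat \<Rightarrow> nat) \<Rightarrow> ('v \<Rightarrow> nat) set" where
  "embs V E n s = {w \<in> inj_funs V {1..n}. carries E s w}"

definition fix_pts :: "nat \<Rightarrow> (nat \<Rightarrow> nat) \<Rightarrow> nat set" where
  "fix_pts n s = {x \<in> {1..n}. s x = x}"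

definition two_pts :: "nat \<Rightarrow> (nat \<Rightarrow> nat) \<Rightarrow> nat set" where
  "two_pts n s = {x \<in> {1..n}. s (s x) = x \<and> s x \<noteq> x}"

lemma finite_inj_funs [simp]: "finite V \<Longrightarrow> finite S \<Longrightarrow> finite (inj_funs V S)"
  unfolding inj_funs_def by (rule finite_subset[OF _ finite_PiE]) auto

lemma finite_fix_pts [simp]: "finite (fix_pts n s)" and finite_two_pts [simp]: "finite (two_pts n s)"
  unfolding fix_pts_def two_pts_def by auto

lemma card_inj_funs:
  "finite V \<Longrightarrow> finite S \<Longrightarrow> card (inj_funs V S) = (\<Prod>i<card V. card S - i)"
  using card_inj_on_subset_funcset[of V S V] unfolding inj_funs_def by (simp add: atLeast0LessThan)

lemma card_inj_funs_asymp:
  assumes "finite V"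
  shows "(\<lambda>n. real (card (inj_funs V {1..n})) / real n ^ card V) \<longlonglongrightarrow> 1"
proof -
  have "(\<lambda>n. real (n - i) / real n) \<longlonglongrightarrow> 1" for i
  proof (rule Lim_transform_eventually)
    show "(\<lambda>n. 1 - real i / real n) \<longlonglongrightarrow> 1"
      using tendsto_diff[OF tendsto_const lim_const_over_n[of "real i"], of 1] by simp
    show "\<forall>\<^sub>F n in sequentially. 1 - real i / real n = real (n - i) / real n"
      using eventually_ge_at_top[of "Suc i"] by eventually_elim (simp add: of_nat_diff field_simps)
  qed
  then have "(\<lambda>n. \<Prod>i<card V. real (n - i) / real n) \<longlonglongrightarrow> (\<Prod>i<card V. 1)"
    by (intro tendsto_prod)
  then show ?thesis using assms by (simp add: card_inj_funs prod_dividef)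
qed

text \<open>
  The value at the source of an edge determines the value at its target, so the values at
  the sources suffice.
\<close>

lemma card_embs_le_power:
  assumes V: "finite V" and E: "Field E = V"
  shows "card (embs V E n s) \<le> n ^ card E"
proof -
  have finE: "finite E" using V E finite_subset[of E "V \<times> V"] unfolding Field_def by fastforce
  have "card (embs V E n s) \<le> card (E \<rightarrow>\<^sub>E {1..n})"
  proof (rule card_inj_on_le)
    show "inj_on (\<lambda>w. \<lambda>e\<in>E. w (fst e)) (embs V E n s)"
    proof (rule inj_onI)
      fix w w' assume w: "w \<in> embs V E n s" "w' \<in> embs V E n s"
        and eq: "(\<lambda>e\<in>E. w (fst e)) = (\<lambda>e\<in>E. w' (fst e))"
      have 1: "w a = w' a" if "(a, b) \<in> E" for a b
        using fun_cong[OF eq, of "(a, b)"] that by simp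
      have 2: "w b = w' b" if "(a, b) \<in> E" for a b
      proof -
        have "s (w a) = w b" "s (w' a) = w' b" using w that by (auto simp: embs_def carries_def)
        then show ?thesis using 1[OF that] by simp
      qed
      show "w = w'"
      proof
        fix x show "w x = w' x"
        proof (cases "x \<in> V")
          case True then show ?thesis using 1 2 E unfolding Field_def by auto
        next
          case False then show ?thesis using w by (auto simp: embs_def inj_funs_def PiE_def extensional_def)
        qed
      qed
    qed
    show "(\<lambda>w. \<lambda>e\<in>E. w (fst e)) ` embs V E n s \<subseteq> E \<rightarrow>\<^sub>E {1..n}"
      using E by (fastforce simp: embs_def inj_funs_def Field_def intro!: restrict_PiE_iff[THEN iffD2])
  qed (use finE in \<open>auto intro: finite_PiE\<close>)
  then show ?thesis using finE by (simp add: card_funcsetE)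
qed

text \<open>
  An embedding is determined by its values at one representative of each connected component.
  If some component has a loop, the graph consists of \<open>l\<close> such components and \<open>q\<close> others, each
  with at least two vertices; the representatives of the former go to fixed points. Without
  loops there are at most \<open>card V / 2\<close> components. If there are exactly that many, all of them
  have two vertices; there being more edges than components (as \<open>card V < 2 * card E\<close>), two
  edges lie in the same component and form a two-cycle. The point of the three bounds is that
  each is smaller than \<open>sqrt n ^ card V\<close> when \<open>s\<close> has few fixed points and two-cycles.
  The excluded case \<open>card V = 2 * card E\<close> is that of a graph whose edges are disjoint.
\<close>

lemma card_embs_cases:
  fixes E :: "('v \<times> 'v) set"
  assumes V: "finite V" and E: "Field E = V" and not_matching: "card V \<noteq> 2 * card E"
  obtains
    (loop) l q where "1 \<le> l" "2 * q + l \<le> card V"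
      "\<And>n s. s permutes {1..n} \<Longrightarrow> card (embs V E n s) \<le> card (fix_pts n s) ^ l * n ^ q"
  | (large) q where "2 * q < card V"
      "\<And>n s. s permutes {1..n} \<Longrightarrow> card (embs V E n s) \<le> n ^ q"
  | (two_cycle) q where "2 * q + 2 \<le> card V"
      "\<And>n s. s permutes {1..n} \<Longrightarrow> card (embs V E n s) \<le> card (two_pts n s) * n ^ q"
proof -
  have finE: "finite E" using V E finite_subset[of E "V \<times> V"] unfolding Field_def by fastforce
  have EV: "a \<in> V" "b \<in> V" if "(a, b) \<in> E" for a b using that E by (auto simp: Field_def)
  define R where "R = (E \<union> E\<inverse>)\<^sup>*"
  have R_refl: "(a, a) \<in> R" for a by (simp add: R_def)
  have R_sym: "(b, a) \<in> R" if "(a, b) \<in> R" for a b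
    using that sym_rtrancl[OF sym_Un_converse, of E] unfolding R_def by (auto dest: symD)
  have R_trans: "(a, c) \<in> R" if "(a, b) \<in> R" "(b, c) \<in> R" for a b c
    using that unfolding R_def by (rule rtrancl_trans)
  have R_E: "(a, b) \<in> R" if "(a, b) \<in> E" for a b using that unfolding R_def by auto
  have R_V: "b \<in> V" if "(a, b) \<in> R" "a \<in> V" for a b
    using that unfolding R_def by (induction rule: rtrancl_induct) (use EV in auto)
  \<comment> \<open>A representative of each connected component, sitting on a loop if there is one.\<close>
  \<comment> \<open>Sitting on a loop if possible matters because only then is the representative's image
    known to be a fixed point.\<close>
  define good where "good = (\<lambda>a b. (a, b) \<in> R \<and> ((\<exists>d. (a, d) \<in> R \<and> (d, d) \<in> E) \<longrightarrow> (b, b) \<in> E))"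
  define c where "c = (\<lambda>a. SOME b. good a b)"
  have "\<exists>b. good a b" for a unfolding good_def using R_refl by blast
  then have good_c: "good a (c a)" for a unfolding c_def by (rule someI_ex)
  have c_R: "(a, c a) \<in> R" for a using good_c[of a] unfolding good_def by blast
  have c_eq: "c a = c b" if "(a, b) \<in> R" for a b
  proof -
    have "(a, x) \<in> R \<longleftrightarrow> (b, x) \<in> R" for x using that R_sym R_trans by blast
    then have "good a = good b" unfolding good_def by presburger
    then show ?thesis unfolding c_def by simp
  qed
  have c_loop: "(c a, c a) \<in> E" if "(a, a) \<in> E" for a
    using good_c[of a] R_refl that unfolding good_def by blast
  define T where "T = c ` V"
  have finT: "finite T" unfolding T_def using V by simp
  have TV: "T \<subseteq> V" unfolding T_def using c_R R_V by blast
  have cT: "c r = r" if "r \<in> T" for r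
    using that c_eq[OF c_R] unfolding T_def by auto
  define F where "F = (\<lambda>r. {a \<in> V. c a = r})"
  have finF: "finite (F r)" for r unfolding F_def using V by simp
  have cardV: "card V = (\<Sum>r\<in>T. card (F r))"
  proof -
    have "V = (\<Union>r\<in>T. F r)" unfolding T_def F_def by auto
    also have "card \<dots> = (\<Sum>r\<in>T. card (F r))"
      by (rule card_UN_disjoint) (use finT finF in \<open>auto simp: F_def\<close>)
    finally show ?thesis .
  qed
  have rF: "r \<in> F r" if "r \<in> T" for r using that TV cT unfolding F_def by auto
  have F1: "1 \<le> card (F r)" if "r \<in> T" for r
    using rF[OF that] finF[of r] by (metis One_nat_def Suc_leI card_gt_0_iff empty_iff)
  have F2: "2 \<le> card (F r)" if r: "r \<in> T" and nl: "(r, r) \<notin> E" for r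
  proof -
    have "r \<in> Field E" using r TV E by auto
    then obtain b where b: "(r, b) \<in> E \<or> (b, r) \<in> E" unfolding Field_def by auto
    then have "c b = c r" using c_eq R_E R_sym by blast
    then have "{r, b} \<subseteq> F r" using b EV cT[OF r] unfolding F_def by auto
    moreover have "b \<noteq> r" using b nl by auto
    ultimately show ?thesis using card_mono[OF finF[of r], of "{r, b}"] by auto
  qed
  have emb_bound: "card (embs V E n s) \<le> (\<Prod>r\<in>T. card (X r))"
    if s: "s permutes {1..n}" and X: "\<And>w r. w \<in> embs V E n s \<Longrightarrow> r \<in> T \<Longrightarrow> w r \<in> X r"
      and finX: "\<And>r. finite (X r)" for n s and X :: "'v \<Rightarrow> nat set"
  proof -
    have "card (embs V E n s) \<le> card (PiE T X)"
    proof (rule card_inj_on_le)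
      show "inj_on (\<lambda>w. restrict w T) (embs V E n s)"
      proof (rule inj_onI)
        fix w w' assume w: "w \<in> embs V E n s" "w' \<in> embs V E n s"
          and eq: "restrict w T = restrict w' T"
        have step: "w a = w' a \<longleftrightarrow> w b = w' b" if "(a, b) \<in> E" for a b
        proof -
          have "s (w a) = w b" "s (w' a) = w' b" using w that by (auto simp: embs_def carries_def)
          then show ?thesis using permutes_inj[OF s] by (metis injD)
        qed
        have along: "w a = w' a" if "(a, b) \<in> R" "w b = w' b" for a b
          using that unfolding R_def
          by (induction rule: converse_rtrancl_induct) (use step in auto)
        show "w = w'"
        proof
          fix x show "w x = w' x"
          proof (cases "x \<in> V")
            case True
            then have "c x \<in> T" unfolding T_def by auto
            then have "w (c x) = w' (c x)" using fun_cong[OF eq, of "c x"] by simp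
            then show ?thesis using along[OF c_R] by simp
          next
            case False
            then show ?thesis using w by (auto simp: embs_def inj_funs_def PiE_def extensional_def)
          qed
        qed
      qed
      show "(\<lambda>w. restrict w T) ` embs V E n s \<subseteq> PiE T X" using X by auto
    qed (use finT finX in \<open>auto intro: finite_PiE\<close>)
    then show ?thesis using finT by (simp add: card_PiE)
  qed
  have w_in: "w r \<in> {1..n}" if "w \<in> embs V E n s" "r \<in> T" for w r s and n :: nat
  proof -
    have "w \<in> V \<rightarrow>\<^sub>E {1..n}" using that by (simp add: embs_def inj_funs_def)
    then show ?thesis using that TV by (meson PiE_mem subsetD)
  qed
  define L where "L = {r \<in> T. (r, r) \<in> E}"
  have LT: "L \<subseteq> T" and finL: "finite L" unfolding L_def using finT by auto
  have "card L + 2 * card (T - L) = (\<Sum>r\<in>L. 1) + (\<Sum>r\<in>T - L. 2)" by simp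
  also have "\<dots> \<le> (\<Sum>r\<in>L. card (F r)) + (\<Sum>r\<in>T - L. card (F r))"
    by (intro add_mono sum_mono F1 F2) (auto simp: L_def)
  also have "\<dots> = card V"
    unfolding cardV using sum.subset_diff[OF LT finT, of "\<lambda>r. card (F r)"] by simp
  finally have VL: "card L + 2 * card (T - L) \<le> card V" .
  show thesis
  proof (cases "L = {}")
    case False
    show thesis
    proof (rule loop[of "card L" "card (T - L)"])
      show "1 \<le> card L" using False finL by (simp add: Suc_leI card_gt_0_iff)
      show "2 * card (T - L) + card L \<le> card V" using VL by simp
      fix n s assume s: "s permutes {1..n::nat}"
      have "card (embs V E n s) \<le> (\<Prod>r\<in>T. card (if r \<in> L then fix_pts n s else {1..n}))"
      proof (rule emb_bound[OF s])
        fix w r assume w: "w \<in> embs V E n s" and r: "r \<in> T"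
        have "s (w r) = w r" if "r \<in> L"
          using that w unfolding L_def embs_def carries_def by auto
        then show "w r \<in> (if r \<in> L then fix_pts n s else {1..n})"
          using w_in[OF w r] by (auto simp: fix_pts_def)
      qed auto
      also have "\<dots> = (\<Prod>r\<in>T - L. n) * (\<Prod>r\<in>L. card (fix_pts n s))"
        by (subst prod.subset_diff[OF LT finT]) (auto intro!: arg_cong2[of _ _ _ _ "(*)"] prod.cong)
      finally show "card (embs V E n s) \<le> card (fix_pts n s) ^ card L * n ^ card (T - L)"
        by (simp add: mult.commute)
    qed
  next
    case True
    have no_loop: "(a, a) \<notin> E" for a
      using True c_loop[of a] EV[of a a] unfolding L_def T_def by blast
    have VT: "2 * card T \<le> card V" using VL True by simp
    show thesis
    proof (cases "2 * card T = card V")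
      case False
      show thesis
      proof (rule large[of "card T"])
        show "2 * card T < card V" using False VT by simp
        fix n s assume s: "s permutes {1..n::nat}"
        have "card (embs V E n s) \<le> (\<Prod>r\<in>T. card {1..n})"
          by (rule emb_bound[OF s]) (use w_in in auto)
        then show "card (embs V E n s) \<le> n ^ card T" by simp
      qed
    next
      case eqVT: True
      have F_eq2: "card (F r) = 2" if "r \<in> T" for r
      proof (rule ccontr)
        assume ne: "card (F r) \<noteq> 2"
        have "(\<Sum>r\<in>T. 2) < (\<Sum>r\<in>T. card (F r))"
        proof (rule sum_strict_mono_ex1[OF finT])
          show "\<forall>x\<in>T. 2 \<le> card (F x)" using F2 no_loop by auto
          show "\<exists>a\<in>T. 2 < card (F a)" using ne that F2[OF that] no_loop by (intro bexI[of _ r]) force+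
        qed
        then show False using cardV eqVT by simp
      qed
      have "V = fst ` E \<union> snd ` E" using E unfolding Field_def by force
      then have "card V \<le> card (fst ` E) + card (snd ` E)" by (simp add: card_Un_le)
      also have "\<dots> \<le> card E + card E" by (intro add_mono card_image_le finE)
      finally have "card T < card E" using eqVT not_matching by linarith
      moreover have "(\<lambda>e. c (fst e)) ` E \<subseteq> T" unfolding T_def using EV by auto
      ultimately have "\<not> inj_on (\<lambda>e. c (fst e)) E"
        using card_inj_on_le[of "\<lambda>e. c (fst e)" E T] finT by fastforce
      then obtain e e' where "e \<in> E" "e' \<in> E" "e \<noteq> e'" "c (fst e) = c (fst e')"
        unfolding inj_on_def by blast
      moreover obtain a b where "e = (a, b)" by (cases e)
      moreover obtain a' b' where "e' = (a', b')" by (cases e')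
      ultimately have e: "(a, b) \<in> E" "(a', b') \<in> E" "(a, b) \<noteq> (a', b')" "c a = c a'"
        by auto
      define r where "r = c a"
      have rT: "r \<in> T" unfolding r_def T_def using EV[OF e(1)] by auto
      have cb: "c b = r" "c b' = r" using c_eq[OF R_E[OF e(1)]] c_eq[OF R_E[OF e(2)]] e(4) r_def by auto
      have inF: "a \<in> F r" "b \<in> F r" "a' \<in> F r" "b' \<in> F r"
        using EV[OF e(1)] EV[OF e(2)] cb e(4) unfolding F_def r_def by auto
      obtain x y where Fxy: "F r = {x, y}" using F_eq2[OF rT] by (metis card_2_iff)
      have "a \<noteq> b" "a' \<noteq> b'" using e no_loop by auto
      then have ba: "(b, a) \<in> E" "F r = {a, b}" using e inF Fxy by auto
      then have r_ab: "r = a \<or> r = b" using rF[OF rT] by auto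
      show thesis
      proof (rule two_cycle[of "card T - 1"])
        have "card T \<ge> 1" using rT finT by (metis One_nat_def Suc_leI card_gt_0_iff empty_iff)
        then show "2 * (card T - 1) + 2 \<le> card V" using eqVT by simp
        fix n s assume s: "s permutes {1..n::nat}"
        have "card (embs V E n s) \<le> (\<Prod>t\<in>T. card (if t = r then two_pts n s else {1..n}))"
        proof (rule emb_bound[OF s])
          fix w t assume w: "w \<in> embs V E n s" and t: "t \<in> T"
          have "s (w a) = w b" "s (w b) = w a" "inj_on w V"
            using w e(1) ba unfolding embs_def carries_def inj_funs_def by auto
          moreover from this have "w a \<noteq> w b" using EV[OF e(1)] \<open>a \<noteq> b\<close> by (auto dest: inj_onD)
          ultimately have "s (s (w r)) = w r \<and> s (w r) \<noteq> w r" using r_ab by auto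
          then show "w t \<in> (if t = r then two_pts n s else {1..n})"
            using w_in[OF w t] by (auto simp: two_pts_def)
        qed auto
        also have "\<dots> = card (two_pts n s) * (\<Prod>t\<in>T - {r}. n)"
          by (subst prod.remove[OF finT rT]) (auto intro!: arg_cong2[of _ _ _ _ "(*)"] prod.cong)
        finally show "card (embs V E n s) \<le> card (two_pts n s) * n ^ (card T - 1)"
          using rT finT by simp
      qed
    qed
  qed
qed

section \<open>Sorting the pairs of injections by their kernel\<close>

definition conv_pmf :: "('x \<Rightarrow> 'x) pmf \<Rightarrow> ('x \<Rightarrow> 'x) pmf \<Rightarrow> ('x \<Rightarrow> 'x) pmf" where
  "conv_pmf p q = map_pmf (\<lambda>(s, t). s \<circ> t) (pair_pmf p q)"

definition conj_invariant :: "nat \<Rightarrow> (nat \<Rightarrow> nat) pmf \<Rightarrow> bool" where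
  "conj_invariant n p \<longleftrightarrow> (\<forall>\<tau>\<in>perms n. map_pmf (\<lambda>s. inv \<tau> \<circ> s \<circ> \<tau>) p = p)"

text \<open>
  These are the embeddings of the functional graph of \<open>\<rho>\<close> into that of \<open>s\<close>, that is, the ways
  to find cycles of \<open>s\<close> arranged like those of \<open>\<rho>\<close>.
\<close>

definition equivariant :: "'i set \<Rightarrow> ('i \<Rightarrow> 'i) \<Rightarrow> nat \<Rightarrow> (nat \<Rightarrow> nat) \<Rightarrow> ('i \<Rightarrow> nat) set" where
  "equivariant I \<rho> n s = {x \<in> inj_funs I {1..n}. \<forall>u\<in>I. s (x u) = x (\<rho> u)}"

lemma finite_set_pmf_perms: "set_pmf p \<subseteq> perms n \<Longrightarrow> finite (set_pmf p)"
  using finite_permutations[of "{1..n}"] finite_subset by auto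

lemma expectation_mono_finite:
  fixes f g :: "'x \<Rightarrow> real"
  assumes "finite (set_pmf p)" "\<And>x. x \<in> set_pmf p \<Longrightarrow> f x \<le> g x"
  shows "measure_pmf.expectation p f \<le> measure_pmf.expectation p g"
  using assms by (intro integral_mono_AE) (auto simp: AE_measure_pmf_iff integrable_measure_pmf_finite)

lemma expectation_pair_mult:
  fixes f :: "'x \<Rightarrow> real" and g :: "'y \<Rightarrow> real"
  assumes p: "finite (set_pmf p)" and q: "finite (set_pmf q)"
  shows "measure_pmf.expectation (pair_pmf p q) (\<lambda>(s, t). f s * g t) =
         measure_pmf.expectation p f * measure_pmf.expectation q g"
proof -
  have "measure_pmf.expectation (pair_pmf p q) (\<lambda>(s, t). f s * g t) =
      (\<Sum>x\<in>set_pmf p \<times> set_pmf q. (case x of (s, t) \<Rightarrow> f s * g t) * pmf (pair_pmf p q) x)"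
    by (rule integral_measure_pmf_real) (use p q in auto)
  also have "\<dots> = (\<Sum>s\<in>set_pmf p. \<Sum>t\<in>set_pmf q. (f s * pmf p s) * (g t * pmf q t))"
    by (auto simp: sum.cartesian_product pmf_pair intro!: sum.cong)
  also have "\<dots> = (\<Sum>s\<in>set_pmf p. f s * pmf p s) * (\<Sum>t\<in>set_pmf q. g t * pmf q t)"
    by (simp add: sum_product)
  also have "\<dots> = measure_pmf.expectation p f * measure_pmf.expectation q g"
    by (subst (1 2) integral_measure_pmf_real[where A = "set_pmf _"]) (use p q in auto)
  finally show ?thesis .
qed

text \<open>
  A bijection between two subsets of \<open>{1..n}\<close> extends to a permutation, because the complements
  have the same size.
\<close>

lemma injections_conjugate:
  fixes w w' :: "'v \<Rightarrow> nat"
  assumes V: "finite V" and w: "w \<in> inj_funs V {1..n}" and w': "w' \<in> inj_funs V {1..n}"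
  obtains \<tau> where "\<tau> permutes {1..n}" "\<And>a. a \<in> V \<Longrightarrow> \<tau> (w' a) = w a"
proof -
  have inj: "inj_on w V" "inj_on w' V" and img: "w ` V \<subseteq> {1..n}" "w' ` V \<subseteq> {1..n}"
    using w w' unfolding inj_funs_def by auto
  have "card ({1..n} - w' ` V) = card ({1..n} - w ` V)"
    using V inj img by (simp add: card_Diff_subset card_image)
  then obtain g where g: "bij_betw g ({1..n} - w' ` V) ({1..n} - w ` V)"
    using finite_same_card_bij[of "{1..n} - w' ` V" "{1..n} - w ` V"] by auto
  define \<tau> where "\<tau> = (\<lambda>x. if x \<in> w' ` V then w (inv_into V w' x) else if x \<in> {1..n} then g x else x)"
  have \<tau>w: "\<tau> (w' a) = w a" if "a \<in> V" for a
    using that inj unfolding \<tau>_def by simp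
  have "bij_betw (w \<circ> inv_into V w') (w' ` V) (w ` V)"
    using inj by (intro bij_betw_trans[OF bij_betw_inv_into]) (auto simp: bij_betw_def)
  then have 1: "bij_betw \<tau> (w' ` V) (w ` V)"
    by (rule bij_betw_cong[THEN iffD1, rotated]) (simp add: \<tau>_def)
  have 2: "bij_betw \<tau> ({1..n} - w' ` V) ({1..n} - w ` V)"
    by (rule bij_betw_cong[THEN iffD1, OF _ g]) (simp add: \<tau>_def)
  have "bij_betw \<tau> (w' ` V \<union> ({1..n} - w' ` V)) (w ` V \<union> ({1..n} - w ` V))"
    by (rule bij_betw_combine[OF 1 2]) auto
  then have "bij_betw \<tau> {1..n} {1..n}" using img by (simp add: Un_absorb1)
  moreover have "\<tau> x = x" if "x \<notin> {1..n}" for x using that img unfolding \<tau>_def by auto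
  ultimately have "\<tau> permutes {1..n}" by (rule bij_imp_permutes)
  then show thesis using \<tau>w that by blast
qed

text \<open>
  Conjugating by a permutation that moves \<open>w'\<close> to \<open>w\<close> exchanges the two events.
\<close>

lemma prob_carries_const:
  fixes E :: "('v \<times> 'v) set"
  assumes V: "finite V" and E: "Field E = V" and inv: "conj_invariant n p"
    and w: "w \<in> inj_funs V {1..n}" and w': "w' \<in> inj_funs V {1..n}"
  shows "measure_pmf.prob p {s. carries E s w'} = measure_pmf.prob p {s. carries E s w}"
proof -
  obtain \<tau> where \<tau>: "\<tau> permutes {1..n}" "\<And>a. a \<in> V \<Longrightarrow> \<tau> (w' a) = w a"
    using injections_conjugate[OF V w w'] by blast
  have *: "inv \<tau> x = y \<longleftrightarrow> x = \<tau> y" for x y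
    using permutes_inv_eq[OF \<tau>(1)] by auto
  have "carries E (inv \<tau> \<circ> s \<circ> \<tau>) w' \<longleftrightarrow> carries E s w" for s
  proof -
    have "\<tau> (w' a) = w a" "\<tau> (w' b) = w b" if "(a, b) \<in> E" for a b
      using \<tau>(2) that E by (auto simp: Field_def)
    then show ?thesis unfolding carries_def by (auto simp: *)
  qed
  moreover have "measure_pmf.prob p {s. carries E s w'} =
      measure_pmf.prob (map_pmf (\<lambda>s. inv \<tau> \<circ> s \<circ> \<tau>) p) {s. carries E s w'}"
    using inv \<tau>(1) unfolding conj_invariant_def by simp
  ultimately show ?thesis by simp
qed

lemma expectation_card_embs:
  assumes V: "finite V" and p: "finite (set_pmf p)"
  shows "measure_pmf.expectation p (\<lambda>s. real (card (embs V E n s))) =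
         (\<Sum>w\<in>inj_funs V {1..n}. measure_pmf.prob p {s. carries E s w})"
proof -
  have "real (card (embs V E n s)) = (\<Sum>w\<in>inj_funs V {1..n}. indicator {s. carries E s w} s)" for s
    using V by (simp add: embs_def indicator_def sum.If_cases Int_def)
  then show ?thesis
    by (simp add: Bochner_Integration.integral_sum integrable_measure_pmf_finite[OF p])
qed

text \<open>
  One of the two factors of the summand is constant in \<open>w\<close>, so the mean of the product is the
  product of the means.
\<close>

lemma sum_prob_carries:
  assumes V: "finite V" and E1: "Field E1 = V" and E2: "Field E2 = V"
    and p: "finite (set_pmf p)" and q: "finite (set_pmf q)"
    and inv: "conj_invariant n p \<or> conj_invariant n q"
  shows "(\<Sum>w\<in>inj_funs V {1..n}. measure_pmf.prob p {s. carries E1 s w} * measure_pmf.prob q {s. carries E2 s w}) =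
     measure_pmf.expectation p (\<lambda>s. real (card (embs V E1 n s))) *
     measure_pmf.expectation q (\<lambda>s. real (card (embs V E2 n s))) / real (card (inj_funs V {1..n}))"
proof (cases "inj_funs V {1..n} = {}")
  case True
  then show ?thesis by simp
next
  case False
  then obtain w0 where w0: "w0 \<in> inj_funs V {1..n}" by blast
  have N: "real (card (inj_funs V {1..n})) \<noteq> 0" using False V by simp
  have *: "(\<Sum>w\<in>inj_funs V {1..n}. f w * g w) = (\<Sum>w\<in>inj_funs V {1..n}. f w) * (\<Sum>w\<in>inj_funs V {1..n}. g w) / real (card (inj_funs V {1..n}))"
    if "\<And>w. w \<in> inj_funs V {1..n} \<Longrightarrow> g w = g w0" for f g :: "_ \<Rightarrow> real"
  proof -
    have "(\<Sum>w\<in>inj_funs V {1..n}. f w * g w) = (\<Sum>w\<in>inj_funs V {1..n}. f w) * g w0"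
      by (simp add: that sum_distrib_right)
    moreover have "(\<Sum>w\<in>inj_funs V {1..n}. g w) = card (inj_funs V {1..n}) * g w0"
      by (simp add: that)
    ultimately show ?thesis using N by simp
  qed
  from inv show ?thesis
  proof
    assume "conj_invariant n q"
    from *[where g = "\<lambda>w. measure_pmf.prob q {s. carries E2 s w}"
          and f = "\<lambda>w. measure_pmf.prob p {s. carries E1 s w}", OF prob_carries_const[OF V E2 this w0]]
    show ?thesis
      by (simp add: expectation_card_embs[OF V p] expectation_card_embs[OF V q])
  next
    assume "conj_invariant n p"
    from *[where g = "\<lambda>w. measure_pmf.prob p {s. carries E1 s w}"
          and f = "\<lambda>w. measure_pmf.prob q {s. carries E2 s w}", OF prob_carries_const[OF V E1 this w0]]
    show ?thesis
      by (simp add: expectation_card_embs[OF V p] expectation_card_embs[OF V q] mult.commute)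
  qed
qed

text \<open>
  The possible coincidence patterns of two injections on \<open>I\<close>, taken together as one function on
  the disjoint sum: an equivalence relation that never relates two elements of the same copy
  of \<open>I\<close>.
\<close>

definition kernels :: "'i set \<Rightarrow> (('i + 'i) \<times> ('i + 'i)) set set" where
  "kernels I = {K. equiv (I <+> I) K \<and>
     (\<forall>u\<in>I. \<forall>v\<in>I. ((Inl u, Inl v) \<in> K \<longrightarrow> u = v) \<and> ((Inr u, Inr v) \<in> K \<longrightarrow> u = v))}"

definition inj_pairs :: "'i set \<Rightarrow> nat \<Rightarrow> ('i + 'i \<Rightarrow> nat) set" where
  "inj_pairs I n = {z \<in> (I <+> I) \<rightarrow>\<^sub>E {1..n}. inj_on (z \<circ> Inl) I \<and> inj_on (z \<circ> Inr) I}"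

lemma finite_inj_pairs [simp]: "finite I \<Longrightarrow> finite (inj_pairs I n)"
  unfolding inj_pairs_def by (rule finite_subset[OF _ finite_PiE[of "I <+> I" "\<lambda>_. {1..n}"]]) auto

lemma finite_kernels: "finite I \<Longrightarrow> finite (kernels I)"
  unfolding kernels_def equiv_def
  by (rule finite_subset[of _ "Pow ((I <+> I) \<times> (I <+> I))"]) (auto simp: refl_on_def)

lemma equiv_kernels: "K \<in> kernels I \<Longrightarrow> equiv (I <+> I) K"
  unfolding kernels_def by blast

text \<open>
  Every function factors uniquely through the quotient by its kernel, and the induced function
  on the quotient is injective.
\<close>

lemma bij_betw_kernels_inj_pairs:
  "bij_betw (\<lambda>(K, w). \<lambda>a\<in>I <+> I. w (K `` {a}))
     (SIGMA K:kernels I. inj_funs ((I <+> I) // K) {1..n}) (inj_pairs I n)"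
proof -
  let ?J = "I <+> I"
  let ?\<Psi> = "\<lambda>(K, w). \<lambda>a\<in>?J. w (K `` {a})"
  have ker: "K = {(a, b) \<in> ?J \<times> ?J. w (K `` {a}) = w (K `` {b})}"
    if K: "K \<in> kernels I" and w: "w \<in> inj_funs (?J // K) {1..n}" for K w
  proof -
    have eq: "equiv ?J K" by (rule equiv_kernels[OF K])
    have iff: "w (K `` {a}) = w (K `` {b}) \<longleftrightarrow> (a, b) \<in> K" if "a \<in> ?J" "b \<in> ?J" for a b
    proof -
      have "w (K `` {a}) = w (K `` {b}) \<longleftrightarrow> K `` {a} = K `` {b}"
        using inj_on_eq_iff[OF _ quotientI[OF that(1)] quotientI[OF that(2)], of w] w
        unfolding inj_funs_def by simp
      also have "\<dots> \<longleftrightarrow> (a, b) \<in> K" using eq_equiv_class_iff[OF eq that] .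
      finally show ?thesis .
    qed
    have KJ: "K \<subseteq> ?J \<times> ?J" using eq by (rule equiv_type)
    show ?thesis
    proof (intro set_eqI)
      fix e :: "('a + 'a) \<times> ('a + 'a)"
      obtain a b where e: "e = (a, b)" by (cases e)
      have "(a, b) \<in> K \<longleftrightarrow> a \<in> ?J \<and> b \<in> ?J \<and> w (K `` {a}) = w (K `` {b})"
        using subsetD[OF KJ, of "(a, b)"] iff[of a b] unfolding mem_Sigma_iff by argo
      then show "e \<in> K \<longleftrightarrow> e \<in> {(a, b) \<in> ?J \<times> ?J. w (K `` {a}) = w (K `` {b})}"
        unfolding e by simp
    qed
  qed
  show ?thesis
    unfolding bij_betw_def
  proof
    show "inj_on ?\<Psi> (SIGMA K:kernels I. inj_funs (?J // K) {1..n})"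
    proof (rule inj_onI, clarify)
      fix K w K' w'
      assume K: "K \<in> kernels I" and w: "w \<in> inj_funs (?J // K) {1..n}"
        and K': "K' \<in> kernels I" and w': "w' \<in> inj_funs (?J // K') {1..n}"
        and eq: "(\<lambda>a\<in>?J. w (K `` {a})) = (\<lambda>a\<in>?J. w' (K' `` {a}))"
      have val: "w (K `` {a}) = w' (K' `` {a})" if "a \<in> ?J" for a
        using fun_cong[OF eq, of a] that by simp
      have KK: "K = K'"
        by (subst ker[OF K w], subst ker[OF K' w'], intro Collect_cong)
          (simp add: val case_prod_beta mem_Times_iff cong: conj_cong)
      have "w C = w' C" for C
      proof (cases "C \<in> ?J // K")
        case True
        then obtain a where "a \<in> ?J" "C = K `` {a}" by (rule quotientE)
        then show ?thesis using val KK by simp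
      next
        case False
        then show ?thesis using w w' KK by (auto simp: inj_funs_def PiE_def extensional_def)
      qed
      then show "K = K' \<and> w = w'" using KK by auto
    qed
    show "?\<Psi> ` (SIGMA K:kernels I. inj_funs (?J // K) {1..n}) = inj_pairs I n"
    proof (intro equalityI subsetI)
      fix z assume "z \<in> ?\<Psi> ` (SIGMA K:kernels I. inj_funs (?J // K) {1..n})"
      then obtain K w where K: "K \<in> kernels I" and w: "w \<in> inj_funs (?J // K) {1..n}"
        and z: "z = (\<lambda>a\<in>?J. w (K `` {a}))" by auto
      have 1: "w (K `` {a}) \<in> {1..n}" if "a \<in> ?J" for a
        using w quotientI[OF that, of K] unfolding inj_funs_def by blast
      have 2: "(a, b) \<in> K" if "a \<in> ?J" "b \<in> ?J" "z a = z b" for a b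
        using that by (subst ker[OF K w]) (simp add: z)
      have "u = v" if "u \<in> I" "v \<in> I" "z (Inl u) = z (Inl v)" for u v
        using 2[OF InlI[OF that(1)] InlI[OF that(2)] that(3)] that K unfolding kernels_def by blast
      moreover have "u = v" if "u \<in> I" "v \<in> I" "z (Inr u) = z (Inr v)" for u v
        using 2[OF InrI[OF that(1)] InrI[OF that(2)] that(3)] that K unfolding kernels_def by blast
      moreover have "z \<in> ?J \<rightarrow>\<^sub>E {1..n}" unfolding z using 1 unfolding restrict_PiE_iff by blast
      ultimately show "z \<in> inj_pairs I n"
        unfolding inj_pairs_def inj_on_def by simp
    next
      fix z assume z: "z \<in> inj_pairs I n"
      define K where "K = {(a, b) \<in> ?J \<times> ?J. z a = z b}"
      define w where "w = (\<lambda>C\<in>?J // K. z (SOME a. a \<in> C))"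
      have eqv: "equiv ?J K"
        unfolding K_def by (intro equivI refl_onI symI transI) auto
      have K: "K \<in> kernels I"
      proof -
        have "u = v" if "u \<in> I" "v \<in> I" "(Inl u, Inl v) \<in> K" for u v
          using z that inj_onD[of "z \<circ> Inl" I u v] by (simp add: K_def inj_pairs_def)
        moreover have "u = v" if "u \<in> I" "v \<in> I" "(Inr u, Inr v) \<in> K" for u v
          using z that inj_onD[of "z \<circ> Inr" I u v] by (simp add: K_def inj_pairs_def)
        ultimately show ?thesis unfolding kernels_def using eqv by simp
      qed
      have Kz: "z a = z b" if "(a, b) \<in> K" for a b using that by (simp add: K_def)
      have wz: "w (K `` {a}) = z a" if "a \<in> ?J" for a
      proof -
        have "a \<in> K `` {a}" using that by (simp add: K_def)
        then have "(SOME b. b \<in> K `` {a}) \<in> K `` {a}" by (rule someI)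
        then have "z a = z (SOME b. b \<in> K `` {a})" using Kz by blast
        then show ?thesis using quotientI[OF that, of K] unfolding w_def by simp
      qed
      have w: "w \<in> inj_funs (?J // K) {1..n}"
        unfolding inj_funs_def
      proof (intro CollectI conjI PiE_I inj_onI)
        fix C assume "C \<in> ?J // K"
        then obtain a where a: "a \<in> ?J" "C = K `` {a}" by (rule quotientE)
        have "z a \<in> {1..n}" using z a unfolding inj_pairs_def by blast
        then show "w C \<in> {1..n}" using a wz by simp
      next
        fix C assume "C \<notin> ?J // K" then show "w C = undefined" by (simp add: w_def)
      next
        fix C C' assume C: "C \<in> ?J // K" "C' \<in> ?J // K" and eq: "w C = w C'"
        obtain a where a: "a \<in> ?J" "C = K `` {a}" using C(1) by (rule quotientE)
        obtain b where b: "b \<in> ?J" "C' = K `` {b}" using C(2) by (rule quotientE)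
        have "(a, b) \<in> K" using eq a b wz by (simp add: K_def)
        then show "C = C'" unfolding a b by (rule equiv_class_eq[OF eqv])
      qed
      have "z = (\<lambda>a\<in>?J. w (K `` {a}))"
        using z wz by (auto simp: inj_pairs_def PiE_def extensional_def fun_eq_iff)
      then show "z \<in> ?\<Psi> ` (SIGMA K:kernels I. inj_funs (?J // K) {1..n})"
        using K w by force
    qed
  qed
qed

lemma sum_by_kernel:
  fixes F :: "_ \<Rightarrow> real"
  assumes I: "finite I"
  shows "(\<Sum>z\<in>inj_pairs I n. F z) =
     (\<Sum>K\<in>kernels I. \<Sum>w\<in>inj_funs ((I <+> I) // K) {1..n}. F (\<lambda>a\<in>I <+> I. w (K `` {a})))"
proof -
  have fin: "finite (inj_funs ((I <+> I) // K) {1..n})" if "K \<in> kernels I" for K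
    using I equiv_type[OF equiv_kernels[OF that]]
    by (intro finite_inj_funs finite_quotient) auto
  have "(\<Sum>z\<in>inj_pairs I n. F z) =
      (\<Sum>y\<in>(SIGMA K:kernels I. inj_funs ((I <+> I) // K) {1..n}). F (case y of (K, w) \<Rightarrow> \<lambda>a\<in>I <+> I. w (K `` {a})))"
    by (rule sum.reindex_bij_betw[OF bij_betw_kernels_inj_pairs, symmetric])
  also have "\<dots> = (\<Sum>K\<in>kernels I. \<Sum>w\<in>inj_funs ((I <+> I) // K) {1..n}. F (\<lambda>a\<in>I <+> I. w (K `` {a})))"
    by (subst sum.Sigma) (use finite_kernels[OF I] fin in \<open>auto intro!: sum.cong\<close>)
  finally show ?thesis .
qed

text \<open>
  The constraints \<open>s (z (\<alpha> u)) = z (\<beta> u)\<close>, for \<open>u \<in> I\<close>, seen as a graph on the classes of the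
  kernel \<open>K\<close> of \<open>z\<close>.
\<close>

definition class_edges :: "'i set \<Rightarrow> ('i \<Rightarrow> 'j) \<Rightarrow> ('i \<Rightarrow> 'j) \<Rightarrow> ('j \<times> 'j) set \<Rightarrow> ('j set \<times> 'j set) set" where
  "class_edges I \<alpha> \<beta> K = (\<lambda>u. (K `` {\<alpha> u}, K `` {\<beta> u})) ` I"

lemma carries_class_edges:
  assumes "\<And>u. u \<in> I \<Longrightarrow> \<alpha> u \<in> J" "\<And>u. u \<in> I \<Longrightarrow> \<beta> u \<in> J"
  shows "carries (class_edges I \<alpha> \<beta> K) s w \<longleftrightarrow>
    (\<forall>u\<in>I. s ((\<lambda>a\<in>J. w (K `` {a})) (\<alpha> u)) = (\<lambda>a\<in>J. w (K `` {a})) (\<beta> u))"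
  using assms unfolding carries_def class_edges_def by simp

lemma Field_class_edges:
  "\<alpha> ` I \<union> \<beta> ` I = J \<Longrightarrow> Field (class_edges I \<alpha> \<beta> K) = J // K"
  unfolding class_edges_def Field_def quotient_def by (auto simp: Domain.simps Range.simps)

lemma card_class_edges:
  assumes eq: "equiv J K" and \<alpha>: "\<And>u. u \<in> I \<Longrightarrow> \<alpha> u \<in> J"
    and inj: "\<And>u v. u \<in> I \<Longrightarrow> v \<in> I \<Longrightarrow> (\<alpha> u, \<alpha> v) \<in> K \<Longrightarrow> u = v"
  shows "card (class_edges I \<alpha> \<beta> K) = card I"
  unfolding class_edges_def
  by (rule card_image) (use inj eq_equiv_class_iff[OF eq \<alpha> \<alpha>] in \<open>auto intro!: inj_onI\<close>)

abbreviation left_edges :: "'i set \<Rightarrow> ('i \<Rightarrow> 'i) \<Rightarrow> (('i + 'i) \<times> ('i + 'i)) set \<Rightarrow> (('i + 'i) set \<times> ('i + 'i) set) set" where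
  "left_edges I \<rho> K \<equiv> class_edges I Inr (\<lambda>u. Inl (\<rho> u)) K"

abbreviation right_edges :: "'i set \<Rightarrow> (('i + 'i) \<times> ('i + 'i)) set \<Rightarrow> (('i + 'i) set \<times> ('i + 'i) set) set" where
  "right_edges I K \<equiv> class_edges I Inl Inr K"

text \<open>
  No two constraints merge when passing to the quotient, so both graphs keep \<open>card I\<close> edges.
  The number of vertices lies between \<open>card I\<close> and \<open>2 * card I\<close>, and the maximum is attained
  exactly when nothing is identified. Comparing with the number of edges, this means that the
  discrete kernel is the only one for which the graph is a set of disjoint edges.
\<close>

lemma kernel_edges:
  assumes I: "finite I" and \<rho>: "bij_betw \<rho> I I" and K: "K \<in> kernels I"
  shows "finite ((I <+> I) // K)"
    and "Field (left_edges I \<rho> K) = (I <+> I) // K"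
    and "Field (right_edges I K) = (I <+> I) // K"
    and "card (left_edges I \<rho> K) = card I"
    and "card (right_edges I K) = card I"
    and "card I \<le> card ((I <+> I) // K)"
    and "card ((I <+> I) // K) \<le> 2 * card I"
    and "card ((I <+> I) // K) = 2 * card I \<longleftrightarrow> K = Id_on (I <+> I)"
proof -
  let ?J = "I <+> I"
  have eq: "equiv ?J K" by (rule equiv_kernels[OF K])
  show fin: "finite (?J // K)" using I equiv_type[OF eq] by (intro finite_quotient) auto
  show "Field (left_edges I \<rho> K) = ?J // K"
    using bij_betw_imp_surj_on[OF \<rho>] by (intro Field_class_edges) force
  show "Field (right_edges I K) = ?J // K"
    by (intro Field_class_edges) auto
  show "card (left_edges I \<rho> K) = card I"
    by (rule card_class_edges[OF eq]) (use K in \<open>auto simp: kernels_def\<close>)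
  show right: "card (right_edges I K) = card I"
    by (rule card_class_edges[OF eq]) (use K in \<open>auto simp: kernels_def\<close>)
  have "card (fst ` right_edges I K) = card I"
    unfolding class_edges_def image_image fst_conv
  proof (rule card_image, rule inj_onI)
    fix u v assume "u \<in> I" "v \<in> I" "K `` {Inl u} = K `` {Inl v}"
    then have "(Inl u, Inl v) \<in> K" using eq_equiv_class_iff[OF eq, of "Inl u" "Inl v"] by blast
    then show "u = v" using K \<open>u \<in> I\<close> \<open>v \<in> I\<close> unfolding kernels_def by blast
  qed
  moreover have "fst ` right_edges I K \<subseteq> ?J // K"
    unfolding class_edges_def quotient_def by auto
  ultimately show "card I \<le> card (?J // K)" using card_mono[OF fin] by metis
  have img: "?J // K = (\<lambda>a. K `` {a}) ` ?J" unfolding quotient_def by auto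
  have cJ: "card ?J = 2 * card I" using I by (simp add: card_Plus)
  have fJ: "finite ?J" using I by simp
  show "card (?J // K) \<le> 2 * card I" unfolding img cJ[symmetric] by (rule card_image_le[OF fJ])
  show "card (?J // K) = 2 * card I \<longleftrightarrow> K = Id_on ?J"
  proof
    assume "card (?J // K) = 2 * card I"
    then have "inj_on (\<lambda>a. K `` {a}) ?J" unfolding img cJ[symmetric] by (rule eq_card_imp_inj_on[OF fJ])
    then have "a = b" if "(a, b) \<in> K" for a b
      using equiv_class_eq[OF eq that] that equiv_type[OF eq] by (auto dest: inj_onD)
    moreover have "(a, a) \<in> K" if "a \<in> ?J" for a using eq that by (auto simp: equiv_def refl_on_def)
    ultimately show "K = Id_on ?J" using equiv_type[OF eq] by auto
  next
    assume "K = Id_on ?J"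
    then have "a = b" if "(a, b) \<in> K" for a b using that by (simp add: Id_on_iff)
    then have "inj_on (\<lambda>a. K `` {a}) ?J"
      by (intro inj_onI) (simp add: eq_equiv_class_iff[OF eq])
    then show "card (?J // K) = 2 * card I" unfolding img cJ[symmetric] by (rule card_image)
  qed
qed

lemma Id_on_kernels: "Id_on (I <+> I) \<in> kernels I"
  unfolding kernels_def by (auto simp: equiv_def refl_on_def sym_def trans_def)

text \<open>
  If the second injection is the image of the first under a permutation, the pair carries no
  more information than the first injection.
\<close>

lemma card_inj_pairs_graph:
  assumes I: "finite I" and g: "g permutes {1..n::nat}" and \<rho>: "bij_betw \<rho> I I"
  shows "card {z \<in> inj_pairs I n. (\<forall>u\<in>I. z (Inr u) = g (z (Inl (\<rho> u)))) \<and> P (\<lambda>u\<in>I. z (Inl u))} =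
         card {x \<in> inj_funs I {1..n}. P x}" (is "card ?A = card ?B")
proof (rule bij_betw_same_card)
  let ?f = "\<lambda>z. \<lambda>u\<in>I. z (Inl u)"
  let ?h = "\<lambda>x. \<lambda>a\<in>I <+> I. case a of Inl u \<Rightarrow> x u | Inr u \<Rightarrow> g (x (\<rho> u))"
  have \<rho>I: "\<rho> u \<in> I" if "u \<in> I" for u using bij_betw_apply[OF \<rho> that] .
  show "bij_betw ?f ?A ?B"
  proof (rule bij_betw_byWitness[where f' = ?h])
    show "\<forall>z\<in>?A. ?h (?f z) = z"
    proof (intro ballI ext)
      fix z a assume z: "z \<in> ?A"
      have zJ: "z \<in> (I <+> I) \<rightarrow>\<^sub>E {1..n}" using z unfolding inj_pairs_def mem_Collect_eq by (elim conjE)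
      have zr: "z (Inr u) = g (z (Inl (\<rho> u)))" if "u \<in> I" for u using z that unfolding mem_Collect_eq by (elim conjE) (rule bspec)
      consider u where "a = Inl u" "u \<in> I" | u where "a = Inr u" "u \<in> I" | "a \<notin> I <+> I"
        by (metis PlusE)
      then show "?h (?f z) a = z a"
      proof cases
        case 1 then show ?thesis by (simp add: InlI)
      next
        case 2 then show ?thesis using zr[OF 2(2)] by (simp add: InrI \<rho>I)
      next
        case 3 then show ?thesis using PiE_arb[OF zJ 3] by simp
      qed
    qed
    show "\<forall>x\<in>?B. ?f (?h x) = x"
      by (auto simp: inj_funs_def PiE_def extensional_def fun_eq_iff)
    show "?f ` ?A \<subseteq> ?B"
    proof (intro subsetI, elim imageE, simp only:)
      fix z assume z: "z \<in> ?A"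
      then have zJ: "z \<in> (I <+> I) \<rightarrow>\<^sub>E {1..n}" and inj: "inj_on (z \<circ> Inl) I" and P: "P (?f z)"
        unfolding inj_pairs_def mem_Collect_eq by simp_all
      have "z (Inl u) \<in> {1..n}" if "u \<in> I" for u using PiE_mem[OF zJ] that by blast
      moreover have "inj_on (?f z) I" using inj unfolding inj_on_def by simp
      ultimately show "?f z \<in> ?B" using P unfolding inj_funs_def by simp
    qed
    show "?h ` ?B \<subseteq> ?A"
    proof (intro subsetI, elim imageE, simp only:)
      fix x assume x: "x \<in> ?B"
      have xI: "x u \<in> {1..n}" if "u \<in> I" for u using x that unfolding inj_funs_def by blast
      have inj: "inj_on x I" using x unfolding inj_funs_def by blast
      have "inj_on (\<lambda>u. g (x (\<rho> u))) I"
        using inj \<rho>I bij_betw_imp_inj_on[OF \<rho>] injD[OF permutes_inj[OF g]] by (auto simp: inj_on_def)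
      moreover have "g (x (\<rho> u)) \<in> {1..n}" if "u \<in> I" for u
        using permutes_in_image[OF g] xI[OF \<rho>I[OF that]] by blast
      moreover have "?f (?h x) = x" using x
        by (auto simp: inj_funs_def PiE_def extensional_def fun_eq_iff)
      ultimately show "?h x \<in> ?A"
        using x xI inj \<rho>I by (auto simp: inj_pairs_def inj_on_def)
    qed
  qed
qed

section \<open>Expected number of equivariant injections into a product\<close>

text \<open>
  The condition on the product \<open>s \<circ> t\<close> is split by introducing the intermediate injection
  \<open>z \<circ> Inr = t \<circ> (z \<circ> Inl)\<close>; the two indicators then depend on \<open>s\<close> alone and on \<open>t\<close> alone.
\<close>

lemma card_equivariant_comp:
  assumes I: "finite I" and \<rho>: "\<And>u. u \<in> I \<Longrightarrow> \<rho> u \<in> I" and t: "t permutes {1..n::nat}"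
  shows "real (card (equivariant I \<rho> n (s \<circ> t))) =
    (\<Sum>z\<in>inj_pairs I n. indicator {s. \<forall>u\<in>I. s (z (Inr u)) = z (Inl (\<rho> u))} s *
                       indicator {t. \<forall>u\<in>I. t (z (Inl u)) = z (Inr u)} t)"
proof -
  let ?P = "\<lambda>x. \<forall>u\<in>I. s (t (x u)) = x (\<rho> u)"
  let ?Q = "\<lambda>z. (\<forall>u\<in>I. s (z (Inr u)) = z (Inl (\<rho> u))) \<and> (\<forall>u\<in>I. t (z (Inl u)) = z (Inr u))"
  have "card (equivariant I \<rho> n (s \<circ> t)) = card {x \<in> inj_funs I {1..n}. ?P x}"
    by (simp add: equivariant_def)
  also have "\<dots> = card {z \<in> inj_pairs I n. (\<forall>u\<in>I. z (Inr u) = t (z (Inl (id u)))) \<and> ?P (\<lambda>u\<in>I. z (Inl u))}"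
    by (rule card_inj_pairs_graph[OF I t bij_betw_id, symmetric])
  also have "{z \<in> inj_pairs I n. (\<forall>u\<in>I. z (Inr u) = t (z (Inl (id u)))) \<and> ?P (\<lambda>u\<in>I. z (Inl u))} =
      {z \<in> inj_pairs I n. ?Q z}"
    by (intro Collect_cong) (auto simp: \<rho>)
  also have "real (card \<dots>) = (\<Sum>z\<in>inj_pairs I n. if ?Q z then 1 else 0)"
    using finite_inj_pairs[OF I, of n] by (simp add: sum.If_cases Int_def)
  also have "\<dots> = (\<Sum>z\<in>inj_pairs I n. indicator {s. \<forall>u\<in>I. s (z (Inr u)) = z (Inl (\<rho> u))} s *
                       indicator {t. \<forall>u\<in>I. t (z (Inl u)) = z (Inr u)} t)"
    by (rule sum.cong[OF refl]) (simp add: indicator_def)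
  finally show ?thesis .
qed

text \<open>
  By independence each pair of injections contributes a product of two probabilities. Grouping
  the pairs by kernel makes one of these probabilities constant within each group.
\<close>

lemma expectation_equivariant:
  assumes I: "finite I" and \<rho>: "bij_betw \<rho> I I"
    and p: "set_pmf p \<subseteq> perms n" and q: "set_pmf q \<subseteq> perms n"
    and inv: "conj_invariant n p \<or> conj_invariant n q"
  shows "measure_pmf.expectation (conv_pmf p q) (\<lambda>s. real (card (equivariant I \<rho> n s))) =
    (\<Sum>K\<in>kernels I.
       measure_pmf.expectation p (\<lambda>s. real (card (embs ((I <+> I) // K) (left_edges I \<rho> K) n s))) *
       measure_pmf.expectation q (\<lambda>s. real (card (embs ((I <+> I) // K) (right_edges I K) n s))) /
       real (card (inj_funs ((I <+> I) // K) {1..n})))"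
proof -
  note fp = finite_set_pmf_perms[OF p] and fq = finite_set_pmf_perms[OF q]
  let ?S = "\<lambda>z :: 'a + 'a \<Rightarrow> nat. {s. \<forall>u\<in>I. s (z (Inr u)) = z (Inl (\<rho> u))}"
  let ?T = "\<lambda>z :: 'a + 'a \<Rightarrow> nat. {t. \<forall>u\<in>I. t (z (Inl u)) = z (Inr u)}"
  have \<rho>I: "\<rho> u \<in> I" if "u \<in> I" for u using bij_betw_apply[OF \<rho> that] .
  have fpq: "finite (set_pmf (pair_pmf p q))" using fp fq by simp
  have "measure_pmf.expectation (conv_pmf p q) (\<lambda>s. real (card (equivariant I \<rho> n s))) =
      measure_pmf.expectation (pair_pmf p q) (\<lambda>x. real (card (equivariant I \<rho> n (fst x \<circ> snd x))))"
    unfolding conv_pmf_def by (simp add: case_prod_beta)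
  also have "\<dots> = measure_pmf.expectation (pair_pmf p q)
      (\<lambda>x. \<Sum>z\<in>inj_pairs I n. (case x of (s, t) \<Rightarrow> indicator (?S z) s * indicator (?T z) t))"
  proof (rule integral_cong_AE)
    show "AE x in pair_pmf p q. real (card (equivariant I \<rho> n (fst x \<circ> snd x))) =
        (\<Sum>z\<in>inj_pairs I n. (case x of (s, t) \<Rightarrow> indicator (?S z) s * indicator (?T z) t))"
    proof (rule AE_pmfI)
      fix x assume "x \<in> set_pmf (pair_pmf p q)"
      then have "snd x permutes {1..n}" using q by auto
      from card_equivariant_comp[where \<rho> = \<rho> and s = "fst x", OF I \<rho>I this]
      show "real (card (equivariant I \<rho> n (fst x \<circ> snd x))) =
        (\<Sum>z\<in>inj_pairs I n. (case x of (s, t) \<Rightarrow> indicator (?S z) s * indicator (?T z) t))"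
        by (simp only: case_prod_beta)
    qed
  qed simp_all
  also have "\<dots> = (\<Sum>z\<in>inj_pairs I n. measure_pmf.prob p (?S z) * measure_pmf.prob q (?T z))"
    by (subst Bochner_Integration.integral_sum)
       (simp_all add: integrable_measure_pmf_finite[OF fpq] expectation_pair_mult[OF fp fq])
  also have "\<dots> = (\<Sum>K\<in>kernels I. \<Sum>w\<in>inj_funs ((I <+> I) // K) {1..n}.
      measure_pmf.prob p {s. carries (left_edges I \<rho> K) s w} *
      measure_pmf.prob q {s. carries (right_edges I K) s w})"
    unfolding sum_by_kernel[OF I]
    by (subst (1 2) carries_class_edges[where J = "I <+> I"]) (auto simp: \<rho>I)
  also have "\<dots> = (\<Sum>K\<in>kernels I.
       measure_pmf.expectation p (\<lambda>s. real (card (embs ((I <+> I) // K) (left_edges I \<rho> K) n s))) *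
       measure_pmf.expectation q (\<lambda>s. real (card (embs ((I <+> I) // K) (right_edges I K) n s))) /
       real (card (inj_funs ((I <+> I) // K) {1..n})))"
    by (intro sum.cong refl sum_prob_carries kernel_edges[OF I \<rho>] fp fq inv)
  finally show ?thesis .
qed

text \<open>
  For a fixed permutation the second injection determines the first, so summing over all kernels
  counts all injections on \<open>I\<close>.
\<close>

lemma sum_card_embs_left:
  assumes I: "finite I" and \<rho>: "bij_betw \<rho> I I" and s: "s permutes {1..n::nat}"
  shows "(\<Sum>K\<in>kernels I. real (card (embs ((I <+> I) // K) (left_edges I \<rho> K) n s))) =
     real (card (inj_funs I {1..n}))"
proof -
  have \<rho>I: "\<rho> u \<in> I" if "u \<in> I" for u using bij_betw_apply[OF \<rho> that] .
  have "s x = y \<longleftrightarrow> x = inv s y" for x y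
    using permutes_inv_eq[OF s, of y x] by auto
  then have "card {z \<in> inj_pairs I n. \<forall>u\<in>I. s (z (Inr u)) = z (Inl (\<rho> u))} = card (inj_funs I {1..n})"
    using card_inj_pairs_graph[OF I permutes_inv[OF s] \<rho>, of "\<lambda>_. True"] by simp
  then have "real (card (inj_funs I {1..n})) =
      (\<Sum>z\<in>inj_pairs I n. indicator {z. \<forall>u\<in>I. s (z (Inr u)) = z (Inl (\<rho> u))} z)"
    using finite_inj_pairs[OF I, of n] by (simp add: indicator_def sum.If_cases Int_def)
  also have "\<dots> = (\<Sum>K\<in>kernels I. \<Sum>w\<in>inj_funs ((I <+> I) // K) {1..n}.
      indicator {w. carries (left_edges I \<rho> K) s w} w)"
    unfolding sum_by_kernel[OF I] indicator_def mem_Collect_eq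
    by (subst carries_class_edges[where J = "I <+> I"]) (auto simp: \<rho>I)
  also have "\<dots> = (\<Sum>K\<in>kernels I. real (card (embs ((I <+> I) // K) (left_edges I \<rho> K) n s)))"
    by (intro sum.cong refl)
       (simp add: embs_def indicator_def sum.If_cases Int_def kernel_edges(1)[OF I \<rho>])
  finally show ?thesis by simp
qed

lemma sum_card_embs_right:
  assumes I: "finite I" and s: "s permutes {1..n::nat}"
  shows "(\<Sum>K\<in>kernels I. real (card (embs ((I <+> I) // K) (right_edges I K) n s))) =
     real (card (inj_funs I {1..n}))"
proof -
  have "s x = y \<longleftrightarrow> y = s x" for x y by auto
  then have "card {z \<in> inj_pairs I n. \<forall>u\<in>I. s (z (Inl u)) = z (Inr u)} = card (inj_funs I {1..n})"
    using card_inj_pairs_graph[OF I s bij_betw_id, of "\<lambda>_. True"] by simp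
  then have "real (card (inj_funs I {1..n})) =
      (\<Sum>z\<in>inj_pairs I n. indicator {z. \<forall>u\<in>I. s (z (Inl u)) = z (Inr u)} z)"
    using finite_inj_pairs[OF I, of n] by (simp add: indicator_def sum.If_cases Int_def)
  also have "\<dots> = (\<Sum>K\<in>kernels I. \<Sum>w\<in>inj_funs ((I <+> I) // K) {1..n}.
      indicator {w. carries (right_edges I K) s w} w)"
    unfolding sum_by_kernel[OF I] indicator_def mem_Collect_eq
    by (subst carries_class_edges[where J = "I <+> I"]) auto
  also have "\<dots> = (\<Sum>K\<in>kernels I. real (card (embs ((I <+> I) // K) (right_edges I K) n s)))"
    by (intro sum.cong refl)
       (simp add: embs_def indicator_def sum.If_cases Int_def kernel_edges(1)[OF I bij_betw_id])
  finally show ?thesis by simp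
qed

text \<open>
  Fixed points are \<open>o (sqrt n)\<close> in all moments and two-cycles are \<open>o (n)\<close> in mean.
\<close>

definition few_short_cycles :: "(nat \<Rightarrow> (nat \<Rightarrow> nat) pmf) \<Rightarrow> bool" where
  "few_short_cycles a \<longleftrightarrow>
     (\<forall>k\<ge>1. (\<lambda>n. measure_pmf.expectation (a n) (\<lambda>s. (real (card (fix_pts n s)) / sqrt (real n)) ^ k)) \<longlonglongrightarrow> 0) \<and>
     (\<lambda>n. measure_pmf.expectation (a n) (\<lambda>s. real (card (two_pts n s)) / real n)) \<longlonglongrightarrow> 0"

lemma sqrt_power_twice: "sqrt (real n) ^ (2 * k) = real n ^ k"
  by (simp add: power_mult)

text \<open>
  Each of the three bounds of \<open>card_embs_cases\<close>, divided by \<open>sqrt n ^ card V\<close>, is at most a power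
  of \<open>fixed points / sqrt n\<close>, at most \<open>1 / sqrt n\<close>, or at most \<open>points in two-cycles / n\<close>.
\<close>

lemma embs_negligible:
  fixes E :: "('v \<times> 'v) set"
  assumes few: "few_short_cycles a" and perms: "\<And>n. set_pmf (a n) \<subseteq> perms n"
    and V: "finite V" and E: "Field E = V" and ne: "card V \<noteq> 2 * card E"
  shows "(\<lambda>n. measure_pmf.expectation (a n) (\<lambda>s. real (card (embs V E n s))) / sqrt (real n) ^ card V) \<longlonglongrightarrow> 0"
proof -
  let ?X = "\<lambda>n s. real (card (embs V E n s)) / sqrt (real n) ^ card V"
  let ?E = "\<lambda>n. measure_pmf.expectation (a n)"
  \<comment> \<open>It suffices to dominate the normalised count by a variable whose expectation vanishes.\<close>
  have squeeze: "(\<lambda>n. ?E n (\<lambda>s. real (card (embs V E n s))) / sqrt (real n) ^ card V) \<longlonglongrightarrow> 0"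
    if dom: "\<And>n s. n \<ge> 1 \<Longrightarrow> s permutes {1..n} \<Longrightarrow> ?X n s \<le> Y n s"
      and lim: "(\<lambda>n. ?E n (Y n)) \<longlonglongrightarrow> 0" for Y :: "nat \<Rightarrow> (nat \<Rightarrow> nat) \<Rightarrow> real"
  proof (rule tendsto_sandwich[OF _ _ tendsto_const lim])
    show "\<forall>\<^sub>F n in sequentially. 0 \<le> ?E n (\<lambda>s. real (card (embs V E n s))) / sqrt (real n) ^ card V"
      by simp
    show "\<forall>\<^sub>F n in sequentially. ?E n (\<lambda>s. real (card (embs V E n s))) / sqrt (real n) ^ card V \<le> ?E n (Y n)"
      using eventually_ge_at_top[of 1]
    proof eventually_elim
      case (elim n)
      have "?E n (\<lambda>s. ?X n s) \<le> ?E n (Y n)"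
        by (rule expectation_mono_finite[OF finite_set_pmf_perms[OF perms]])
           (use dom[OF elim] perms in auto)
      then show ?case by simp
    qed
  qed
  have r1: "sqrt (real n) \<ge> 1" if "n \<ge> 1" for n using that by simp
  show ?thesis
  proof (rule card_embs_cases[OF V E ne])
    fix l q :: nat
    assume l: "1 \<le> l" and v: "2 * q + l \<le> card V"
      and b: "\<And>n s. s permutes {1..n} \<Longrightarrow> card (embs V E n s) \<le> card (fix_pts n s) ^ l * n ^ q"
    show ?thesis
    proof (rule squeeze)
      show "(\<lambda>n. ?E n (\<lambda>s. (real (card (fix_pts n s)) / sqrt (real n)) ^ l)) \<longlonglongrightarrow> 0"
        using few l unfolding few_short_cycles_def by blast
      fix n :: nat and s assume n: "n \<ge> 1" and s: "s permutes {1..n}"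
      let ?r = "sqrt (real n)" and ?f = "real (card (fix_pts n s))"
      have "real (card (embs V E n s)) \<le> ?f ^ l * real n ^ q"
        using of_nat_mono[OF b[OF s], where 'a = real] by simp
      then have "?X n s \<le> ?f ^ l * ?r ^ (2 * q) / ?r ^ card V"
        unfolding sqrt_power_twice by (intro divide_right_mono) auto
      also have "\<dots> = (?f / ?r) ^ l * (?r ^ (2 * q + l) / ?r ^ card V)"
        using r1[OF n] by (simp add: power_divide power_add)
      also have "\<dots> \<le> (?f / ?r) ^ l * 1"
        using power_increasing[OF v r1[OF n]] r1[OF n] by (intro mult_left_mono) auto
      finally show "?X n s \<le> (?f / ?r) ^ l" by simp
    qed
  next
    fix q :: nat
    assume v: "2 * q < card V"
      and b: "\<And>n s. s permutes {1..n} \<Longrightarrow> card (embs V E n s) \<le> n ^ q"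
    show ?thesis
    proof (rule squeeze)
      show "(\<lambda>n. ?E n (\<lambda>s. 1 / sqrt (real n))) \<longlonglongrightarrow> 0"
        by (simp add: LIMSEQ_inverse_real_of_nat tendsto_inverse_0_at_top filterlim_compose[OF sqrt_at_top filterlim_real_sequentially] flip: inverse_eq_divide)
      fix n :: nat and s assume n: "n \<ge> 1" and s: "s permutes {1..n}"
      let ?r = "sqrt (real n)"
      have "real (card (embs V E n s)) \<le> real n ^ q"
        using of_nat_mono[OF b[OF s], where 'a = real] by simp
      then have "?X n s \<le> ?r ^ (2 * q) / ?r ^ card V"
        unfolding sqrt_power_twice by (intro divide_right_mono) auto
      also have "\<dots> = (1 / ?r) * (?r ^ Suc (2 * q) / ?r ^ card V)"
        using r1[OF n] by simp
      also have "\<dots> \<le> (1 / ?r) * 1"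
        using power_increasing[OF Suc_leI[OF v] r1[OF n]] r1[OF n] by (intro mult_left_mono) auto
      finally show "?X n s \<le> 1 / ?r" by simp
    qed
  next
    fix q :: nat
    assume v: "2 * q + 2 \<le> card V"
      and b: "\<And>n s. s permutes {1..n} \<Longrightarrow> card (embs V E n s) \<le> card (two_pts n s) * n ^ q"
    show ?thesis
    proof (rule squeeze)
      show "(\<lambda>n. ?E n (\<lambda>s. real (card (two_pts n s)) / real n)) \<longlonglongrightarrow> 0"
        using few unfolding few_short_cycles_def by blast
      fix n :: nat and s assume n: "n \<ge> 1" and s: "s permutes {1..n}"
      let ?r = "sqrt (real n)" and ?f = "real (card (two_pts n s))"
      have "real (card (embs V E n s)) \<le> ?f * real n ^ q"
        using of_nat_mono[OF b[OF s], where 'a = real] by simp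
      then have "?X n s \<le> ?f * ?r ^ (2 * q) / ?r ^ card V"
        unfolding sqrt_power_twice by (intro divide_right_mono) auto
      also have "\<dots> = ?f / real n * (?r ^ (2 * q + 2) / ?r ^ card V)"
      proof -
        have "?r ^ (2 * q + 2) = ?r ^ (2 * q) * real n"
          using sqrt_power_twice[of n "Suc q"] sqrt_power_twice[of n q] by simp
        then show ?thesis using n by (simp only:) simp
      qed
      also have "\<dots> \<le> ?f / real n * 1"
        using power_increasing[OF v r1[OF n]] r1[OF n] by (intro mult_left_mono) auto
      finally show "?X n s \<le> ?f / real n" by simp
    qed
  qed
qed

lemma expectation_card_embs_le:
  assumes "set_pmf p \<subseteq> perms n" "finite V" "Field E = V"
  shows "measure_pmf.expectation p (\<lambda>s. real (card (embs V E n s))) \<le> real n ^ card E"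
proof -
  have "measure_pmf.expectation p (\<lambda>s. real (card (embs V E n s))) \<le> measure_pmf.expectation p (\<lambda>_. real n ^ card E)"
    by (rule expectation_mono_finite[OF finite_set_pmf_perms[OF assms(1)]])
       (use of_nat_mono[OF card_embs_le_power[OF assms(2,3)], where 'a = real] in auto)
  then show ?thesis by simp
qed

lemma power_over_card_inj_funs:
  assumes "finite V"
  shows "(\<lambda>n. real n ^ card V / real (card (inj_funs V {1..n}))) \<longlonglongrightarrow> 1"
  using tendsto_inverse[OF card_inj_funs_asymp[OF assms]] by simp

text \<open>
  The expectations over all kernels add up to the number of injections on \<open>I\<close>, which is
  asymptotic to \<open>n ^ card I\<close>. A kernel with \<open>v\<close> classes other than the discrete one contributes
  \<open>o (sqrt n ^ v)\<close>, and \<open>v \<le> 2 * card I\<close>, so the discrete kernel carries everything. The edge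
  sets \<open>e K\<close> are kept abstract because the argument is used for the edges of either factor.
\<close>

lemma embs_discrete_kernel:
  fixes e :: "(('i + 'i) \<times> ('i + 'i)) set \<Rightarrow> (('i + 'i) set \<times> ('i + 'i) set) set"
  assumes few: "few_short_cycles a" and perms: "\<And>n. set_pmf (a n) \<subseteq> perms n" and I: "finite I"
    and field: "\<And>K. K \<in> kernels I \<Longrightarrow> Field (e K) = (I <+> I) // K"
    and card: "\<And>K. K \<in> kernels I \<Longrightarrow> card (e K) = card I"
    and total: "\<And>n s. s permutes {1..n} \<Longrightarrow>
       (\<Sum>K\<in>kernels I. real (card (embs ((I <+> I) // K) (e K) n s))) = real (card (inj_funs I {1..n}))"
  shows "(\<lambda>n. measure_pmf.expectation (a n)
      (\<lambda>s. real (card (embs ((I <+> I) // Id_on (I <+> I)) (e (Id_on (I <+> I))) n s))) / real n ^ card I) \<longlonglongrightarrow> 1"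
proof -
  let ?J = "I <+> I"
  let ?A = "\<lambda>K n. measure_pmf.expectation (a n) (\<lambda>s. real (card (embs (?J // K) (e K) n s)))"
  note ke = kernel_edges[OF I bij_betw_id]
  have sum_A: "(\<Sum>K\<in>kernels I. ?A K n) = real (card (inj_funs I {1..n}))" for n
  proof -
    note fin = finite_set_pmf_perms[OF perms[of n]]
    have "(\<Sum>K\<in>kernels I. ?A K n) = measure_pmf.expectation (a n) (\<lambda>s. \<Sum>K\<in>kernels I. real (card (embs (?J // K) (e K) n s)))"
      by (simp add: Bochner_Integration.integral_sum integrable_measure_pmf_finite[OF fin])
    also have "\<dots> = measure_pmf.expectation (a n) (\<lambda>s. real (card (inj_funs I {1..n})))"
    proof (rule integral_cong_AE)
      show "AE s in a n. (\<Sum>K\<in>kernels I. real (card (embs (?J // K) (e K) n s))) = real (card (inj_funs I {1..n}))"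
        using perms[of n] total by (intro AE_pmfI) blast
    qed simp_all
    finally show ?thesis by simp
  qed
  have small: "(\<lambda>n. ?A K n / real n ^ card I) \<longlonglongrightarrow> 0" if K: "K \<in> kernels I" "K \<noteq> Id_on ?J" for K
  proof (rule tendsto_sandwich[OF _ _ tendsto_const])
    show "(\<lambda>n. ?A K n / sqrt (real n) ^ card (?J // K)) \<longlonglongrightarrow> 0"
      by (rule embs_negligible[OF few perms ke(1)[OF K(1)] field[OF K(1)]])
         (use ke(8)[OF K(1)] K card in auto)
    show "\<forall>\<^sub>F n in sequentially. 0 \<le> ?A K n / real n ^ card I" by simp
    show "\<forall>\<^sub>F n in sequentially. ?A K n / real n ^ card I \<le> ?A K n / sqrt (real n) ^ card (?J // K)"
      using eventually_ge_at_top[of 1]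
    proof eventually_elim
      case (elim n)
      have "sqrt (real n) ^ card (?J // K) \<le> sqrt (real n) ^ (2 * card I)"
        using elim by (intro power_increasing ke(7)[OF K(1)]) simp
      then show ?case unfolding sqrt_power_twice using elim
        by (intro divide_left_mono mult_pos_pos) (auto intro!: integral_nonneg_AE)
    qed
  qed
  have "?A (Id_on ?J) n / real n ^ card I = real (card (inj_funs I {1..n})) / real n ^ card I -
      (\<Sum>K\<in>kernels I - {Id_on ?J}. ?A K n / real n ^ card I)" for n
    unfolding sum_A[symmetric] sum.remove[OF finite_kernels[OF I] Id_on_kernels]
    by (simp add: add_divide_distrib sum_divide_distrib)
  moreover have "(\<lambda>n. real (card (inj_funs I {1..n})) / real n ^ card I -
      (\<Sum>K\<in>kernels I - {Id_on ?J}. ?A K n / real n ^ card I)) \<longlonglongrightarrow> 1 - (\<Sum>K\<in>kernels I - {Id_on ?J}. 0)"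
    by (intro tendsto_diff card_inj_funs_asymp[OF I] tendsto_sum small) auto
  ultimately show ?thesis by simp
qed

text \<open>
  With \<open>v\<close> classes, normalise both expectations by \<open>sqrt n ^ v\<close> and the denominator by
  \<open>n ^ v\<close>. The term of the discrete kernel tends to \<open>1\<close>; in all others both normalised
  expectations vanish.
\<close>

lemma expectation_equivariant_tendsto_1:
  fixes I :: "'i set"
  assumes a: "few_short_cycles a" "\<And>n. set_pmf (a n) \<subseteq> perms n"
    and b: "few_short_cycles b" "\<And>n. set_pmf (b n) \<subseteq> perms n"
    and inv: "\<And>n. conj_invariant n (a n) \<or> conj_invariant n (b n)"
    and I: "finite I" and \<rho>: "bij_betw \<rho> I I"
  shows "(\<lambda>n. measure_pmf.expectation (conv_pmf (a n) (b n)) (\<lambda>s. real (card (equivariant I \<rho> n s)))) \<longlonglongrightarrow> 1"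
proof -
  let ?J = "I <+> I"
  let ?A = "\<lambda>K n. measure_pmf.expectation (a n) (\<lambda>s. real (card (embs (?J // K) (left_edges I \<rho> K) n s)))"
  let ?B = "\<lambda>K n. measure_pmf.expectation (b n) (\<lambda>s. real (card (embs (?J // K) (right_edges I K) n s)))"
  let ?N = "\<lambda>K n. real (card (inj_funs (?J // K) {1..n}))"
  note ke = kernel_edges[OF I \<rho>]
  have term_lim: "(\<lambda>n. ?A K n * ?B K n / ?N K n) \<longlonglongrightarrow> (if K = Id_on ?J then 1 else 0)"
    if K: "K \<in> kernels I" for K
  proof (rule Lim_transform_eventually)
    let ?v = "card (?J // K)"
    let ?l = "if K = Id_on ?J then 1 else 0 :: real"
    have lA: "(\<lambda>n. ?A K n / sqrt (real n) ^ ?v) \<longlonglongrightarrow> ?l"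
    proof (cases "K = Id_on ?J")
      case True
      then have "?v = 2 * card I" using ke(8)[OF K] by simp
      then show ?thesis
        using embs_discrete_kernel[OF a I, where e = "left_edges I \<rho>"] True
        by (simp add: ke sum_card_embs_left[OF I \<rho>] sqrt_power_twice)
    next
      case False
      then show ?thesis
        using embs_negligible[OF a ke(1,2)[OF K]] ke(4,8)[OF K] by simp
    qed
    have lB: "(\<lambda>n. ?B K n / sqrt (real n) ^ ?v) \<longlonglongrightarrow> ?l"
    proof (cases "K = Id_on ?J")
      case True
      then have "?v = 2 * card I" using ke(8)[OF K] by simp
      then show ?thesis
        using embs_discrete_kernel[OF b I, where e = "right_edges I"] True
        by (simp add: ke sum_card_embs_right[OF I] sqrt_power_twice)
    next
      case False
      then show ?thesis
        using embs_negligible[OF b ke(1,3)[OF K]] ke(5,8)[OF K] by simp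
    qed
    have lim: "(\<lambda>n. ?A K n / sqrt (real n) ^ ?v * (?B K n / sqrt (real n) ^ ?v) * (real n ^ ?v / ?N K n))
        \<longlonglongrightarrow> ?l * ?l * 1"
      by (intro tendsto_mult lA lB power_over_card_inj_funs ke(1)[OF K])
    show "(\<lambda>n. ?A K n / sqrt (real n) ^ ?v * (?B K n / sqrt (real n) ^ ?v) * (real n ^ ?v / ?N K n))
        \<longlonglongrightarrow> ?l"
    proof -
      have "?l * ?l * 1 = ?l" by simp
      with lim show ?thesis by (simp only:)
    qed
    show "\<forall>\<^sub>F n in sequentially. ?A K n / sqrt (real n) ^ ?v * (?B K n / sqrt (real n) ^ ?v) * (real n ^ ?v / ?N K n) =
        ?A K n * ?B K n / ?N K n"
      using eventually_ge_at_top[of 1]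
    proof eventually_elim
      case (elim n)
      have "real n ^ ?v = sqrt (real n) ^ ?v * sqrt (real n) ^ ?v"
        by (simp flip: power_mult_distrib)
      then show ?case using elim by simp
    qed
  qed
  have "(\<lambda>n. \<Sum>K\<in>kernels I. ?A K n * ?B K n / ?N K n) \<longlonglongrightarrow> (\<Sum>K\<in>kernels I. if K = Id_on ?J then 1 else 0)"
    by (intro tendsto_sum term_lim)
  also have "(\<Sum>K\<in>kernels I. if K = Id_on ?J then 1 else 0 :: real) = 1"
    using finite_kernels[OF I] Id_on_kernels by simp
  finally show ?thesis
    by (simp add: expectation_equivariant[OF I \<rho> a(2) b(2) inv])
qed

text \<open>
  Whatever the cycles of the second factor, its expectation is at most \<open>n ^ card I\<close>. For the discrete kernel the term is bounded, which is smaller than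
  \<open>sqrt n ^ card I\<close> as \<open>I\<close> is not empty. For any other kernel, with \<open>v\<close> classes, the term is
  \<open>o (sqrt n ^ v) * n ^ card I / n ^ v\<close>, and \<open>v \<ge> card I\<close>.
\<close>

lemma expectation_equivariant_small:
  fixes I :: "'i set"
  assumes a: "few_short_cycles a" "\<And>n. set_pmf (a n) \<subseteq> perms n"
    and b: "\<And>n. set_pmf (b n) \<subseteq> perms n"
    and inv: "\<And>n. conj_invariant n (a n) \<or> conj_invariant n (b n)"
    and I: "finite I" "I \<noteq> {}" and \<rho>: "bij_betw \<rho> I I"
  shows "(\<lambda>n. measure_pmf.expectation (conv_pmf (a n) (b n)) (\<lambda>s. real (card (equivariant I \<rho> n s)))
      / sqrt (real n) ^ card I) \<longlonglongrightarrow> 0"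
proof -
  let ?J = "I <+> I"
  let ?A = "\<lambda>K n. measure_pmf.expectation (a n) (\<lambda>s. real (card (embs (?J // K) (left_edges I \<rho> K) n s)))"
  let ?B = "\<lambda>K n. measure_pmf.expectation (b n) (\<lambda>s. real (card (embs (?J // K) (right_edges I K) n s)))"
  let ?N = "\<lambda>K n. real (card (inj_funs (?J // K) {1..n}))"
  note ke = kernel_edges[OF I(1) \<rho>]
  have cI: "card I \<ge> 1" using I by (simp add: Suc_leI card_gt_0_iff)
  have A0: "?A K n \<ge> 0" and B0: "?B K n \<ge> 0" for K n by simp_all
  have term_lim: "(\<lambda>n. ?A K n * ?B K n / ?N K n / sqrt (real n) ^ card I) \<longlonglongrightarrow> 0"
    if K: "K \<in> kernels I" for K
  proof -
    let ?v = "card (?J // K)"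
    have B: "?B K n \<le> sqrt (real n) ^ (2 * card I)" for n
      using expectation_card_embs_le[OF b ke(1,3)[OF K]] ke(5)[OF K] by (simp add: sqrt_power_twice)
    have A: "?A K n \<le> sqrt (real n) ^ (2 * card I)" for n
      using expectation_card_embs_le[OF a(2) ke(1,2)[OF K]] ke(4)[OF K] by (simp add: sqrt_power_twice)
    \<comment> \<open>The vanishing factor: in the discrete case it comes from \<open>sqrt n ^ card I\<close>, otherwise from the
      first expectation.\<close>
    define x where "x = (\<lambda>n. if K = Id_on ?J then 1 / sqrt (real n) else ?A K n / sqrt (real n) ^ ?v)"
    have x0: "x n \<ge> 0" for n unfolding x_def by simp
    have x: "x \<longlonglongrightarrow> 0"
    proof (cases "K = Id_on ?J")
      case True
      have "(\<lambda>n. inverse (sqrt (real n))) \<longlonglongrightarrow> 0"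
        by (rule tendsto_inverse_0_at_top[OF filterlim_compose[OF sqrt_at_top filterlim_real_sequentially]])
      then show ?thesis unfolding x_def using True by (simp add: inverse_eq_divide)
    next
      case False
      then show ?thesis
        unfolding x_def using embs_negligible[OF a ke(1,2)[OF K]] ke(4,8)[OF K] by simp
    qed
    show ?thesis
    proof (rule tendsto_sandwich[OF _ _ tendsto_const])
      show "(\<lambda>n. x n * (real n ^ ?v / ?N K n)) \<longlonglongrightarrow> 0"
        using tendsto_mult[OF x power_over_card_inj_funs[OF ke(1)[OF K]]] by simp
      show "\<forall>\<^sub>F n in sequentially. 0 \<le> ?A K n * ?B K n / ?N K n / sqrt (real n) ^ card I"
        using A0 B0 by simp
      show "\<forall>\<^sub>F n in sequentially. ?A K n * ?B K n / ?N K n / sqrt (real n) ^ card I \<le> x n * (real n ^ ?v / ?N K n)"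
        using eventually_ge_at_top[of 1]
      proof eventually_elim
        case (elim n)
        let ?r = "sqrt (real n)"
        have r: "?r \<ge> 1" using elim by simp
        have rv: "real n ^ ?v = ?r ^ ?v * ?r ^ ?v" by (simp flip: power_mult_distrib)
        have "?A K n * ?B K n \<le> x n * (?r ^ ?v * ?r ^ ?v) * ?r ^ card I"
        proof (cases "K = Id_on ?J")
          case True
          have v: "?v = 2 * card I" using ke(8)[OF K] True by simp
          have "?r ^ 1 \<le> ?r ^ card I" by (rule power_increasing[OF cI r])
          then have 1: "1 \<le> x n * ?r ^ card I" using True r unfolding x_def by (simp add: field_simps)
          have "?A K n * ?B K n \<le> ?r ^ ?v * ?r ^ ?v"
            unfolding v using A[of n] B[of n] A0[of n K] B0[of n K] by (intro mult_mono) auto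
          also have "\<dots> \<le> (?r ^ ?v * ?r ^ ?v) * (x n * ?r ^ card I)"
            using mult_left_mono[OF 1, of "?r ^ ?v * ?r ^ ?v"] r by simp
          finally show ?thesis by (simp add: mult_ac)
        next
          case False
          have "2 * card I \<le> ?v + card I" using ke(6)[OF K] by simp
          then have "?r ^ (2 * card I) \<le> ?r ^ (?v + card I)" by (rule power_increasing[OF _ r])
          then have "?A K n * ?B K n \<le> ?A K n * ?r ^ (?v + card I)"
            using B[of n] A0[of n K] by (intro mult_left_mono) auto
          also have "\<dots> = x n * (?r ^ ?v * ?r ^ ?v) * ?r ^ card I"
            using False r unfolding x_def by (simp add: power_add)
          finally show ?thesis .
        qed
        then have "?A K n * ?B K n / ?N K n \<le> x n * (?r ^ ?v * ?r ^ ?v) * ?r ^ card I / ?N K n"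
          by (intro divide_right_mono) auto
        then have "?A K n * ?B K n / ?N K n / ?r ^ card I \<le> x n * (?r ^ ?v * ?r ^ ?v) * ?r ^ card I / ?N K n / ?r ^ card I"
          by (rule divide_right_mono) simp
        also have "\<dots> = x n * (real n ^ ?v / ?N K n)"
          using r unfolding rv by simp
        finally show ?case .
      qed
    qed
  qed
  have "(\<lambda>n. \<Sum>K\<in>kernels I. ?A K n * ?B K n / ?N K n / sqrt (real n) ^ card I) \<longlonglongrightarrow> (\<Sum>K\<in>kernels I. 0)"
    by (intro tendsto_sum term_lim)
  then show ?thesis
    by (simp add: expectation_equivariant[OF I(1) \<rho> a(2) b inv] sum_divide_distrib)
qed

section \<open>Equivariant injections and the cycle structure\<close>

definition period_pts :: "nat \<Rightarrow> nat \<Rightarrow> (nat \<Rightarrow> nat) \<Rightarrow> nat set" where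
  "period_pts d n s = {x \<in> {1..n}. card (orbit s x) = d}"

text \<open>
  The size of the orbit is the least period of \<open>x\<close>.
\<close>

lemma card_orbit_dvd_iff:
  assumes s: "permutation s"
  shows "card (orbit s x) dvd r \<longleftrightarrow> (s ^^ r) x = x"
proof -
  have "orbit s x = set (support s x)"
    unfolding support_set[OF s] orbit_altdef_permutation[OF s] by auto
  moreover have "distinct (support s x)" using cycle_of_permutation[OF s, of x] by simp
  ultimately have "card (orbit s x) = least_power s x" by (simp add: distinct_card del: set_map)
  then show ?thesis using least_power_dvd[OF s] by simp
qed

lemma permutes_permutation: "s permutes {1..n::nat} \<Longrightarrow> permutation s"
  using permutation_permutes by blast

lemma permutes_funpow:
  assumes "s permutes S"
  shows "s ^^ r permutes S"
proof (induction r)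
  case 0 show ?case unfolding funpow.simps by (rule permutes_id)
next
  case (Suc r) then show ?case unfolding funpow.simps by (rule permutes_compose[OF _ assms])
qed

lemma finite_orbit_permutation: "permutation s \<Longrightarrow> finite (orbit s x)"
  by (rule finite_orbit[OF permutation_self_in_orbit])

lemma orbit_eq_of_mem:
  assumes "permutation s" "y \<in> orbit s x"
  shows "orbit s y = orbit s x"
proof -
  have "x \<in> orbit s y"
    by (rule orbit_swap[OF permutation_self_in_orbit[OF assms(1)] assms(2)])
  then show ?thesis using assms(2) by (intro equalityI subsetI) (erule orbit_trans, assumption)+
qed

lemma card_orbit_pos: "permutation s \<Longrightarrow> card (orbit s x) > 0"
  using permutation_self_in_orbit[of s x] finite_orbit_permutation[of s x] by (auto simp: card_gt_0_iff)

lemma funpow_inj_below_card_orbit: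
  assumes s: "permutation s" and eq: "(s ^^ i) x = (s ^^ j) x"
    and ij: "i < card (orbit s x)" "j < card (orbit s x)"
  shows "i = j"
proof -
  have *: "i = j" if "i \<le> j" "(s ^^ i) x = (s ^^ j) x" "j < card (orbit s x)" for i j
  proof -
    have "inj s" using s by (simp add: permutation bij_is_inj)
    moreover have "(s ^^ i) ((s ^^ (j - i)) x) = (s ^^ i) x"
      using that by (metis comp_apply funpow_add le_add_diff_inverse)
    ultimately have "(s ^^ (j - i)) x = x" by (metis inj_fn injD)
    then have "card (orbit s x) dvd j - i" using card_orbit_dvd_iff[OF s] by simp
    then show ?thesis using that by (metis diff_is_0_eq' dvd_imp_le le_antisym less_imp_diff_less neq0_conv not_le diff_le_self le_trans diff_zero zero_less_diff)
  qed
  then show ?thesis using eq ij by (metis nat_le_linear)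
qed

lemma fix_pts_eq: "s permutes {1..n} \<Longrightarrow> fix_pts n s = period_pts 1 n s"
  using card_orbit_dvd_iff[OF permutes_permutation, of s n _ 1]
  unfolding fix_pts_def period_pts_def by auto

lemma two_pts_eq:
  assumes s: "s permutes {1..n}"
  shows "two_pts n s = period_pts 2 n s"
proof -
  have "s (s x) = x \<and> s x \<noteq> x \<longleftrightarrow> card (orbit s x) = 2" for x
  proof -
    note p = permutes_permutation[OF s]
    have "s (s x) = x \<longleftrightarrow> card (orbit s x) dvd 2"
      using card_orbit_dvd_iff[OF p, of x 2] by (simp add: numeral_2_eq_2)
    moreover have "s x = x \<longleftrightarrow> card (orbit s x) dvd 1"
      using card_orbit_dvd_iff[OF p, of x 1] by simp
    moreover have "c dvd 2 \<and> \<not> c dvd 1 \<longleftrightarrow> c = 2" for c :: nat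
      using prime_nat_iff[of 2] two_is_prime_nat by auto
    ultimately show ?thesis by blast
  qed
  then show ?thesis unfolding two_pts_def period_pts_def by auto
qed

text \<open>
  The points of period \<open>d\<close> are partitioned into the cycles of length \<open>d\<close>.
\<close>

lemma card_period_pts:
  assumes s: "s permutes {1..n}"
  shows "card (period_pts d n s) = d * cycle_count n d s"
proof -
  note p = permutes_permutation[OF s]
  let ?C = "{C \<in> orbit s ` {1..n}. card C = d}"
  have "period_pts d n s = \<Union>?C"
  proof (intro equalityI subsetI)
    fix x assume "x \<in> period_pts d n s"
    then have "orbit s x \<in> ?C" by (simp add: period_pts_def)
    then show "x \<in> \<Union>?C" using permutation_self_in_orbit[OF p] by (rule UnionI)
  next
    fix x assume "x \<in> \<Union>?C"
    then obtain y where y: "y \<in> {1..n}" "card (orbit s y) = d" "x \<in> orbit s y" by auto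
    then have "x \<in> {1..n}" using permutes_orbit_subset[OF s y(1)] by (rule_tac subsetD)
    then show "x \<in> period_pts d n s"
      using y(2) orbit_eq_of_mem[OF p y(3)] by (simp add: period_pts_def)
  qed
  also have "card \<dots> = sum card ?C"
  proof (rule card_Union_disjoint)
    show "disjoint ?C"
      unfolding pairwise_def disjnt_def using orbit_eq_of_mem[OF p] by blast
  qed (use finite_orbit_permutation[OF p] in auto)
  also have "\<dots> = d * card ?C" by simp
  finally show ?thesis by (simp add: cycle_count_def)
qed

text \<open>
  A point is fixed by \<open>s ^^ r\<close> exactly when its period divides \<open>r\<close>.
\<close>

lemma perm_tr_funpow:
  assumes s: "s permutes {1..n}" and r: "r \<ge> 1"
  shows "perm_tr n (s ^^ r) = (\<Sum>d | d dvd r. d * cycle_count n d s)"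
proof -
  note p = permutes_permutation[OF s]
  have fin: "finite {d. d dvd r}" using r by simp
  have "perm_tr n (s ^^ r) = card {x \<in> {1..n}. (s ^^ r) x = x}"
    by (rule perm_tr_eq_card_fixed_points[OF permutes_funpow[OF s]])
  also have "{x \<in> {1..n}. (s ^^ r) x = x} = (\<Union>d\<in>{d. d dvd r}. period_pts d n s)"
    using card_orbit_dvd_iff[OF p] unfolding period_pts_def by auto
  also have "card \<dots> = (\<Sum>d | d dvd r. card (period_pts d n s))"
    by (rule card_UN_disjoint) (use fin in \<open>auto simp: period_pts_def\<close>)
  finally show ?thesis by (simp add: card_period_pts[OF s])
qed

text \<open>
  Together with \<open>cycle_shift\<close>, a permutation with one cycle of length \<open>l a\<close> for each \<open>a \<in> A\<close>.
\<close>

definition cycle_index :: "'a set \<Rightarrow> ('a \<Rightarrow> nat) \<Rightarrow> ('a \<times> nat) set" where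
  "cycle_index A l = (SIGMA a:A. {..<l a})"

definition cycle_shift :: "('a \<Rightarrow> nat) \<Rightarrow> 'a \<times> nat \<Rightarrow> 'a \<times> nat" where
  "cycle_shift l = (\<lambda>(a, j). (a, Suc j mod l a))"

text \<open>
  A choice of base points on distinct cycles of the prescribed lengths.
\<close>

definition cycle_starts :: "'a set \<Rightarrow> ('a \<Rightarrow> nat) \<Rightarrow> nat \<Rightarrow> (nat \<Rightarrow> nat) \<Rightarrow> ('a \<Rightarrow> nat) set" where
  "cycle_starts A l n s = {y \<in> A \<rightarrow>\<^sub>E {1..n}. (\<forall>a\<in>A. card (orbit s (y a)) = l a) \<and>
     (\<forall>a\<in>A. \<forall>b\<in>A. a \<noteq> b \<longrightarrow> y b \<notin> orbit s (y a))}"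

lemma cycle_startsD:
  assumes "y \<in> cycle_starts A l n s"
  shows "y \<in> A \<rightarrow>\<^sub>E {1..n}"
    and "\<And>a. a \<in> A \<Longrightarrow> card (orbit s (y a)) = l a"
    and "\<And>a b. a \<in> A \<Longrightarrow> b \<in> A \<Longrightarrow> a \<noteq> b \<Longrightarrow> y b \<notin> orbit s (y a)"
  using assms unfolding cycle_starts_def mem_Collect_eq by simp_all

lemma finite_cycle_index: "finite A \<Longrightarrow> finite (cycle_index A l)"
  unfolding cycle_index_def by auto

lemma bij_betw_cycle_shift:
  assumes "finite A"
  shows "bij_betw (cycle_shift l) (cycle_index A l) (cycle_index A l)"
proof -
  have sub: "cycle_shift l ` cycle_index A l \<subseteq> cycle_index A l"
    unfolding cycle_shift_def cycle_index_def
    by (auto intro!: mod_less_divisor gr_zeroI)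
  have "j = j'" if "j < d" "j' < d" "Suc j mod d = Suc j' mod d" for j j' d :: nat
    using that by (cases "Suc j = d"; cases "Suc j' = d") auto
  then have "inj_on (cycle_shift l) (cycle_index A l)"
    unfolding cycle_shift_def cycle_index_def inj_on_def by auto
  then show ?thesis
    using endo_inj_surj[OF finite_cycle_index[OF assms] sub] unfolding bij_betw_def by blast
qed

text \<open>
  An equivariant injection is determined by the image of the base point \<open>(a, 0)\<close> of each cycle,
  since \<open>(a, j)\<close> has to go to the \<open>j\<close>-th iterate. Injectivity within one cycle says that the
  image has period exactly \<open>l a\<close>, and injectivity across cycles that the orbits are distinct.
\<close>

lemma card_equivariant_cycle_shift:
  assumes A: "finite A" and l: "\<And>a. a \<in> A \<Longrightarrow> l a \<ge> 1" and s: "s permutes {1..n}"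
  shows "card (equivariant (cycle_index A l) (cycle_shift l) n s) = card (cycle_starts A l n s)"
proof (rule bij_betw_same_card)
  let ?I = "cycle_index A l"
  let ?f = "\<lambda>x. \<lambda>a\<in>A. x (a, 0::nat)"
  let ?g = "\<lambda>y. \<lambda>u\<in>?I. (s ^^ snd u) (y (fst u))"
  note p = permutes_permutation[OF s]
  have mem: "(a, j) \<in> ?I \<longleftrightarrow> a \<in> A \<and> j < l a" for a j
    unfolding cycle_index_def by auto
  have orb: "(s ^^ j) x \<in> orbit s x" for j x
    unfolding orbit_altdef_permutation[OF p] by auto
  have along: "x (a, j) = (s ^^ j) (x (a, 0))"
    if x: "x \<in> equivariant ?I (cycle_shift l) n s" and "(a, j) \<in> ?I" for x a j
    using that(2)
  proof (induction j)
    case (Suc j)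
    then have aj: "(a, j) \<in> ?I" by (simp add: mem)
    have "s (x (a, j)) = x (cycle_shift l (a, j))"
      using x aj unfolding equivariant_def by blast
    then show ?case using Suc.IH[OF aj] Suc.prems by (simp add: cycle_shift_def mem)
  qed simp
  show "bij_betw ?f (equivariant ?I (cycle_shift l) n s) (cycle_starts A l n s)"
  proof (rule bij_betw_byWitness[where f' = ?g])
    show "\<forall>x\<in>equivariant ?I (cycle_shift l) n s. ?g (?f x) = x"
    proof (intro ballI ext)
      fix x u assume x: "x \<in> equivariant ?I (cycle_shift l) n s"
      show "?g (?f x) u = x u"
      proof (cases "u \<in> ?I")
        case True
        then show ?thesis using along[OF x, of "fst u" "snd u"] mem[of "fst u" "snd u"] by simp
      next
        case False
        have "x \<in> ?I \<rightarrow>\<^sub>E {1..n}" using x unfolding equivariant_def inj_funs_def by simp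
        from PiE_arb[OF this False] show ?thesis using False by simp
      qed
    qed
    show "\<forall>y\<in>cycle_starts A l n s. ?f (?g y) = y"
    proof (intro ballI ext)
      fix y a assume y: "y \<in> cycle_starts A l n s"
      show "?f (?g y) a = y a"
      proof (cases "a \<in> A")
        case True
        then have "(a, 0) \<in> ?I" using l[OF True] by (simp add: mem)
        then show ?thesis using True by simp
      next
        case False
        have "y \<in> A \<rightarrow>\<^sub>E {1..n}" using y unfolding cycle_starts_def by simp
        from PiE_arb[OF this False] show ?thesis using False by simp
      qed
    qed
    show "?f ` equivariant ?I (cycle_shift l) n s \<subseteq> cycle_starts A l n s"
    proof (rule image_subsetI)
      fix x assume x: "x \<in> equivariant ?I (cycle_shift l) n s"
      then have xI: "x \<in> ?I \<rightarrow>\<^sub>E {1..n}" and inj: "inj_on x ?I"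
        unfolding equivariant_def inj_funs_def by auto
      have 0: "(a, 0) \<in> ?I" if "a \<in> A" for a using l[OF that] that by (simp add: mem)
      have loop: "(s ^^ l a) (x (a, 0)) = x (a, 0)" if a: "a \<in> A" for a
      proof -
        have j: "(a, l a - 1) \<in> ?I" using l[OF a] a by (simp add: mem)
        then have "s (x (a, l a - 1)) = x (cycle_shift l (a, l a - 1))"
          using x unfolding equivariant_def by blast
        also have "\<dots> = x (a, 0)" using l[OF a] by (simp add: cycle_shift_def)
        finally have "(s ^^ Suc (l a - 1)) (x (a, 0)) = x (a, 0)" using along[OF x j] by simp
        then show ?thesis using l[OF a] by simp
      qed
      have card_orb: "card (orbit s (x (a, 0))) = l a" if a: "a \<in> A" for a
      proof (rule ccontr)
        let ?c = "card (orbit s (x (a, 0)))"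
        assume "?c \<noteq> l a"
        moreover have "?c dvd l a" using loop[OF a] card_orbit_dvd_iff[OF p] by simp
        ultimately have c: "?c < l a" using l[OF a] by (auto dest: dvd_imp_le)
        then have cI: "(a, ?c) \<in> ?I" using a by (simp add: mem)
        have "(s ^^ ?c) (x (a, 0)) = x (a, 0)" using card_orbit_dvd_iff[OF p, of "x (a, 0)" ?c] by simp
        then have "x (a, ?c) = x (a, 0)" using along[OF x cI] by simp
        then have "?c = 0" using inj_onD[OF inj _ cI 0[OF a]] by simp
        then show False using card_orbit_pos[OF p, of "x (a, 0)"] by simp
      qed
      have "x (b, 0) \<notin> orbit s (x (a, 0))" if "a \<in> A" "b \<in> A" "a \<noteq> b" for a b
      proof
        assume "x (b, 0) \<in> orbit s (x (a, 0))"
        then obtain m where "x (b, 0) = (s ^^ m) (x (a, 0))"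
          unfolding orbit_altdef_permutation[OF p] by blast
        also have "\<dots> = (s ^^ (m mod l a)) (x (a, 0))"
          by (rule funpow_mod_eq[OF loop[OF that(1)], symmetric])
        also have "\<dots> = x (a, m mod l a)"
          using along[OF x, of a "m mod l a"] that l[OF that(1)] by (simp add: mem)
        finally have "(b, 0) = (a, m mod l a)"
          by (rule inj_onD[OF inj]) (use that l[OF that(1)] 0 in \<open>simp_all add: mem\<close>)
        then show False using that by simp
      qed
      then show "?f x \<in> cycle_starts A l n s"
        unfolding cycle_starts_def using card_orb PiE_mem[OF xI 0] by simp
    qed
    show "?g ` cycle_starts A l n s \<subseteq> equivariant ?I (cycle_shift l) n s"
    proof (rule image_subsetI)
      fix y assume y: "y \<in> cycle_starts A l n s"
      note yA = cycle_startsD(1)[OF y] and cy = cycle_startsD(2)[OF y] and dj = cycle_startsD(3)[OF y]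
      have in_n: "(s ^^ j) (y a) \<in> {1..n}" if "a \<in> A" for a j
        using orb permutes_orbit_subset[OF s PiE_mem[OF yA that]] by blast
      have inj: "(a, j) = (b, i)"
        if u: "(a, j) \<in> ?I" and v: "(b, i) \<in> ?I" and eq: "(s ^^ j) (y a) = (s ^^ i) (y b)" for a j b i
      proof -
        have "orbit s (y a) = orbit s (y b)"
          using orbit_eq_of_mem[OF p orb, of j "y a"] orbit_eq_of_mem[OF p orb, of i "y b"] eq by simp
        then have "y b \<in> orbit s (y a)" using permutation_self_in_orbit[OF p] by simp
        then have ab: "a = b" using dj u v by (auto simp: mem)
        moreover have "j = i"
          using funpow_inj_below_card_orbit[OF p, of j "y a" i] eq u v cy ab by (simp add: mem)
        ultimately show ?thesis by simp
      qed
      have "inj_on (?g y) ?I"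
      proof (rule inj_onI)
        fix u v assume u: "u \<in> ?I" and v: "v \<in> ?I" and "?g y u = ?g y v"
        then have "(s ^^ snd u) (y (fst u)) = (s ^^ snd v) (y (fst v))" by simp
        then show "u = v" using inj[of "fst u" "snd u" "fst v" "snd v"] u v by simp
      qed
      moreover have "?g y \<in> ?I \<rightarrow>\<^sub>E {1..n}"
      proof (rule restrict_PiE_iff[THEN iffD2], rule ballI)
        fix u assume "u \<in> ?I"
        then have "fst u \<in> A" using mem[of "fst u" "snd u"] by simp
        then show "(s ^^ snd u) (y (fst u)) \<in> {1..n}" by (rule in_n)
      qed
      moreover have "s (?g y u) = ?g y (cycle_shift l u)" if u: "u \<in> ?I" for u
      proof -
        obtain a j where aj: "u = (a, j)" by (cases u)
        then have a: "a \<in> A" using u by (simp add: mem)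
        have "(s ^^ l a) (y a) = y a"
          using card_orbit_dvd_iff[OF p, of "y a" "l a"] cy[OF a] by simp
        from funpow_mod_eq[OF this, of "Suc j"]
        have "s ((s ^^ j) (y a)) = (s ^^ (Suc j mod l a)) (y a)" by simp
        moreover have "(a, Suc j mod l a) \<in> ?I" using a l[OF a] by (simp add: mem)
        ultimately show ?thesis using u aj by (simp add: cycle_shift_def)
      qed
      ultimately show "?g y \<in> equivariant ?I (cycle_shift l) n s"
        unfolding equivariant_def inj_funs_def by blast
    qed
  qed
qed

text \<open>
  The new base point ranges over the points of period \<open>l b\<close> that avoid the cycles already
  chosen; only the chosen cycles of the same length \<open>l b\<close> take points away.
\<close>

lemma card_cycle_starts_insert:
  assumes A: "finite A" and b: "b \<notin> A" and s: "s permutes {1..n}"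
  shows "card (cycle_starts (insert b A) l n s) =
    card (cycle_starts A l n s) * (card (period_pts (l b) n s) - l b * card {a \<in> A. l a = l b})"
proof -
  note p = permutes_permutation[OF s]
  define U where "U = (\<lambda>y :: 'a \<Rightarrow> nat. \<Union>a\<in>A. orbit s (y a))"
  let ?S = "SIGMA y:cycle_starts A l n s. period_pts (l b) n s - U y"
  have finP: "finite (period_pts (l b) n s)" unfolding period_pts_def by simp
  have sym: "x \<in> orbit s y \<longleftrightarrow> y \<in> orbit s x" for x y
    using orbit_eq_of_mem[OF p] permutation_self_in_orbit[OF p] by blast
  have "bij_betw (\<lambda>(y, x). y(b := x)) ?S (cycle_starts (insert b A) l n s)"
  proof (rule bij_betw_byWitness[where f' = "\<lambda>z. (restrict z A, z b)"])
    show "\<forall>yx\<in>?S. (\<lambda>z. (restrict z A, z b)) ((\<lambda>(y, x). y(b := x)) yx) = yx"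
    proof (clarsimp, rule ext)
      fix y x a assume y: "y \<in> cycle_starts A l n s"
      show "restrict (y(b := x)) A a = y a"
        using b PiE_arb[OF cycle_startsD(1)[OF y], of a] by (cases "a \<in> A") auto
    qed
    show "\<forall>z\<in>cycle_starts (insert b A) l n s. (\<lambda>(y, x). y(b := x)) (restrict z A, z b) = z"
    proof (clarsimp, rule ext)
      fix z a assume z: "z \<in> cycle_starts (insert b A) l n s"
      show "((restrict z A)(b := z b)) a = z a"
        using PiE_arb[OF cycle_startsD(1)[OF z], of a] by (cases "a \<in> insert b A") auto
    qed
    show "(\<lambda>(y, x). y(b := x)) ` ?S \<subseteq> cycle_starts (insert b A) l n s"
    proof clarify
      fix y x assume y: "y \<in> cycle_starts A l n s" and x: "x \<in> period_pts (l b) n s" "x \<notin> U y"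
      note yA = cycle_startsD(1)[OF y] and cy = cycle_startsD(2)[OF y] and dj = cycle_startsD(3)[OF y]
      have xn: "x \<in> {1..n}" "card (orbit s x) = l b" using x(1) unfolding period_pts_def by simp_all
      have ne: "a \<noteq> b" if "a \<in> A" for a using b that by metis
      have sep: "y a \<notin> orbit s x" "x \<notin> orbit s (y a)" if "a \<in> A" for a
        using x(2) that sym[of "y a" x] unfolding U_def by blast+
      show "y(b := x) \<in> cycle_starts (insert b A) l n s"
        unfolding cycle_starts_def mem_Collect_eq
      proof (intro conjI ballI impI)
        show "y(b := x) \<in> insert b A \<rightarrow>\<^sub>E {1..n}" using yA xn(1) by (rule PiE_fun_upd[rotated])
        show "card (orbit s ((y(b := x)) a)) = l a" if "a \<in> insert b A" for a
          using that xn(2) cy ne by (cases "a = b") simp_all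
        show "(y(b := x)) c \<notin> orbit s ((y(b := x)) a)"
          if "a \<in> insert b A" "c \<in> insert b A" "a \<noteq> c" for a c
        proof (cases "a = b")
          case True
          then have "c \<in> A" using that by simp
          then show ?thesis using True ne[OF \<open>c \<in> A\<close>] sep by simp
        next
          case a: False
          then have "a \<in> A" using that by simp
          then show ?thesis using a that sep dj by (cases "c = b") simp_all
        qed
      qed
    qed
    show "(\<lambda>z. (restrict z A, z b)) ` cycle_starts (insert b A) l n s \<subseteq> ?S"
    proof (rule image_subsetI)
      fix z assume z: "z \<in> cycle_starts (insert b A) l n s"
      note zA = cycle_startsD(1)[OF z]
      have zn: "z a \<in> {1..n}" if "a \<in> insert b A" for a using PiE_mem[OF zA that] .
      note cz = cycle_startsD(2)[OF z] and dz = cycle_startsD(3)[OF z]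
      have "restrict z A \<in> cycle_starts A l n s"
        unfolding cycle_starts_def mem_Collect_eq restrict_PiE_iff using zn cz dz by simp
      moreover have "z b \<in> period_pts (l b) n s"
        using zn[of b] cz[of b] unfolding period_pts_def by simp
      moreover have "z b \<notin> orbit s (z a)" if "a \<in> A" for a
        using dz[of a b] b that by blast
      then have "z b \<notin> U (restrict z A)" unfolding U_def by simp
      ultimately show "(restrict z A, z b) \<in> ?S" by simp
    qed
  qed
  then have "card (cycle_starts (insert b A) l n s) = card ?S"
    by (rule bij_betw_same_card[symmetric])
  also have "\<dots> = (\<Sum>y\<in>cycle_starts A l n s. card (period_pts (l b) n s - U y))"
  proof (rule card_SigmaI)
    show "finite (cycle_starts A l n s)"
      unfolding cycle_starts_def
      by (rule finite_subset[OF _ finite_PiE[of A "\<lambda>_. {1..n}"]]) (use A in auto)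
  qed (use finP in auto)
  also have "\<dots> = (\<Sum>y\<in>cycle_starts A l n s. card (period_pts (l b) n s) - l b * card {a \<in> A. l a = l b})"
  proof (rule sum.cong[OF refl])
    fix y assume y: "y \<in> cycle_starts A l n s"
    note yA = cycle_startsD(1)[OF y] and cy = cycle_startsD(2)[OF y] and dj = cycle_startsD(3)[OF y]
    let ?B = "{a \<in> A. l a = l b}"
    have inter: "period_pts (l b) n s \<inter> U y = (\<Union>a\<in>?B. orbit s (y a))"
    proof (intro equalityI subsetI)
      fix x assume x: "x \<in> period_pts (l b) n s \<inter> U y"
      then obtain a where a: "a \<in> A" "x \<in> orbit s (y a)" unfolding U_def by blast
      then have "l a = l b" using x orbit_eq_of_mem[OF p a(2)] cy[OF a(1)] by (simp add: period_pts_def)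
      then show "x \<in> (\<Union>a\<in>?B. orbit s (y a))" using a by blast
    next
      fix x assume "x \<in> (\<Union>a\<in>?B. orbit s (y a))"
      then obtain a where a: "a \<in> A" "l a = l b" "x \<in> orbit s (y a)" by blast
      then have "x \<in> {1..n}" using permutes_orbit_subset[OF s PiE_mem[OF yA a(1)]] by blast
      then show "x \<in> period_pts (l b) n s \<inter> U y"
        using a orbit_eq_of_mem[OF p a(3)] cy[OF a(1)] unfolding period_pts_def U_def by auto
    qed
    have "card (\<Union>a\<in>?B. orbit s (y a)) = (\<Sum>a\<in>?B. card (orbit s (y a)))"
    proof (rule card_UN_disjoint)
      show "\<forall>a\<in>?B. \<forall>c\<in>?B. a \<noteq> c \<longrightarrow> orbit s (y a) \<inter> orbit s (y c) = {}"
      proof (intro ballI impI)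
        fix a c assume ac: "a \<in> ?B" "c \<in> ?B" "a \<noteq> c"
        then have "y c \<notin> orbit s (y a)" using dj by blast
        then show "orbit s (y a) \<inter> orbit s (y c) = {}"
          using orbit_eq_of_mem[OF p] permutation_self_in_orbit[OF p] by blast
      qed
    qed (use A finite_orbit_permutation[OF p] in auto)
    also have "\<dots> = l b * card ?B" using cy by simp
    finally have "card (period_pts (l b) n s \<inter> U y) = l b * card ?B" unfolding inter .
    then show "card (period_pts (l b) n s - U y) = card (period_pts (l b) n s) - l b * card ?B"
      using card_Diff_subset_Int[of "period_pts (l b) n s" "U y"] finP by simp
  qed
  finally show ?thesis by simp
qed

lemma card_cycle_starts:
  assumes "finite A" and s: "s permutes {1..n}" and D: "finite D" "l ` A \<subseteq> D"
  shows "card (cycle_starts A l n s) =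
    (\<Prod>d\<in>D. \<Prod>i<card {a \<in> A. l a = d}. card (period_pts d n s) - d * i)"
  using assms(1) D(2)
proof (induction A rule: finite_induct)
  case empty
  then show ?case by (simp add: cycle_starts_def)
next
  case (insert b A)
  let ?m = "\<lambda>A d. card {a \<in> A. l a = d}"
  let ?F = "\<lambda>d k. \<Prod>i<k. card (period_pts d n s) - d * i"
  have bD: "l b \<in> D" using insert.prems by simp
  have m_b: "?m (insert b A) (l b) = Suc (?m A (l b))"
  proof -
    have "{a \<in> insert b A. l a = l b} = insert b {a \<in> A. l a = l b}" by auto
    then show ?thesis using insert.hyps by simp
  qed
  have m_other: "?m (insert b A) d = ?m A d" if "d \<noteq> l b" for d
    using that by (intro arg_cong[of _ _ card]) auto
  have "card (cycle_starts (insert b A) l n s) =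
      (\<Prod>d\<in>D. ?F d (?m A d)) * (card (period_pts (l b) n s) - l b * ?m A (l b))"
    using card_cycle_starts_insert[OF insert.hyps s, of l] insert.IH insert.prems by simp
  also have "\<dots> = ?F (l b) (Suc (?m A (l b))) * (\<Prod>d\<in>D - {l b}. ?F d (?m A d))"
    by (simp add: prod.remove[OF D(1) bD] mult_ac)
  also have "\<dots> = ?F (l b) (?m (insert b A) (l b)) * (\<Prod>d\<in>D - {l b}. ?F d (?m (insert b A) d))"
    unfolding m_b using m_other by (intro arg_cong2[of _ _ _ _ "(*)"] prod.cong refl) auto
  also have "\<dots> = (\<Prod>d\<in>D. ?F d (?m (insert b A) d))"
    by (simp only: prod.remove[OF D(1) bD])
  finally show ?case .
qed

lemma prod_diff_eq_fact_binomial: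
  "(\<Prod>i<c. C - i) = fact c * (C choose c :: nat)"
proof (induction c)
  case (Suc c)
  have "(C - c) * (C choose c) = Suc c * (C choose Suc c)"
  proof (cases C)
    case (Suc C')
    show ?thesis
    proof (cases "c \<le> C")
      case True
      then show ?thesis using binomial_absorb_comp[of C c] Suc_times_binomial[of c C'] Suc
        by (metis binomial_absorption diff_Suc_1 mult.commute)
    qed (simp add: binomial_eq_0)
  qed simp
  then show ?case using Suc by (simp add: algebra_simps)
qed simp

lemma card_equivariant_fixed_points:
  assumes s: "s permutes {1..n}"
  shows "card (equivariant (cycle_index {..<k} (\<lambda>_. 1)) (cycle_shift (\<lambda>_. 1)) n s) =
    (\<Prod>i<k. card (fix_pts n s) - i)"
  using card_equivariant_cycle_shift[of "{..<k}" "\<lambda>_. 1", OF _ _ s]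
    card_cycle_starts[of "{..<k}" s n "{1}" "\<lambda>_. 1", OF finite_lessThan s _ image_subsetI]
  by (simp add: fix_pts_eq[OF s])

lemma card_equivariant_two_cycle:
  assumes s: "s permutes {1..n}"
  shows "card (equivariant (cycle_index {()} (\<lambda>_. 2)) (cycle_shift (\<lambda>_. 2)) n s) = card (two_pts n s)"
  using card_equivariant_cycle_shift[of "{()}" "\<lambda>_. 2", OF _ _ s]
    card_cycle_starts[of "{()}" s n "{2}" "\<lambda>_. 2", OF _ s _ image_subsetI]
  by (simp add: two_pts_eq[OF s])

text \<open>
  The index set has \<open>c d\<close> cycles of length \<open>d\<close>, so each \<open>d\<close> contributes a falling factorial
  with step \<open>d\<close>.
\<close>

lemma card_equivariant_cycle_type:
  assumes s: "s permutes {1..n}"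
  shows "real (card (equivariant (cycle_index (SIGMA d:{1..k}. {..<c d}) fst) (cycle_shift fst) n s)) =
    (\<Prod>d\<in>{1..k}. real d ^ c d * fact (c d)) * (\<Prod>d\<in>{1..k}. real (cycle_count n d s choose c d))"
proof -
  let ?A = "SIGMA d:{1..k}. {..<c d}"
  have m: "card {a \<in> ?A. fst a = d} = c d" if "d \<in> {1..k}" for d
  proof -
    have "{a \<in> ?A. fst a = d} = Pair d ` {..<c d}" using that by auto
    then show ?thesis by (simp add: card_image inj_on_def)
  qed
  have F: "(\<Prod>i<m. card (period_pts d n s) - d * i) = d ^ m * (fact m * (cycle_count n d s choose m))" for d m
    unfolding prod_diff_eq_fact_binomial[symmetric] card_period_pts[OF s]
    by (simp add: prod.distrib flip: diff_mult_distrib2)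
  have "card (equivariant (cycle_index ?A fst) (cycle_shift fst) n s) = card (cycle_starts ?A fst n s)"
    by (rule card_equivariant_cycle_shift[OF _ _ s]) auto
  also have "\<dots> = (\<Prod>d\<in>{1..k}. \<Prod>i<card {a \<in> ?A. fst a = d}. card (period_pts d n s) - d * i)"
    by (rule card_cycle_starts[OF _ s]) auto
  also have "\<dots> = (\<Prod>d\<in>{1..k}. d ^ c d * (fact (c d) * (cycle_count n d s choose c d)))"
    by (rule prod.cong[OF refl]) (simp only: m F)
  finally show ?thesis by (simp add: prod.distrib mult_ac)
qed

section \<open>Few short cycles in a product\<close>

lemma set_conv_pmf: "set_pmf p \<subseteq> perms n \<Longrightarrow> set_pmf q \<subseteq> perms n \<Longrightarrow> set_pmf (conv_pmf p q) \<subseteq> perms n"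
  unfolding conv_pmf_def by (auto intro: permutes_compose)

text \<open>
  If \<open>f \<ge> 2 * k\<close>, every factor \<open>f - i\<close> is at least \<open>f / 2\<close>.
\<close>

lemma power_le_falling_factorial: "real f ^ k \<le> (2 * real k) ^ k + 2 ^ k * real (\<Prod>i<k. f - i)"
proof (cases "f < 2 * k")
  case True
  then have "real f ^ k \<le> (2 * real k) ^ k" by (intro power_mono) auto
  also have "\<dots> \<le> (2 * real k) ^ k + 2 ^ k * real (\<Prod>i<k. f - i)" by (simp del: of_nat_prod)
  finally show ?thesis .
next
  case False
  have "real f ^ k = (\<Prod>i<k. real f)" by simp
  also have "\<dots> \<le> (\<Prod>i<k. 2 * real (f - i))"
    using False by (intro prod_mono) (auto simp: of_nat_diff)
  also have "\<dots> = 2 ^ k * real (\<Prod>i<k. f - i)" by (simp add: prod.distrib)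
  also have "\<dots> \<le> (2 * real k) ^ k + 2 ^ k * real (\<Prod>i<k. f - i)" by (simp del: of_nat_prod)
  finally show ?thesis .
qed

text \<open>
  The falling factorials of the number of fixed points and the number of points in two-cycles
  are numbers of equivariant injections, on \<open>k\<close> indices and on two indices, so
  \<open>expectation_equivariant_small\<close> applies. Falling factorials of all orders control the
  moments.
\<close>

lemma few_short_cycles_conv:
  assumes a: "few_short_cycles a" "\<And>n. set_pmf (a n) \<subseteq> perms n"
    and b: "\<And>n. set_pmf (b n) \<subseteq> perms n"
    and inv: "\<And>n. conj_invariant n (a n) \<or> conj_invariant n (b n)"
  shows "few_short_cycles (\<lambda>n. conv_pmf (a n) (b n))"
proof -
  let ?c = "\<lambda>n. conv_pmf (a n) (b n)"
  let ?E = "\<lambda>n. measure_pmf.expectation (?c n) :: ((nat \<Rightarrow> nat) \<Rightarrow> real) \<Rightarrow> real"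
  have c: "set_pmf (?c n) \<subseteq> perms n" for n by (rule set_conv_pmf[OF a(2) b])
  note fin = finite_set_pmf_perms[OF c]
  have small: "(\<lambda>n. ?E n (\<lambda>s. real (card (equivariant (cycle_index A l) (cycle_shift l) n s)))
      / sqrt (real n) ^ card (cycle_index A l)) \<longlonglongrightarrow> 0"
    if "finite A" "cycle_index A l \<noteq> {}" for A :: "'z set" and l
    by (rule expectation_equivariant_small[OF a b inv finite_cycle_index _ bij_betw_cycle_shift])
       (use that in auto)
  have Econg: "?E n f = ?E n g" if "\<And>s. s permutes {1..n} \<Longrightarrow> f s = g s" for n f g
    using that c[of n] by (intro integral_cong_AE AE_pmfI) auto
  show ?thesis
    unfolding few_short_cycles_def
  proof (intro conjI allI impI)
    fix k :: nat assume k: "1 \<le> k"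
    let ?P = "\<lambda>n s. real (\<Prod>i<k. card (fix_pts n s) - i)"
    have cI: "card (cycle_index {..<k} (\<lambda>_. 1)) = k" by (simp add: cycle_index_def)
    have P: "(\<lambda>n. ?E n (?P n) / sqrt (real n) ^ k) \<longlonglongrightarrow> 0"
    proof -
      have "cycle_index {..<k} (\<lambda>_. 1) \<noteq> {}" using k cI by (metis card.empty not_one_le_zero)
      from small[OF _ this] have "(\<lambda>n. ?E n (\<lambda>s. real (card (equivariant (cycle_index {..<k} (\<lambda>_. 1)) (cycle_shift (\<lambda>_. 1)) n s)))
          / sqrt (real n) ^ k) \<longlonglongrightarrow> 0" unfolding cI by simp
      moreover have "?E n (\<lambda>s. real (card (equivariant (cycle_index {..<k} (\<lambda>_. 1)) (cycle_shift (\<lambda>_. 1)) n s)))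
          = ?E n (?P n)" for n
        by (rule Econg) (simp only: card_equivariant_fixed_points)
      ultimately show ?thesis by simp
    qed
    have invs: "(\<lambda>n. 1 / sqrt (real n) ^ k) \<longlonglongrightarrow> 0"
    proof -
      have "(\<lambda>n. inverse (sqrt (real n))) \<longlonglongrightarrow> 0"
        by (rule tendsto_inverse_0_at_top[OF filterlim_compose[OF sqrt_at_top filterlim_real_sequentially]])
      from tendsto_power[OF this, of k] show ?thesis
        using k by (simp add: power_one_over inverse_eq_divide power_0_left)
    qed
    show "(\<lambda>n. ?E n (\<lambda>s. (real (card (fix_pts n s)) / sqrt (real n)) ^ k)) \<longlonglongrightarrow> 0"
    proof (rule tendsto_sandwich[OF _ _ tendsto_const])
      show "(\<lambda>n. (2 * real k) ^ k * (1 / sqrt (real n) ^ k) + 2 ^ k * (?E n (?P n) / sqrt (real n) ^ k)) \<longlonglongrightarrow> 0"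
        by (rule tendsto_add_zero; rule tendsto_mult_right_zero) (rule invs P)+
      show "\<forall>\<^sub>F n in sequentially. 0 \<le> ?E n (\<lambda>s. (real (card (fix_pts n s)) / sqrt (real n)) ^ k)"
        by simp
      have "?E n (\<lambda>s. (real (card (fix_pts n s)) / sqrt (real n)) ^ k) \<le>
          (2 * real k) ^ k * (1 / sqrt (real n) ^ k) + 2 ^ k * (?E n (?P n) / sqrt (real n) ^ k)" for n
      proof -
        have "?E n (\<lambda>s. (real (card (fix_pts n s)) / sqrt (real n)) ^ k) \<le>
            ?E n (\<lambda>s. ((2 * real k) ^ k + 2 ^ k * ?P n s) / sqrt (real n) ^ k)"
        proof (rule expectation_mono_finite[OF fin])
          fix s
          show "(real (card (fix_pts n s)) / sqrt (real n)) ^ k \<le> ((2 * real k) ^ k + 2 ^ k * ?P n s) / sqrt (real n) ^ k"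
            unfolding power_divide by (rule divide_right_mono[OF power_le_falling_factorial]) simp
        qed
        also have "\<dots> = ((2 * real k) ^ k + 2 ^ k * ?E n (?P n)) / sqrt (real n) ^ k"
          by (simp add: integrable_measure_pmf_finite[OF fin] del: of_nat_prod)
        finally show ?thesis by (simp add: add_divide_distrib)
      qed
      then show "\<forall>\<^sub>F n in sequentially. ?E n (\<lambda>s. (real (card (fix_pts n s)) / sqrt (real n)) ^ k) \<le>
          (2 * real k) ^ k * (1 / sqrt (real n) ^ k) + 2 ^ k * (?E n (?P n) / sqrt (real n) ^ k)"
        by simp
    qed
  next
    have cI: "card (cycle_index {()} (\<lambda>_. 2)) = 2" by (simp add: cycle_index_def)
    have "cycle_index {()} (\<lambda>_. 2) \<noteq> {}" using cI by (metis card.empty zero_neq_numeral)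
    from small[OF _ this] have "(\<lambda>n. ?E n (\<lambda>s. real (card (equivariant (cycle_index {()} (\<lambda>_. 2)) (cycle_shift (\<lambda>_. 2)) n s)))
        / real n) \<longlonglongrightarrow> 0" unfolding cI by simp
    moreover have "?E n (\<lambda>s. real (card (equivariant (cycle_index {()} (\<lambda>_. 2)) (cycle_shift (\<lambda>_. 2)) n s))) =
        ?E n (\<lambda>s. real (card (two_pts n s)))" for n
      by (rule Econg) (simp only: card_equivariant_two_cycle)
    ultimately show "(\<lambda>n. ?E n (\<lambda>s. real (card (two_pts n s)) / real n)) \<longlonglongrightarrow> 0"
      by simp
  qed
qed

section \<open>Bonferroni inequalities and Poisson limits\<close>

lemma alternating_binomial_partial_sum:
  "(\<Sum>j\<le>J. (- 1) ^ j * real (Suc m choose j)) = (- 1) ^ J * real (m choose J)"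
  by (induction J) (simp_all add: algebra_simps)

text \<open>
  The expansion of the event \<open>x = c\<close> by inclusion and exclusion,
  \<open>(x choose c) * (\<Sum>j. (- 1) ^ j * ((x - c) choose j))\<close>, truncated after \<open>j = J\<close> and rewritten
  in terms of the binomial coefficients of \<open>x\<close>.
\<close>

definition bonferroni :: "nat \<Rightarrow> nat \<Rightarrow> nat \<Rightarrow> real" where
  "bonferroni J c x = (\<Sum>j\<le>J. (- 1) ^ j * real ((c + j) choose c) * real (x choose (c + j)))"

text \<open>
  The absolute value of the first term left out by \<open>bonferroni\<close>.
\<close>

definition bonferroni_error :: "nat \<Rightarrow> nat \<Rightarrow> nat \<Rightarrow> real" where
  "bonferroni_error J c x = real ((c + Suc J) choose c) * real (x choose (c + Suc J))"

lemma bonferroni_error_bound: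
  "\<bar>of_bool (x = c) - bonferroni J c x\<bar> \<le> bonferroni_error J c x"
proof (cases "x < c")
  case True
  then show ?thesis by (simp add: bonferroni_def bonferroni_error_def binomial_eq_0)
next
  case False
  then obtain m where m: "x = c + m" using le_Suc_ex by (metis not_less)
  have bin: "((c + j) choose c) * (x choose (c + j)) = (x choose c) * (m choose j)" for j
  proof (cases "j \<le> m")
    case True
    then show ?thesis using choose_mult[of c "c + j" x] m by (simp add: mult.commute)
  next
    case False
    then show ?thesis using m by (simp add: binomial_eq_0)
  qed
  have S: "bonferroni J c x = real (x choose c) * (\<Sum>j\<le>J. (- 1) ^ j * real (m choose j))"
    unfolding bonferroni_def sum_distrib_left
    by (rule sum.cong) (use bin in \<open>simp_all add: mult.assoc mult.left_commute flip: of_nat_mult\<close>)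
  have R: "bonferroni_error J c x = real (x choose c) * real (m choose Suc J)"
    unfolding bonferroni_error_def using bin[of "Suc J"] by (simp flip: of_nat_mult)
  show ?thesis
  proof (cases m)
    case 0
    have "(\<Sum>j\<le>J. (- 1) ^ j * real (0 choose j)) = (1::real)"
      by (induction J) auto
    then show ?thesis unfolding S R using m 0 by simp
  next
    case (Suc m')
    have "\<bar>bonferroni J c x\<bar> = real (x choose c) * real (m' choose J)"
      unfolding S Suc alternating_binomial_partial_sum by (simp add: abs_mult power_abs)
    also have "\<dots> \<le> bonferroni_error J c x"
      unfolding R Suc by (intro mult_left_mono) auto
    finally show ?thesis using m Suc by simp
  qed
qed

text \<open>
  Expanding \<open>(\<Prod>d\<in>D. a d + (b d - a d))\<close>, the terms other than \<open>\<Prod>d\<in>D. a d\<close> are bounded by the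
  corresponding terms of \<open>(\<Prod>d\<in>D. 1 + r d)\<close>.
\<close>

lemma prod_perturbation_bound:
  fixes a b r :: "'d \<Rightarrow> real"
  assumes "finite D" "\<And>d. d \<in> D \<Longrightarrow> \<bar>a d\<bar> \<le> 1" "\<And>d. d \<in> D \<Longrightarrow> \<bar>a d - b d\<bar> \<le> r d"
  shows "\<bar>(\<Prod>d\<in>D. a d) - (\<Prod>d\<in>D. b d)\<bar> \<le> (\<Prod>d\<in>D. 1 + r d) - 1"
  using assms
proof (induction D rule: finite_induct)
  case (insert x D)
  let ?A = "\<Prod>d\<in>D. a d" and ?B = "\<Prod>d\<in>D. b d" and ?R = "\<Prod>d\<in>D. 1 + r d"
  have IH: "\<bar>?A - ?B\<bar> \<le> ?R - 1" using insert by auto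
  have x: "\<bar>a x\<bar> \<le> 1" "\<bar>a x - b x\<bar> \<le> r x" using insert by auto
  have A: "\<bar>?A\<bar> \<le> 1" unfolding abs_prod using insert by (intro prod_le_1) auto
  have B: "\<bar>?B\<bar> \<le> ?R" using IH A by linarith
  have "a x * ?A - b x * ?B = a x * (?A - ?B) + (a x - b x) * ?B" by (simp add: algebra_simps)
  then have "\<bar>a x * ?A - b x * ?B\<bar> \<le> \<bar>a x\<bar> * \<bar>?A - ?B\<bar> + \<bar>a x - b x\<bar> * \<bar>?B\<bar>"
    by (metis abs_mult abs_triangle_ineq)
  also have "\<dots> \<le> 1 * (?R - 1) + r x * ?R"
    using x IH B by (intro add_mono mult_mono) auto
  finally show ?case using insert by (simp add: algebra_simps)
qed auto

text \<open>
  For a fixed truncation \<open>J\<close>, the truncated expansion of the event \<open>x = c\<close> and its error bound are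
  linear combinations of products of binomial coefficients, so their expectations converge. The
  limits are products over \<open>d\<close> of partial sums of the exponential series, and of error terms
  that vanish as \<open>J\<close> grows; the partial sums converge to the Poisson probabilities.
\<close>

lemma Poisson_limit_of_binomial_moments:
  fixes Q :: "nat \<Rightarrow> ('d \<Rightarrow> nat) pmf" and rate :: "'d \<Rightarrow> real"
  assumes D: "finite D"
    and fin: "\<And>n. finite (set_pmf (Q n))"
    and ext: "\<And>n x d. x \<in> set_pmf (Q n) \<Longrightarrow> d \<notin> D \<Longrightarrow> x d = dflt"
    and rate: "\<And>d. d \<in> D \<Longrightarrow> rate d > 0"
    and mom: "\<And>a. (\<lambda>n. measure_pmf.expectation (Q n) (\<lambda>x. \<Prod>d\<in>D. real (x d choose a d)))
                \<longlonglongrightarrow> (\<Prod>d\<in>D. rate d ^ a d / fact (a d))"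
  shows "(\<lambda>n. pmf (Q n) c) \<longlonglongrightarrow> pmf (Pi_pmf D dflt (\<lambda>d. poisson_pmf (rate d))) c"
proof (cases "\<forall>d. d \<notin> D \<longrightarrow> c d = dflt")
  case False
  then have "pmf (Q n) c = 0" for n using ext by (auto simp: pmf_eq_0_set_pmf)
  moreover have "pmf (Pi_pmf D dflt (\<lambda>d. poisson_pmf (rate d))) c = 0"
    using False D by (intro pmf_Pi_outside) auto
  ultimately show ?thesis by simp
next
  case True
  let ?E = "\<lambda>n. measure_pmf.expectation (Q n) :: (_ \<Rightarrow> real) \<Rightarrow> real"
  have int: "integrable (measure_pmf (Q n)) f" for n and f :: "_ \<Rightarrow> real"
    by (rule integrable_measure_pmf_finite[OF fin])
  have lin: "(\<lambda>n. ?E n (\<lambda>x. \<Prod>d\<in>D. \<Sum>b\<le>B. w d b * real (x d choose b)))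
      \<longlonglongrightarrow> (\<Prod>d\<in>D. \<Sum>b\<le>B. w d b * (rate d ^ b / fact b))" for w :: "'d \<Rightarrow> nat \<Rightarrow> real" and B
  proof -
    let ?G = "PiE D (\<lambda>_. {..B})"
    have "?E n (\<lambda>x. \<Prod>d\<in>D. \<Sum>b\<le>B. w d b * real (x d choose b)) =
          (\<Sum>g\<in>?G. (\<Prod>d\<in>D. w d (g d)) * ?E n (\<lambda>x. \<Prod>d\<in>D. real (x d choose g d)))" for n
      using D by (simp add: prod_sum_PiE prod.distrib Bochner_Integration.integral_sum int)
    moreover have "(\<Prod>d\<in>D. \<Sum>b\<le>B. w d b * (rate d ^ b / fact b)) =
          (\<Sum>g\<in>?G. (\<Prod>d\<in>D. w d (g d)) * (\<Prod>d\<in>D. rate d ^ g d / fact (g d)))"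
      using D by (subst prod_sum_PiE) (simp_all flip: prod.distrib)
    ultimately show ?thesis
      by (simp only:) (intro tendsto_sum tendsto_mult tendsto_const mom)
  qed
  define s where "s = (\<lambda>J d. \<Sum>j\<le>J. (- 1) ^ j * real ((c d + j) choose c d) *
      (rate d ^ (c d + j) / fact (c d + j)))"
  define e where "e = (\<lambda>J d. real ((c d + Suc J) choose c d) *
      (rate d ^ (c d + Suc J) / fact (c d + Suc J)))"
  have choose_fact: "real ((p + q) choose p) * (y / fact (p + q)) = y / (fact p * fact q)"
    for p q and y :: real
    by (simp add: binomial_fact field_simps)
  have s_eq: "s J d = rate d ^ c d / fact (c d) * (\<Sum>j\<le>J. (- rate d) ^ j / fact j)" for J d
    unfolding s_def sum_distrib_left
  proof (rule sum.cong[OF refl])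
    fix j
    have "(- 1) ^ j * real ((c d + j) choose c d) * (rate d ^ (c d + j) / fact (c d + j)) =
        (- 1) ^ j * (rate d ^ (c d + j) / (fact (c d) * fact j))"
      by (simp only: mult.assoc choose_fact)
    then show "(- 1) ^ j * real ((c d + j) choose c d) * (rate d ^ (c d + j) / fact (c d + j)) =
        rate d ^ c d / fact (c d) * ((- rate d) ^ j / fact j)"
      by (simp add: power_add power_minus[of "rate d"])
  qed
  have e_eq: "e J d = rate d ^ c d / fact (c d) * (rate d ^ Suc J / fact (Suc J))" for J d
    unfolding e_def choose_fact by (simp add: power_add)
  have s_lim: "(\<lambda>J. s J d) \<longlonglongrightarrow> pmf (poisson_pmf (rate d)) (c d)" if "d \<in> D" for d
  proof -
    have "(\<lambda>J. \<Sum>j\<le>J. (- rate d) ^ j / fact j) \<longlonglongrightarrow> exp (- rate d)"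
      using exp_converges[of "- rate d"] unfolding sums_def_le by (simp add: field_simps)
    then show ?thesis unfolding s_eq using rate[OF that] by (auto intro!: tendsto_eq_intros)
  qed
  have e_lim: "(\<lambda>J. e J d) \<longlonglongrightarrow> 0" for d
  proof -
    have "(\<lambda>J. rate d ^ Suc J / fact (Suc J)) \<longlonglongrightarrow> 0"
      using LIMSEQ_Suc[OF summable_LIMSEQ_zero[OF summable_exp[of "rate d"]]] by (simp add: field_simps)
    then show ?thesis unfolding e_eq by (rule tendsto_mult_right_zero)
  qed
  \<comment> \<open>A common upper bound for the orders of the binomial coefficients, as \<open>lin\<close> uses the same
    range of summation for every coordinate.\<close>
  define Cm where "Cm = (\<Sum>d\<in>D. c d)"
  have cm: "c d \<le> Cm" if "d \<in> D" for d
    unfolding Cm_def using D that by (intro member_le_sum) auto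
  have limS: "(\<lambda>n. ?E n (\<lambda>x. \<Prod>d\<in>D. bonferroni J (c d) (x d))) \<longlonglongrightarrow> (\<Prod>d\<in>D. s J d)" for J
  proof -
    define w where "w = (\<lambda>d b. if c d \<le> b \<and> b \<le> c d + J
        then (- 1) ^ (b - c d) * real (b choose c d) else 0)"
    have gen: "(\<Sum>j\<le>J. (- 1) ^ j * real ((c d + j) choose c d) * h (c d + j)) =
        (\<Sum>b\<le>Cm + J. w d b * h b)" if "d \<in> D" for d and h :: "nat \<Rightarrow> real"
    proof -
      have "(\<Sum>b\<le>Cm + J. w d b * h b) = (\<Sum>b\<in>{c d..c d+J}. w d b * h b)"
        by (rule sum.mono_neutral_right) (use cm[OF that] in \<open>auto simp: w_def\<close>)
      also have "\<dots> = (\<Sum>j\<le>J. (- 1) ^ j * real ((c d + j) choose c d) * h (c d + j))"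
        by (rule sum.reindex_bij_witness[of _ "\<lambda>j. c d + j" "\<lambda>b. b - c d"]) (auto simp: w_def)
      finally show ?thesis by simp
    qed
    have "(\<Prod>d\<in>D. bonferroni J (c d) (x d)) = (\<Prod>d\<in>D. \<Sum>b\<le>Cm + J. w d b * real (x d choose b))" for x
      unfolding bonferroni_def by (rule prod.cong[OF refl]) (rule gen)
    moreover have "(\<Prod>d\<in>D. s J d) = (\<Prod>d\<in>D. \<Sum>b\<le>Cm + J. w d b * (rate d ^ b / fact b))"
      unfolding s_def by (rule prod.cong[OF refl]) (rule gen)
    ultimately show ?thesis using lin[of w "Cm + J"] by (simp only:)
  qed
  have limR: "(\<lambda>n. ?E n (\<lambda>x. \<Prod>d\<in>D. 1 + bonferroni_error J (c d) (x d)))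
      \<longlonglongrightarrow> (\<Prod>d\<in>D. 1 + e J d)" for J
  proof -
    define w where "w = (\<lambda>d b. (if b = 0 then 1 else 0) +
        (if b = c d + Suc J then real ((c d + Suc J) choose c d) else 0))"
    have gen: "1 + real ((c d + Suc J) choose c d) * h (c d + Suc J) =
        (\<Sum>b\<le>Cm + Suc J. w d b * h b)" if "d \<in> D" "h 0 = 1" for d and h :: "nat \<Rightarrow> real"
    proof -
      have "(\<Sum>b\<le>Cm + Suc J. w d b * h b) = (\<Sum>b\<in>{0, c d + Suc J}. w d b * h b)"
        by (rule sum.mono_neutral_right) (use cm[OF that(1)] in \<open>auto simp: w_def\<close>)
      then show ?thesis using that(2) by (simp add: w_def)
    qed
    have "(\<Prod>d\<in>D. 1 + bonferroni_error J (c d) (x d)) =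
        (\<Prod>d\<in>D. \<Sum>b\<le>Cm + Suc J. w d b * real (x d choose b))" for x
      unfolding bonferroni_error_def by (rule prod.cong[OF refl], rule gen) auto
    moreover have "(\<Prod>d\<in>D. 1 + e J d) = (\<Prod>d\<in>D. \<Sum>b\<le>Cm + Suc J. w d b * (rate d ^ b / fact b))"
      unfolding e_def by (rule prod.cong[OF refl], rule gen) auto
    ultimately show ?thesis using lin[of w "Cm + Suc J"] by (simp only:)
  qed
  have bound: "\<bar>pmf (Q n) c - ?E n (\<lambda>x. \<Prod>d\<in>D. bonferroni J (c d) (x d))\<bar>
      \<le> ?E n (\<lambda>x. \<Prod>d\<in>D. 1 + bonferroni_error J (c d) (x d)) - 1" for n J
  proof -
    have "pmf (Q n) c = ?E n (\<lambda>x. \<Prod>d\<in>D. of_bool (x d = c d))"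
    proof -
      have "?E n (\<lambda>x. \<Prod>d\<in>D. of_bool (x d = c d)) = ?E n (indicator {c})"
      proof (intro integral_cong_AE AE_pmfI)
        fix x assume x: "x \<in> set_pmf (Q n)"
        show "(\<Prod>d\<in>D. of_bool (x d = c d)) = (indicator {c} x :: real)"
        proof (cases "x = c")
          case False
          then obtain d where "d \<in> D" "x d \<noteq> c d"
            using ext[OF x] True by (metis HOL.ext)
          then show ?thesis using D False by (auto intro!: prod_zero)
        qed simp
      qed simp_all
      then show ?thesis by (simp add: pmf.rep_eq)
    qed
    then have "\<bar>pmf (Q n) c - ?E n (\<lambda>x. \<Prod>d\<in>D. bonferroni J (c d) (x d))\<bar> =
       \<bar>?E n (\<lambda>x. (\<Prod>d\<in>D. of_bool (x d = c d)) - (\<Prod>d\<in>D. bonferroni J (c d) (x d)))\<bar>"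
      by (simp add: int)
    also have "\<dots> \<le> ?E n (\<lambda>x. \<bar>(\<Prod>d\<in>D. of_bool (x d = c d)) - (\<Prod>d\<in>D. bonferroni J (c d) (x d))\<bar>)"
      by (rule integral_abs_bound)
    also have "\<dots> \<le> ?E n (\<lambda>x. (\<Prod>d\<in>D. 1 + bonferroni_error J (c d) (x d)) - 1)"
      by (intro integral_mono int prod_perturbation_bound[OF D]) (auto simp: bonferroni_error_bound)
    finally show ?thesis by (simp add: int)
  qed
  have limJ1: "(\<lambda>J. \<Prod>d\<in>D. s J d) \<longlonglongrightarrow> (\<Prod>d\<in>D. pmf (poisson_pmf (rate d)) (c d))"
    by (intro tendsto_prod s_lim)
  have limJ2: "(\<lambda>J. (\<Prod>d\<in>D. 1 + e J d) - 1) \<longlonglongrightarrow> 0"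
  proof -
    have "(\<lambda>J. (\<Prod>d\<in>D. 1 + e J d) - 1) \<longlonglongrightarrow> (\<Prod>d\<in>D. 1 + 0) - 1"
      by (intro tendsto_diff tendsto_prod tendsto_add tendsto_const e_lim)
    then show ?thesis by simp
  qed
  have P: "pmf (Pi_pmf D dflt (\<lambda>d. poisson_pmf (rate d))) c = (\<Prod>d\<in>D. pmf (poisson_pmf (rate d)) (c d))"
    using D True by (intro pmf_Pi') auto
  show ?thesis unfolding P
  proof (rule tendstoI)
    fix r :: real assume r: "r > 0"
    let ?p = "\<Prod>d\<in>D. pmf (poisson_pmf (rate d)) (c d)"
    have r4: "r / 4 > 0" using r by simp
    have triangle: "dist q p < r"
      if "dist s p < r / 4" "dist (e - 1) 0 < r / 4" "dist S s < r / 4" "dist R e < r / 4"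
         "\<bar>q - S\<bar> \<le> R - 1" for q p s e S R :: real
      using that unfolding dist_real_def by linarith
    have "eventually (\<lambda>J. dist (\<Prod>d\<in>D. s J d) ?p < r / 4 \<and>
        dist ((\<Prod>d\<in>D. 1 + e J d) - 1) 0 < r / 4) sequentially"
      by (intro eventually_conj tendstoD[OF limJ1 r4] tendstoD[OF limJ2 r4])
    then obtain J where J: "dist (\<Prod>d\<in>D. s J d) ?p < r / 4"
        "dist ((\<Prod>d\<in>D. 1 + e J d) - 1) 0 < r / 4"
      using eventually_happens'[OF sequentially_bot, of "\<lambda>J. dist (\<Prod>d\<in>D. s J d) ?p < r / 4 \<and>
        dist ((\<Prod>d\<in>D. 1 + e J d) - 1) 0 < r / 4"] by blast
    show "eventually (\<lambda>n. dist (pmf (Q n) c) ?p < r) sequentially"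
      using tendstoD[OF limS[of J] r4] tendstoD[OF limR[of J] r4]
    proof eventually_elim
      case (elim n)
      show ?case by (rule triangle[OF J(1) J(2) elim(1) elim(2) bound[of n J]])
    qed
  qed
qed

text \<open>
  By Scheffe's lemma, pointwise convergence of probability masses to a probability mass
  function implies convergence in \<open>L\<^sup>1\<close> of the counting measure.
\<close>

lemma expectation_tendsto_if_pmf_tendsto:
  fixes Q :: "nat \<Rightarrow> 'x pmf" and f :: "'x \<Rightarrow> real"
  assumes lim: "\<And>x. (\<lambda>n. pmf (Q n) x) \<longlonglongrightarrow> pmf R x" and f: "\<And>x. \<bar>f x\<bar> \<le> B"
  shows "(\<lambda>n. measure_pmf.expectation (Q n) f) \<longlonglongrightarrow> measure_pmf.expectation R f"
proof -
  let ?C = "count_space (UNIV :: 'x set)"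
  have int: "integrable ?C (pmf p)" for p :: "'x pmf"
    by (simp add: integrable_pmf)
  have L0: "(\<lambda>n. \<integral>\<^sup>+ x. norm (pmf (Q n) x - pmf R x) \<partial>?C) \<longlonglongrightarrow> 0"
  proof (rule Scheffe_lemma2)
    have one: "(\<integral>\<^sup>+ x. norm (pmf p x) \<partial>?C) = 1" for p :: "'x pmf"
      by (simp add: nn_integral_pmf measure_pmf.emeasure_space_1[of p, simplified])
    show "(\<integral>\<^sup>+ x. norm (pmf (Q n) x) \<partial>?C) \<le> (\<integral>\<^sup>+ x. norm (pmf R x) \<partial>?C)" for n
      by (simp only: one)
    show "AE x in ?C. (\<lambda>n. pmf (Q n) x) \<longlonglongrightarrow> pmf R x"
      using lim by simp
  qed (simp_all add: int)
  have eq: "(\<integral>\<^sup>+ x. norm (pmf (Q n) x - pmf R x) \<partial>?C) = ennreal (\<integral>x. \<bar>pmf (Q n) x - pmf R x\<bar> \<partial>?C)" for n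
    using nn_integral_eq_integral[of ?C "\<lambda>x. \<bar>pmf (Q n) x - pmf R x\<bar>"] int by simp
  have L1: "(\<lambda>n. \<integral>x. \<bar>pmf (Q n) x - pmf R x\<bar> \<partial>?C) \<longlonglongrightarrow> 0"
  proof (rule iffD1[OF tendsto_ennreal_iff])
    show "(\<lambda>n. ennreal (\<integral>x. \<bar>pmf (Q n) x - pmf R x\<bar> \<partial>?C)) \<longlonglongrightarrow> ennreal 0"
      using L0 unfolding eq ennreal_0 .
  qed simp_all
  have B: "B \<ge> 0" using order_trans[OF abs_ge_zero f[of undefined]] .
  have ex: "measure_pmf.expectation p f = (\<integral>x. pmf p x * f x \<partial>?C)" for p
    by (simp add: measure_pmf_eq_density integral_density)
  have intf: "integrable ?C (\<lambda>x. pmf p x * f x)" for p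
  proof (rule Bochner_Integration.integrable_bound)
    show "integrable ?C (\<lambda>x. B * pmf p x)" by (simp add: int)
    have "norm (pmf p x * f x) \<le> norm (B * pmf p x)" for x
      using mult_left_mono[OF f[of x], of "pmf p x"] B by (simp add: abs_mult mult.commute)
    then show "AE x in ?C. norm (pmf p x * f x) \<le> norm (B * pmf p x)" by simp
  qed simp
  have "\<bar>measure_pmf.expectation (Q n) f - measure_pmf.expectation R f\<bar>
      \<le> B * (\<integral>x. \<bar>pmf (Q n) x - pmf R x\<bar> \<partial>?C)" for n
  proof -
    have "\<bar>measure_pmf.expectation (Q n) f - measure_pmf.expectation R f\<bar> =
        \<bar>\<integral>x. (pmf (Q n) x - pmf R x) * f x \<partial>?C\<bar>"
      by (simp add: ex intf left_diff_distrib)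
    also have "\<dots> \<le> (\<integral>x. \<bar>(pmf (Q n) x - pmf R x) * f x\<bar> \<partial>?C)"
      by (rule integral_abs_bound)
    also have "\<dots> \<le> (\<integral>x. B * \<bar>pmf (Q n) x - pmf R x\<bar> \<partial>?C)"
    proof (rule integral_mono)
      show "integrable ?C (\<lambda>x. \<bar>(pmf (Q n) x - pmf R x) * f x\<bar>)"
        by (simp add: left_diff_distrib intf)
      show "\<bar>(pmf (Q n) x - pmf R x) * f x\<bar> \<le> B * \<bar>pmf (Q n) x - pmf R x\<bar>" for x
        using mult_right_mono[OF f[of x], of "\<bar>pmf (Q n) x - pmf R x\<bar>"] by (simp add: abs_mult mult.commute)
    qed (simp add: int)
    finally show ?thesis by simp
  qed
  then have "(\<lambda>n. measure_pmf.expectation (Q n) f - measure_pmf.expectation R f) \<longlonglongrightarrow> 0"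
    by (intro Lim_null_comparison[OF _ tendsto_mult_right_zero[OF L1, of B]]) auto
  then show ?thesis using LIM_zero_iff by blast
qed

section \<open>Cycle counts of a product of two permutations\<close>

definition cycle_vec :: "nat \<Rightarrow> nat \<Rightarrow> (nat \<Rightarrow> nat) \<Rightarrow> nat \<Rightarrow> nat" where
  "cycle_vec k n s = (\<lambda>d\<in>{1..k}. cycle_count n d s)"

text \<open>
  The expected number of equivariant injections for the cycle type \<open>\<alpha>\<close> tends to \<open>1\<close>; dividing
  by \<open>\<Prod>d. d ^ \<alpha> d * fact (\<alpha> d)\<close> gives exactly the binomial moments of independent Poisson
  variables with parameters \<open>1 / d\<close>.
\<close>

lemma cycle_counts_converge:
  fixes h :: "(nat \<Rightarrow> nat) \<Rightarrow> real"
  assumes a: "few_short_cycles a" "\<And>n. set_pmf (a n) \<subseteq> perms n"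
    and b: "few_short_cycles b" "\<And>n. set_pmf (b n) \<subseteq> perms n"
    and inv: "\<And>n. conj_invariant n (a n) \<or> conj_invariant n (b n)"
    and h: "\<And>x. \<bar>h x\<bar> \<le> B"
  shows "(\<lambda>n. measure_pmf.expectation (conv_pmf (a n) (b n)) (\<lambda>s. h (cycle_vec k n s)))
    \<longlonglongrightarrow> measure_pmf.expectation (Pi_pmf {1..k} undefined (\<lambda>d. poisson_pmf (1 / real d))) h"
proof -
  let ?c = "\<lambda>n. conv_pmf (a n) (b n)"
  let ?Q = "\<lambda>n. map_pmf (cycle_vec k n) (?c n)"
  have c: "set_pmf (?c n) \<subseteq> perms n" for n by (rule set_conv_pmf[OF a(2) b(2)])
  note fin = finite_set_pmf_perms[OF c]
  have "(\<lambda>n. pmf (?Q n) x) \<longlonglongrightarrow> pmf (Pi_pmf {1..k} undefined (\<lambda>d. poisson_pmf (1 / real d))) x" for x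
  proof (rule Poisson_limit_of_binomial_moments)
    fix \<alpha> :: "nat \<Rightarrow> nat"
    let ?A = "SIGMA d:{1..k}. {..<\<alpha> d}"
    let ?W = "\<Prod>d\<in>{1..k}. real d ^ \<alpha> d * fact (\<alpha> d)"
    let ?X = "\<lambda>n s. real (card (equivariant (cycle_index ?A fst) (cycle_shift fst) n s))"
    have W: "?W > 0" by (intro prod_pos) auto
    have "(\<lambda>n. measure_pmf.expectation (?c n) (?X n)) \<longlonglongrightarrow> 1"
      by (rule expectation_equivariant_tendsto_1[OF a b inv finite_cycle_index bij_betw_cycle_shift]) auto
    then have "(\<lambda>n. measure_pmf.expectation (?c n) (?X n) / ?W) \<longlonglongrightarrow> 1 / ?W"
      by (rule tendsto_divide[OF _ tendsto_const]) (use W in auto)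
    moreover have "measure_pmf.expectation (?c n) (?X n) / ?W =
        measure_pmf.expectation (?Q n) (\<lambda>x. \<Prod>d\<in>{1..k}. real (x d choose \<alpha> d))" for n
    proof -
      have "measure_pmf.expectation (?c n) (?X n) =
          measure_pmf.expectation (?c n) (\<lambda>s. ?W * (\<Prod>d\<in>{1..k}. real (cycle_vec k n s d choose \<alpha> d)))"
      proof (rule integral_cong_AE)
        show "AE s in ?c n. ?X n s = ?W * (\<Prod>d\<in>{1..k}. real (cycle_vec k n s d choose \<alpha> d))"
        proof (rule AE_pmfI)
          fix s assume "s \<in> set_pmf (?c n)"
          then have "s permutes {1..n}" using c by blast
          from card_equivariant_cycle_type[OF this, of k \<alpha>]
          show "?X n s = ?W * (\<Prod>d\<in>{1..k}. real (cycle_vec k n s d choose \<alpha> d))"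
            unfolding cycle_vec_def by simp
        qed
      qed simp_all
      then show ?thesis using W by (simp del: of_nat_prod prod_zero_iff)
    qed
    moreover have "1 / ?W = (\<Prod>d\<in>{1..k}. (1 / real d) ^ \<alpha> d / fact (\<alpha> d))"
      by (simp add: power_one_over prod_dividef)
    ultimately show "(\<lambda>n. measure_pmf.expectation (?Q n) (\<lambda>x. \<Prod>d\<in>{1..k}. real (x d choose \<alpha> d)))
        \<longlonglongrightarrow> (\<Prod>d\<in>{1..k}. (1 / real d) ^ \<alpha> d / fact (\<alpha> d))"
      by (simp only:)
  next
    fix n x and d :: nat assume "x \<in> set_pmf (?Q n)" "d \<notin> {1..k}"
    then show "x d = undefined" unfolding cycle_vec_def by auto
  next
    fix n show "finite (set_pmf (?Q n))" using fin by simp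
  qed auto
  from expectation_tendsto_if_pmf_tendsto[OF this h] show ?thesis by simp
qed

section \<open>Laws of products of independent permutations\<close>

definition prod_law :: "('l \<Rightarrow> ('x \<Rightarrow> 'x) pmf) \<Rightarrow> 'l list \<Rightarrow> ('x \<Rightarrow> 'x) pmf" where
  "prod_law p ls = foldr (\<lambda>l. conv_pmf (p l)) ls (return_pmf id)"

lemma prod_law_simps [simp]:
  "prod_law p [] = return_pmf id" "prod_law p (l # ls) = conv_pmf (p l) (prod_law p ls)"
  unfolding prod_law_def by simp_all

lemma conv_pmf_bind: "conv_pmf p q = bind_pmf p (\<lambda>s. bind_pmf q (\<lambda>t. return_pmf (s \<circ> t)))"
  unfolding conv_pmf_def pair_pmf_def map_pmf_def by (simp add: bind_assoc_pmf bind_return_pmf)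

lemma conv_pmf_assoc: "conv_pmf (conv_pmf p q) r = conv_pmf p (conv_pmf q r)"
  unfolding conv_pmf_bind by (simp add: bind_assoc_pmf bind_return_pmf comp_assoc)

lemma conv_pmf_id [simp]: "conv_pmf (return_pmf id) p = p" "conv_pmf p (return_pmf id) = p"
  unfolding conv_pmf_bind by (simp_all add: bind_return_pmf bind_return_pmf')

lemma prod_law_append: "prod_law p (ls @ ls') = conv_pmf (prod_law p ls) (prod_law p ls')"
  by (induction ls) (simp_all add: conv_pmf_assoc)

lemma set_prod_law:
  assumes "\<And>l. l \<in> set ls \<Longrightarrow> set_pmf (p l) \<subseteq> perms n"
  shows "set_pmf (prod_law p ls) \<subseteq> perms n"
  using assms
proof (induction ls)
  case Nil
  show ?case using permutes_id by simp
next
  case (Cons l ls)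
  then show ?case unfolding prod_law_simps by (intro set_conv_pmf) simp_all
qed

text \<open>
  Conjugation is a homomorphism.
\<close>

lemma conj_invariant_conv:
  assumes "conj_invariant n p" "conj_invariant n q"
  shows "conj_invariant n (conv_pmf p q)"
  unfolding conj_invariant_def
proof
  fix \<tau> assume \<tau>: "\<tau> \<in> perms n"
  have "\<tau> \<circ> inv \<tau> = id" using \<tau> permutes_inv_o(1) by blast
  then have *: "inv \<tau> \<circ> (s \<circ> t) \<circ> \<tau> = (inv \<tau> \<circ> s \<circ> \<tau>) \<circ> (inv \<tau> \<circ> t \<circ> \<tau>)" for s t
    by (metis comp_assoc comp_id id_comp)
  have "conv_pmf p q = conv_pmf (map_pmf (\<lambda>s. inv \<tau> \<circ> s \<circ> \<tau>) p) (map_pmf (\<lambda>s. inv \<tau> \<circ> s \<circ> \<tau>) q)"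
    using assms \<tau> unfolding conj_invariant_def by simp
  also have "\<dots> = map_pmf (\<lambda>s. inv \<tau> \<circ> s \<circ> \<tau>) (conv_pmf p q)"
    unfolding conv_pmf_bind map_pmf_def
    by (simp add: bind_assoc_pmf bind_return_pmf *)
  finally show "map_pmf (\<lambda>s. inv \<tau> \<circ> s \<circ> \<tau>) (conv_pmf p q) = conv_pmf p q" by simp
qed

lemma conj_invariant_prod_law:
  assumes "\<And>l. l \<in> set ls \<Longrightarrow> conj_invariant n (p l)"
  shows "conj_invariant n (prod_law p ls)"
  using assms
proof (induction ls)
  case Nil
  have "inv \<tau> \<circ> \<tau> = id" if "\<tau> \<in> perms n" for \<tau> using that permutes_inv_o(2) by blast
  then show ?case by (simp add: conj_invariant_def)
next
  case (Cons l ls)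
  then show ?case by (simp add: conj_invariant_conv)
qed

lemma expectation_conv_pmf_commute:
  fixes g :: "(nat \<Rightarrow> nat) \<Rightarrow> real"
  assumes p: "set_pmf p \<subseteq> perms n" and q: "set_pmf q \<subseteq> perms n"
    and g: "\<And>s t. s permutes {1..n} \<Longrightarrow> t permutes {1..n} \<Longrightarrow> g (s \<circ> t) = g (t \<circ> s)"
  shows "measure_pmf.expectation (conv_pmf p q) g = measure_pmf.expectation (conv_pmf q p) g"
proof -
  have "measure_pmf.expectation (conv_pmf p q) g =
      measure_pmf.expectation (pair_pmf p q) (\<lambda>x. g (fst x \<circ> snd x))"
    unfolding conv_pmf_def by (simp add: case_prod_beta)
  also have "\<dots> = measure_pmf.expectation (pair_pmf p q) (\<lambda>x. g (snd x \<circ> fst x))"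
  proof (rule integral_cong_AE)
    show "AE x in pair_pmf p q. g (fst x \<circ> snd x) = g (snd x \<circ> fst x)"
    proof (rule AE_pmfI)
      fix x assume "x \<in> set_pmf (pair_pmf p q)"
      then have "fst x permutes {1..n}" "snd x permutes {1..n}" using p q by auto
      then show "g (fst x \<circ> snd x) = g (snd x \<circ> fst x)" by (rule g)
    qed
  qed simp_all
  also have "\<dots> = measure_pmf.expectation (conv_pmf q p) g"
    unfolding conv_pmf_def by (subst (2) pair_commute_pmf) (simp add: case_prod_beta)
  finally show ?thesis .
qed

text \<open>
  The map \<open>t\<close> conjugates \<open>s \<circ> t\<close> to \<open>t \<circ> s\<close>.
\<close>

lemma perm_tr_funpow_commute:
  assumes s: "s permutes {1..n}" and t: "t permutes {1..n}"
  shows "perm_tr n ((s \<circ> t) ^^ r) = perm_tr n ((t \<circ> s) ^^ r)"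
proof -
  have shift: "((t \<circ> s) ^^ r) (t x) = t (((s \<circ> t) ^^ r) x)" for x
    by (induction r) simp_all
  have "bij_betw t {x \<in> {1..n}. ((s \<circ> t) ^^ r) x = x} {x \<in> {1..n}. ((t \<circ> s) ^^ r) x = x}"
    unfolding bij_betw_def
  proof (intro conjI equalityI subsetI)
    show "inj_on t {x \<in> {1..n}. ((s \<circ> t) ^^ r) x = x}"
      using permutes_inj[OF t] by (rule inj_on_subset) simp
  next
    fix y assume "y \<in> t ` {x \<in> {1..n}. ((s \<circ> t) ^^ r) x = x}"
    then obtain x where "x \<in> {1..n}" "((s \<circ> t) ^^ r) x = x" "y = t x" by blast
    then show "y \<in> {x \<in> {1..n}. ((t \<circ> s) ^^ r) x = x}"
      using shift[of x] permutes_in_image[OF t, of x] by simp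
  next
    fix y assume y: "y \<in> {x \<in> {1..n}. ((t \<circ> s) ^^ r) x = x}"
    define x where "x = inv t y"
    have tx: "t x = y" unfolding x_def by (rule permutes_inverses(1)[OF t])
    have "t (((s \<circ> t) ^^ r) x) = t x" using shift[of x] y tx by simp
    then have "((s \<circ> t) ^^ r) x = x" by (rule injD[OF permutes_inj[OF t]])
    moreover have "x \<in> {1..n}" using y tx permutes_in_image[OF t, of x] by simp
    ultimately show "y \<in> t ` {x \<in> {1..n}. ((s \<circ> t) ^^ r) x = x}" using tx by blast
  qed
  then have "card {x \<in> {1..n}. ((s \<circ> t) ^^ r) x = x} = card {x \<in> {1..n}. ((t \<circ> s) ^^ r) x = x}"
    by (rule bij_betw_same_card)
  then show ?thesis
    using perm_tr_eq_card_fixed_points[OF permutes_funpow[OF permutes_compose[OF t s]], of r]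
      perm_tr_eq_card_fixed_points[OF permutes_funpow[OF permutes_compose[OF s t]], of r] by simp
qed

lemma map_Pi_pmf_prod_law:
  assumes "distinct ls"
  shows "map_pmf (\<lambda>s. foldr (\<circ>) (map s ls) id) (Pi_pmf (set ls) dflt p) = prod_law p ls"
  using assms
proof (induction ls)
  case (Cons l ls)
  let ?F = "\<lambda>ls s. foldr (\<circ>) (map s ls) id"
  have upd: "map (f(l := y)) ls = map f ls" for f y using Cons.prems by simp
  have "map_pmf (?F (l # ls)) (Pi_pmf (set (l # ls)) dflt p) =
      map_pmf (\<lambda>x. ?F (l # ls) ((snd x)(l := fst x))) (pair_pmf (p l) (Pi_pmf (set ls) dflt p))"
    using Cons.prems by (simp add: Pi_pmf_insert pmf.map_comp o_def case_prod_beta)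
  also have "\<dots> = map_pmf (\<lambda>x. fst x \<circ> ?F ls (snd x)) (pair_pmf (p l) (Pi_pmf (set ls) dflt p))"
    by (simp only: list.map foldr.simps upd fun_upd_same o_def)
  also have "\<dots> = conv_pmf (p l) (map_pmf (?F ls) (Pi_pmf (set ls) dflt p))"
    unfolding conv_pmf_bind pair_pmf_def map_pmf_def by (simp add: bind_assoc_pmf bind_return_pmf)
  also have "map_pmf (?F ls) (Pi_pmf (set ls) dflt p) = prod_law p ls"
    by (rule Cons.IH) (use Cons.prems in simp)
  finally show ?case by (simp only: prod_law_simps)
qed simp

section \<open>From random variables to laws\<close>

lemma measurable_count_space_UNIV:
  assumes "X \<in> measurable M (count_space B)"
  shows "X \<in> measurable M (count_space UNIV)"
proof -
  have "id \<in> measurable (count_space B) (count_space UNIV)" by simp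
  from measurable_comp[OF assms this] show ?thesis by simp
qed

text \<open>
  All but a null set of outcomes have values of positive probability, since there are only finitely many
  values.
\<close>

lemma (in prob_space) pmf_of_finite_random_variable:
  assumes X: "X \<in> measurable M (count_space B)" and B: "finite B"
  obtains p where "set_pmf p \<subseteq> B" "measure_pmf p = distr M (count_space UNIV) X"
proof -
  note X' = measurable_count_space_UNIV[OF X]
  let ?D = "distr M (count_space UNIV) X"
  interpret D: prob_space ?D by (rule prob_space_distr[OF X'])
  have XB: "X \<omega> \<in> B" if "\<omega> \<in> space M" for \<omega> using measurable_space[OF X that] by simp
  have "AE \<omega> in M. \<forall>b\<in>B. measure ?D {b} = 0 \<longrightarrow> X \<omega> \<noteq> b"
  proof (rule AE_finite_allI[OF B])
    fix b
    show "AE \<omega> in M. measure ?D {b} = 0 \<longrightarrow> X \<omega> \<noteq> b"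
    proof (cases "measure ?D {b} = 0")
      case True
      have "X -` {b} \<inter> space M \<in> null_sets M"
      proof (rule null_setsI)
        show "X -` {b} \<inter> space M \<in> sets M" using X' by (rule measurable_sets) simp
        show "emeasure M (X -` {b} \<inter> space M) = 0"
          using True by (simp add: measure_distr[OF X'] emeasure_eq_measure)
      qed
      then have "AE \<omega> in M. \<omega> \<notin> X -` {b} \<inter> space M" by (rule AE_not_in)
      then show ?thesis using AE_space by eventually_elim auto
    qed simp
  qed
  then have "AE \<omega> in M. measure ?D {X \<omega>} \<noteq> 0"
    using AE_space by eventually_elim (use XB in blast)
  then have AE: "AE x in ?D. measure ?D {x} \<noteq> 0"
    by (subst AE_distr_iff[OF X']) simp_all
  define p where "p = Abs_pmf ?D"
  have p: "measure_pmf p = ?D"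
    unfolding p_def by (rule Abs_pmf_inverse) (use AE D.prob_space_axioms in simp)
  have "set_pmf p \<subseteq> B"
  proof
    fix x assume "x \<in> set_pmf p"
    then have "measure ?D {x} \<noteq> 0" unfolding p[symmetric] by (simp add: measure_pmf_single set_pmf_iff)
    then have "X -` {x} \<inter> space M \<noteq> {}" by (auto simp: measure_distr[OF X'])
    then show "x \<in> B" using XB by auto
  qed
  then show thesis using p that by blast
qed

text \<open>
  The possible values of the vector form a countable set, so it is enough to compare the
  probabilities of single vectors, which are products on both sides.
\<close>

lemma (in prob_space) joint_law_pmf:
  fixes X :: "'i \<Rightarrow> 'a \<Rightarrow> 'x"
  assumes I: "finite I" "I \<noteq> {}" and B: "\<And>i. i \<in> I \<Longrightarrow> countable (B i)"
    and X: "\<And>i. i \<in> I \<Longrightarrow> X i \<in> measurable M (count_space (B i))"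
    and indep: "indep_vars (\<lambda>i. count_space (B i)) X I"
    and p: "\<And>i. i \<in> I \<Longrightarrow> measure_pmf (p i) = distr M (count_space UNIV) (X i)"
  shows "(\<lambda>\<omega>. \<lambda>i\<in>I. X i \<omega>) \<in> measurable M (count_space UNIV)"
    and "distr M (count_space UNIV) (\<lambda>\<omega>. \<lambda>i\<in>I. X i \<omega>) = measure_pmf (Pi_pmf I undefined p)"
proof -
  let ?X = "\<lambda>\<omega>. \<lambda>i\<in>I. X i \<omega>"
  let ?P = "PiE I B"
  have cP: "countable ?P" using I B by (intro countable_PiE) auto
  have XB: "X i \<omega> \<in> B i" if "i \<in> I" "\<omega> \<in> space M" for i \<omega>
    using measurable_space[OF X[OF that(1)] that(2)] by simp
  have pre: "?X -` {y} \<inter> space M = (\<Inter>i\<in>I. X i -` {y i} \<inter> space M)" if y: "y \<in> ?P" for y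
  proof (intro equalityI subsetI)
    fix \<omega> assume "\<omega> \<in> ?X -` {y} \<inter> space M"
    then show "\<omega> \<in> (\<Inter>i\<in>I. X i -` {y i} \<inter> space M)" by auto
  next
    fix \<omega> assume \<omega>: "\<omega> \<in> (\<Inter>i\<in>I. X i -` {y i} \<inter> space M)"
    have "X i \<omega> = y i \<and> \<omega> \<in> space M" if "i \<in> I" for i using INT_D[OF \<omega> that] by simp
    then have "?X \<omega> i = y i" and \<omega>M: "\<omega> \<in> space M" for i
      using PiE_arb[OF y, of i] I(2) by (cases "i \<in> I"; auto)+
    then have "?X \<omega> = y" by (intro ext)
    then show "\<omega> \<in> ?X -` {y} \<inter> space M" using \<omega>M by simp
  qed
  have "?X \<in> measurable M (count_space ?P)"
  proof (subst measurable_count_space_eq_countable[OF cP], intro conjI ballI)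
    show "?X \<in> space M \<rightarrow> ?P" using XB by auto
    fix y assume y: "y \<in> ?P"
    show "?X -` {y} \<inter> space M \<in> sets M"
      unfolding pre[OF y]
      by (intro sets.finite_INT I measurable_sets[OF X]) (use y in auto)
  qed
  then show X': "?X \<in> measurable M (count_space UNIV)" by (rule measurable_count_space_UNIV)
  have supp: "set_pmf (p i) \<subseteq> B i" if i: "i \<in> I" for i
  proof
    fix x assume "x \<in> set_pmf (p i)"
    then have "measure (distr M (count_space UNIV) (X i)) {x} \<noteq> 0"
      unfolding p[OF i, symmetric] by (simp add: measure_pmf_single set_pmf_iff)
    then have "X i -` {x} \<inter> space M \<noteq> {}"
      by (auto simp: measure_distr[OF measurable_count_space_UNIV[OF X[OF i]]])
    then show "x \<in> B i" using XB[OF i] by auto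
  qed
  show "distr M (count_space UNIV) ?X = measure_pmf (Pi_pmf I undefined p)"
  proof (rule measure_eqI_countable_AE[OF _ _ _ _ cP])
    show "AE x in distr M (count_space UNIV) ?X. x \<in> ?P"
      by (subst AE_distr_iff[OF X']) (use XB in \<open>auto intro!: AE_I2\<close>)
    show "AE x in measure_pmf (Pi_pmf I undefined p). x \<in> ?P"
    proof (rule AE_pmfI)
      fix x assume "x \<in> set_pmf (Pi_pmf I undefined p)"
      then have "x \<in> PiE_dflt I undefined (set_pmf \<circ> p)"
        using set_Pi_pmf_subset'[OF I(1), of undefined p] by blast
      then show "x \<in> ?P" using supp unfolding PiE_dflt_def by (auto simp: PiE_def extensional_def)
    qed
    fix y assume y: "y \<in> ?P"
    have "measure M (?X -` {y} \<inter> space M) = (\<Prod>i\<in>I. measure M (X i -` {y i} \<inter> space M))"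
      unfolding pre[OF y] by (rule indep_varsD_finite[OF indep I(2,1)]) (use y in auto)
    also have "\<dots> = (\<Prod>i\<in>I. pmf (p i) (y i))"
    proof (rule prod.cong[OF refl])
      fix i assume i: "i \<in> I"
      show "measure M (X i -` {y i} \<inter> space M) = pmf (p i) (y i)"
        unfolding pmf.rep_eq p[OF i]
        by (simp add: measure_distr[OF measurable_count_space_UNIV[OF X[OF i]]])
    qed
    also have "\<dots> = pmf (Pi_pmf I undefined p) y"
      by (rule pmf_Pi'[OF I(1), symmetric]) (rule PiE_arb[OF y])
    finally show "emeasure (distr M (count_space UNIV) ?X) {y} = emeasure (measure_pmf (Pi_pmf I undefined p)) {y}"
      using X' by (simp add: emeasure_distr emeasure_eq_measure emeasure_pmf_single)
  qed simp_all
qed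

lemma distr_count_space_cong:
  assumes "X \<in> measurable M (count_space B)" "Y \<in> measurable M (count_space B)"
    and "distr M (count_space B) X = distr M (count_space B) Y"
  shows "distr M (count_space UNIV) X = distr M (count_space UNIV) Y"
proof -
  have "distr M (count_space UNIV) Z = distr (distr M (count_space B) Z) (count_space UNIV) id"
    if "Z \<in> measurable M (count_space B)" for Z
    by (subst distr_distr[OF _ that]) simp_all
  then show ?thesis using assms by metis
qed

lemma conj_invariant_law:
  assumes X: "X \<in> measurable M (count_space (perms n))"
    and p: "measure_pmf p = distr M (count_space UNIV) X"
    and inv: "\<And>\<tau>. \<tau> \<in> perms n \<Longrightarrow> distr M (count_space (perms n)) (\<lambda>\<omega>. inv \<tau> \<circ> X \<omega> \<circ> \<tau>)
             = distr M (count_space (perms n)) X"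
  shows "conj_invariant n p"
  unfolding conj_invariant_def
proof
  fix \<tau> assume \<tau>: "\<tau> \<in> perms n"
  let ?c = "\<lambda>s. inv \<tau> \<circ> s \<circ> \<tau>"
  have "?c \<in> measurable (count_space (perms n)) (count_space (perms n))"
    using \<tau> by (auto intro!: permutes_compose permutes_inv)
  from measurable_comp[OF X this] have cX: "(\<lambda>\<omega>. ?c (X \<omega>)) \<in> measurable M (count_space (perms n))"
    by (simp add: comp_def)
  have "measure_pmf (map_pmf ?c p) = distr (distr M (count_space UNIV) X) (count_space UNIV) ?c"
    by (simp add: map_pmf_rep_eq p)
  also have "\<dots> = distr M (count_space UNIV) (\<lambda>\<omega>. ?c (X \<omega>))"
    by (subst distr_distr[OF _ measurable_count_space_UNIV[OF X]]) (simp_all add: comp_def)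
  also have "\<dots> = distr M (count_space UNIV) X"
    by (rule distr_count_space_cong[OF cX X inv[OF \<tau>]])
  finally show "map_pmf ?c p = p" by (simp only: p[symmetric] measure_pmf_inject)
qed

lemma expectation_distr_pmf:
  fixes f :: "'x \<Rightarrow> real"
  assumes "measure_pmf p = distr M (count_space UNIV) X" "X \<in> measurable M (count_space UNIV)"
  shows "measure_pmf.expectation p f = (\<integral>\<omega>. f (X \<omega>) \<partial>M)"
  unfolding assms(1) by (rule integral_distr[OF assms(2)]) simp

lemma perm_prod_restrict: "perm_prod m (\<lambda>l\<in>{1..m}. s l) = perm_prod m s"
  unfolding perm_prod_def by (intro arg_cong2[of _ _ _ _ "\<lambda>x. foldr (\<circ>) x"] map_cong refl) auto

text \<open>
  A cycle of length two has two points, whence the factor \<open>2\<close>.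
\<close>

lemma few_short_cycles_law:
  assumes p: "\<And>n. n \<ge> 1 \<Longrightarrow> measure_pmf (p n) = distr (M n) (count_space UNIV) (X n)"
    and X: "\<And>n. n \<ge> 1 \<Longrightarrow> X n \<in> measurable (M n) (count_space (perms n))"
    and fixed: "\<And>k::nat. k \<ge> 1 \<Longrightarrow>
      (\<lambda>n. \<integral>\<omega>. (real (cycle_count n 1 (X n \<omega>)) / sqrt (real n)) ^ k \<partial>M n) \<longlonglongrightarrow> 0"
    and two: "(\<lambda>n. (\<integral>\<omega>. real (cycle_count n 2 (X n \<omega>)) \<partial>M n) / real n) \<longlonglongrightarrow> 0"
  shows "few_short_cycles p"
  unfolding few_short_cycles_def
proof (intro conjI allI impI)
  have perm: "X n \<omega> permutes {1..n}" if "n \<ge> 1" "\<omega> \<in> space (M n)" for n \<omega>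
    using measurable_space[OF X[OF that(1)] that(2)] by simp
  {
    fix k :: nat assume k: "1 \<le> k"
    show "(\<lambda>n. measure_pmf.expectation (p n) (\<lambda>s. (real (card (fix_pts n s)) / sqrt (real n)) ^ k)) \<longlonglongrightarrow> 0"
    proof (rule Lim_transform_eventually[OF fixed[OF k]])
      show "\<forall>\<^sub>F n in sequentially. (\<integral>\<omega>. (real (cycle_count n 1 (X n \<omega>)) / sqrt (real n)) ^ k \<partial>M n) =
          measure_pmf.expectation (p n) (\<lambda>s. (real (card (fix_pts n s)) / sqrt (real n)) ^ k)"
        using eventually_ge_at_top[of 1]
      proof eventually_elim
        case (elim n)
        have "cycle_count n 1 (X n \<omega>) = card (fix_pts n (X n \<omega>))" if "\<omega> \<in> space (M n)" for \<omega>
          using perm[OF elim that] by (simp add: fix_pts_eq card_period_pts)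
        then show ?case
          unfolding expectation_distr_pmf[OF p[OF elim] measurable_count_space_UNIV[OF X[OF elim]]]
          by (intro Bochner_Integration.integral_cong refl) simp
      qed
    qed
  }
  show "(\<lambda>n. measure_pmf.expectation (p n) (\<lambda>s. real (card (two_pts n s)) / real n)) \<longlonglongrightarrow> 0"
  proof (rule Lim_transform_eventually)
    show "(\<lambda>n. 2 * ((\<integral>\<omega>. real (cycle_count n 2 (X n \<omega>)) \<partial>M n) / real n)) \<longlonglongrightarrow> 0"
      by (rule tendsto_mult_right_zero[OF two])
    show "\<forall>\<^sub>F n in sequentially. 2 * ((\<integral>\<omega>. real (cycle_count n 2 (X n \<omega>)) \<partial>M n) / real n) =
        measure_pmf.expectation (p n) (\<lambda>s. real (card (two_pts n s)) / real n)"
      using eventually_ge_at_top[of 1]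
    proof eventually_elim
      case (elim n)
      have "card (two_pts n (X n \<omega>)) = 2 * cycle_count n 2 (X n \<omega>)" if "\<omega> \<in> space (M n)" for \<omega>
        using perm[OF elim that] by (simp add: two_pts_eq card_period_pts)
      then have "(\<integral>\<omega>. real (card (two_pts n (X n \<omega>))) / real n \<partial>M n) =
          (\<integral>\<omega>. 2 * (real (cycle_count n 2 (X n \<omega>)) / real n) \<partial>M n)"
        by (intro Bochner_Integration.integral_cong refl) simp
      then show ?case
        unfolding expectation_distr_pmf[OF p[OF elim] measurable_count_space_UNIV[OF X[OF elim]]]
        by auto
    qed
  qed
qed

section \<open>Convergence of the traces\<close>

text \<open>
  Write \<open>\<sigma> n 1 \<circ> \<dots> \<circ> \<sigma> n m\<close> as \<open>pre\<close>, \<open>\<sigma> n i\<close>, \<open>mid\<close>, \<open>\<sigma> n j\<close>, \<open>post\<close>. Rotating \<open>pre\<close> to the end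
  gives \<open>a = \<sigma> n i \<circ> mid\<close> followed by \<open>b = \<sigma> n j \<circ> post \<circ> pre\<close>. The one index \<open>l0\<close> at which
  invariance may fail occurs in only one of these blocks, and in that block either in its first
  factor or in the rest. So within each block, and between the blocks, at least one of two
  factors is invariant.
\<close>

theorem corollary4:
  fixes m :: nat
    and M :: "nat \<Rightarrow> 'a measure"
    and \<sigma> :: "nat \<Rightarrow> nat \<Rightarrow> 'a \<Rightarrow> nat \<Rightarrow> nat"
    and N :: "'b measure"
    and \<xi> :: "nat \<Rightarrow> 'b \<Rightarrow> nat"
  assumes m: "m \<ge> 2"
    and prob: "\<And>n. n \<ge> 1 \<Longrightarrow> prob_space (M n)"
    and rv: "\<And>n l. n \<ge> 1 \<Longrightarrow> l \<in> {1..m} \<Longrightarrow>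
               \<sigma> n l \<in> measurable (M n) (count_space (perms n))"
    and indep: "\<And>n. n \<ge> 1 \<Longrightarrow>
               prob_space.indep_vars (M n) (\<lambda>_. count_space (perms n)) (\<sigma> n) {1..m}"
    and conj_inv: "\<exists>l0\<in>{1..m}. \<forall>l\<in>{1..m} - {l0}. \<forall>n\<ge>1. \<forall>\<tau>\<in>perms n.
               distr (M n) (count_space (perms n)) (\<lambda>\<omega>. inv \<tau> \<circ> \<sigma> n l \<omega> \<circ> \<tau>)
             = distr (M n) (count_space (perms n)) (\<sigma> n l)"
    and few_cycles: "\<exists>i j. 1 \<le> i \<and> i < j \<and> j \<le> m \<and>
          (\<forall>k::nat\<ge>1.
             (\<lambda>n. \<integral>\<omega>. (real (cycle_count n 1 (\<sigma> n i \<omega>)) / sqrt (real n)) ^ k \<partial>M n) \<longlonglongrightarrow> 0 \<and>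
             (\<lambda>n. \<integral>\<omega>. (real (cycle_count n 1 (\<sigma> n j \<omega>)) / sqrt (real n)) ^ k \<partial>M n) \<longlonglongrightarrow> 0) \<and>
          (\<lambda>n. (\<integral>\<omega>. real (cycle_count n 2 (\<sigma> n i \<omega>)) \<partial>M n) / real n) \<longlonglongrightarrow> 0 \<and>
          (\<lambda>n. (\<integral>\<omega>. real (cycle_count n 2 (\<sigma> n j \<omega>)) \<partial>M n) / real n) \<longlonglongrightarrow> 0"
    and N: "prob_space N"
    and \<xi>_indep: "prob_space.indep_vars N (\<lambda>_. count_space UNIV) \<xi> {1..}"
    and \<xi>_poisson: "\<And>d. d \<ge> 1 \<Longrightarrow>
          distr N (count_space UNIV) (\<xi> d) = measure_pmf (poisson_pmf (1 / real d))"
  shows "\<forall>k\<ge>1. conv_in_distr {1..k}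
           M (\<lambda>n \<omega>. \<lambda>r\<in>{1..k}. real (perm_tr n ((perm_prod m (\<lambda>l. \<sigma> n l \<omega>)) ^^ r)))
           N (\<lambda>\<omega>. \<lambda>r\<in>{1..k}. \<Sum>d | d dvd r. real d * real (\<xi> d \<omega>))"
proof -
  \<comment> \<open>Outside the range of the hypotheses the law is taken to be the unit mass at the identity, which is
    conjugation invariant, so that the lemmas on sequences of laws apply for all \<open>n\<close>.\<close>
  have "\<exists>q. set_pmf q \<subseteq> perms n \<and> (n \<ge> 1 \<longrightarrow> l \<in> {1..m} \<longrightarrow> measure_pmf q = distr (M n) (count_space UNIV) (\<sigma> n l)) \<and>
      (\<not> (n \<ge> 1 \<and> l \<in> {1..m}) \<longrightarrow> q = return_pmf id)" for n l
  proof (cases "n \<ge> 1 \<and> l \<in> {1..m}")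
    case True
    interpret prob_space "M n" using prob True by blast
    obtain q where "set_pmf q \<subseteq> perms n" "measure_pmf q = distr (M n) (count_space UNIV) (\<sigma> n l)"
      by (rule pmf_of_finite_random_variable[OF rv[of n l]]) (use True finite_permutations in auto)
    then show ?thesis using True by blast
  next
    case False
    then show ?thesis using permutes_id by (intro exI[of _ "return_pmf id"]) auto
  qed
  then obtain p where p_sub: "\<And>n l. set_pmf (p n l) \<subseteq> perms n"
    and p_law: "\<And>n l. n \<ge> 1 \<Longrightarrow> l \<in> {1..m} \<Longrightarrow> measure_pmf (p n l) = distr (M n) (count_space UNIV) (\<sigma> n l)"
    and p_triv: "\<And>n l. \<not> (n \<ge> 1 \<and> l \<in> {1..m}) \<Longrightarrow> p n l = return_pmf id"
    by metis
  from conj_inv obtain l0 where l0: "\<And>l n \<tau>. l \<in> {1..m} - {l0} \<Longrightarrow> n \<ge> 1 \<Longrightarrow> \<tau> \<in> perms n \<Longrightarrow>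
      distr (M n) (count_space (perms n)) (\<lambda>\<omega>. inv \<tau> \<circ> \<sigma> n l \<omega> \<circ> \<tau>)
      = distr (M n) (count_space (perms n)) (\<sigma> n l)" by blast
  have p_inv: "conj_invariant n (p n l)" if "l \<noteq> l0" for n l
  proof (cases "n \<ge> 1 \<and> l \<in> {1..m}")
    case True
    then show ?thesis
      using that by (intro conj_invariant_law[OF rv p_law] l0) auto
  next
    case False
    then show ?thesis using conj_invariant_prod_law[of "[]" n] by (simp add: p_triv)
  qed
  from few_cycles obtain i j where ij: "1 \<le> i" "i < j" "j \<le> m"
    and fi: "\<And>k::nat. k \<ge> 1 \<Longrightarrow> (\<lambda>n. \<integral>\<omega>. (real (cycle_count n 1 (\<sigma> n i \<omega>)) / sqrt (real n)) ^ k \<partial>M n) \<longlonglongrightarrow> 0"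
    and fj: "\<And>k::nat. k \<ge> 1 \<Longrightarrow> (\<lambda>n. \<integral>\<omega>. (real (cycle_count n 1 (\<sigma> n j \<omega>)) / sqrt (real n)) ^ k \<partial>M n) \<longlonglongrightarrow> 0"
    and ti: "(\<lambda>n. (\<integral>\<omega>. real (cycle_count n 2 (\<sigma> n i \<omega>)) \<partial>M n) / real n) \<longlonglongrightarrow> 0"
    and tj: "(\<lambda>n. (\<integral>\<omega>. real (cycle_count n 2 (\<sigma> n j \<omega>)) \<partial>M n) / real n) \<longlonglongrightarrow> 0"
    by blast
  have im: "i \<in> {1..m}" and jm: "j \<in> {1..m}" using ij by auto
  have few_i: "few_short_cycles (\<lambda>n. p n i)"
    by (rule few_short_cycles_law[OF p_law[OF _ im] rv[OF _ im] fi ti])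
  have few_j: "few_short_cycles (\<lambda>n. p n j)"
    by (rule few_short_cycles_law[OF p_law[OF _ jm] rv[OF _ jm] fj tj])
  define pre mid post where "pre = [1..<i]" and "mid = [Suc i..<j]" and "post = [Suc j..<Suc m]"
  have upt_split: "[x..<z] = [x..<y] @ [y..<z]" if "x \<le> y" "y \<le> z" for x y z :: nat
    using upt_add_eq_append[of x y "z - y"] that by simp
  have "[1..<Suc m] = [1..<i] @ [i..<j] @ [j..<Suc m]"
    using ij upt_split[of 1 i "Suc m"] upt_split[of i j "Suc m"] by (simp del: upt_Suc)
  also have "[i..<j] = i # mid" unfolding mid_def using ij by (simp add: upt_conv_Cons)
  also have "[j..<Suc m] = j # post" unfolding post_def using ij by (simp add: upt_conv_Cons del: upt_Suc)
  finally have split: "[1..<Suc m] = pre @ (i # mid) @ (j # post)" unfolding pre_def .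
  define a where "a = (\<lambda>n. conv_pmf (p n i) (prod_law (p n) mid))"
  define b where "b = (\<lambda>n. conv_pmf (p n j) (prod_law (p n) (post @ pre)))"
  have a_sub: "set_pmf (a n) \<subseteq> perms n" and b_sub: "set_pmf (b n) \<subseteq> perms n" for n
    unfolding a_def b_def by (intro set_conv_pmf set_prod_law p_sub)+
  have pl_sub: "set_pmf (prod_law (p n) ls) \<subseteq> perms n" for n ls
    by (rule set_prod_law) (rule p_sub)
  have l_inv: "conj_invariant n (prod_law (p n) ls)" if "l0 \<notin> set ls" for n ls
    using that by (intro conj_invariant_prod_law p_inv) auto
  have few_a: "few_short_cycles a"
    unfolding a_def
  proof (rule few_short_cycles_conv[OF few_i p_sub set_prod_law[OF p_sub]])
    show "conj_invariant n (p n i) \<or> conj_invariant n (prod_law (p n) mid)" for n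
      using p_inv[of i] l_inv[of mid] by (cases "i = l0") (auto simp: mid_def)
  qed
  have few_b: "few_short_cycles b"
    unfolding b_def
  proof (rule few_short_cycles_conv[OF few_j p_sub set_prod_law[OF p_sub]])
    show "conj_invariant n (p n j) \<or> conj_invariant n (prod_law (p n) (post @ pre))" for n
      using p_inv[of j] l_inv[of "post @ pre"] ij by (cases "j = l0") (auto simp: pre_def post_def)
  qed
  have inv_ab: "conj_invariant n (a n) \<or> conj_invariant n (b n)" for n
  proof (cases "l0 \<in> set (i # mid)")
    case True
    then have "l0 \<notin> set (j # post @ pre)" using ij by (auto simp: mid_def pre_def post_def)
    then show ?thesis using l_inv[of "j # post @ pre" n] unfolding b_def by simp
  next
    case False
    then show ?thesis using l_inv[of "i # mid" n] unfolding a_def by simp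
  qed
  show ?thesis
  proof (intro allI impI)
    fix k :: nat assume k: "k \<ge> 1"
    show "conv_in_distr {1..k}
           M (\<lambda>n \<omega>. \<lambda>r\<in>{1..k}. real (perm_tr n ((perm_prod m (\<lambda>l. \<sigma> n l \<omega>)) ^^ r)))
           N (\<lambda>\<omega>. \<lambda>r\<in>{1..k}. \<Sum>d | d dvd r. real d * real (\<xi> d \<omega>))"
      unfolding conv_in_distr_def
    proof (intro allI impI)
      fix f :: "(nat \<Rightarrow> real) \<Rightarrow> real"
      assume "bounded (f ` topspace (powertop_real {1..k}))"
      then obtain B where B: "\<And>x. x \<in> topspace (powertop_real {1..k}) \<Longrightarrow> \<bar>f x\<bar> \<le> B"
        unfolding bounded_iff by auto
      \<comment> \<open>Both vectors are the image under \<open>T\<close> of a vector of cycle counts, respectively of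
        Poisson variables.\<close>
      define T where "T = (\<lambda>c :: nat \<Rightarrow> nat. \<lambda>r\<in>{1..k}. \<Sum>d | d dvd r. real d * real (c d))"
      define h where "h = (\<lambda>c. f (T c))"
      define g where "g = (\<lambda>n s. f (\<lambda>r\<in>{1..k}. real (perm_tr n (s ^^ r))))"
      have hB: "\<bar>h c\<bar> \<le> B" for c unfolding h_def T_def by (rule B) simp
      have g_comm: "g n (s \<circ> t) = g n (t \<circ> s)" if "s permutes {1..n}" "t permutes {1..n}" for n s t
        unfolding g_def perm_tr_funpow_commute[OF that] ..
      have T_cong: "T c = T c'" if "\<And>d. d \<in> {1..k} \<Longrightarrow> c d = c' d" for c c'
      proof -
        have "c d = c' d" if "d dvd r" "r \<in> {1..k}" for d r
          using that dvd_imp_le[of d r] dvd_pos_nat[of r d] \<open>\<And>d. d \<in> {1..k} \<Longrightarrow> c d = c' d\<close> by simp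
        then show ?thesis unfolding T_def by (intro restrict_ext sum.cong) auto
      qed
      have g_h: "g n s = h (cycle_vec k n s)" if s: "s permutes {1..n}" for n s
      proof -
        have "real (perm_tr n (s ^^ r)) = (\<Sum>d | d dvd r. real d * real (cycle_count n d s))" if "r \<in> {1..k}" for r
          using that by (subst perm_tr_funpow[OF s]) auto
        then have "g n s = f (T (\<lambda>d. cycle_count n d s))"
          unfolding g_def T_def by (intro arg_cong[of _ _ f] restrict_ext) auto
        also have "T (\<lambda>d. cycle_count n d s) = T (cycle_vec k n s)"
          by (rule T_cong) (simp add: cycle_vec_def)
        finally show ?thesis unfolding h_def .
      qed
      have lhs: "(\<integral>\<omega>. f (\<lambda>r\<in>{1..k}. real (perm_tr n ((perm_prod m (\<lambda>l. \<sigma> n l \<omega>)) ^^ r))) \<partial>M n) =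
          measure_pmf.expectation (conv_pmf (a n) (b n)) (\<lambda>s. h (cycle_vec k n s))" if n: "n \<ge> 1" for n
      proof -
        interpret prob_space "M n" by (rule prob[OF n])
        have ne: "{1..m} \<noteq> {}" using m by simp
        have cnt: "countable (perms n)" using finite_permutations[of "{1..n}"] by (simp add: countable_finite)
        note joint = joint_law_pmf[OF finite_atLeastAtMost ne cnt rv[OF n] indep[OF n] p_law[OF n]]
        have set_eq: "set [1..<Suc m] = {1..m}" by (simp add: atLeastLessThanSuc_atLeastAtMost del: upt_Suc)
        have "(\<integral>\<omega>. f (\<lambda>r\<in>{1..k}. real (perm_tr n ((perm_prod m (\<lambda>l. \<sigma> n l \<omega>)) ^^ r))) \<partial>M n) =
            (\<integral>\<omega>. g n (perm_prod m (\<lambda>l\<in>{1..m}. \<sigma> n l \<omega>)) \<partial>M n)"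
          unfolding g_def perm_prod_restrict ..
        also have "\<dots> = measure_pmf.expectation (Pi_pmf {1..m} undefined (p n)) (\<lambda>s. g n (perm_prod m s))"
          by (rule expectation_distr_pmf[OF joint(2)[symmetric] joint(1), symmetric])
        also have "\<dots> = measure_pmf.expectation (map_pmf (perm_prod m) (Pi_pmf {1..m} undefined (p n))) (g n)"
          by simp
        also have "map_pmf (perm_prod m) (Pi_pmf {1..m} undefined (p n)) = prod_law (p n) [1..<Suc m]"
          using map_Pi_pmf_prod_law[of "[1..<Suc m]" undefined "p n"]
          unfolding set_eq perm_prod_def by simp
        also have "prod_law (p n) [1..<Suc m] = conv_pmf (prod_law (p n) pre) (prod_law (p n) ((i # mid) @ (j # post)))"
          unfolding split prod_law_append ..
        also have "measure_pmf.expectation \<dots> (g n) =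
            measure_pmf.expectation (conv_pmf (prod_law (p n) ((i # mid) @ (j # post))) (prod_law (p n) pre)) (g n)"
          by (rule expectation_conv_pmf_commute[where n = n and g = "g n", OF pl_sub pl_sub g_comm])
        also have "conv_pmf (prod_law (p n) ((i # mid) @ (j # post))) (prod_law (p n) pre) = conv_pmf (a n) (b n)"
          unfolding a_def b_def by (simp add: prod_law_append conv_pmf_assoc)
        also have "measure_pmf.expectation (conv_pmf (a n) (b n)) (g n) =
            measure_pmf.expectation (conv_pmf (a n) (b n)) (\<lambda>s. h (cycle_vec k n s))"
        proof (rule integral_cong_AE)
          show "AE s in conv_pmf (a n) (b n). g n s = h (cycle_vec k n s)"
            using set_conv_pmf[OF a_sub b_sub] by (intro AE_pmfI g_h) blast
        qed simp_all
        finally show ?thesis .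
      qed
      have rhs: "(\<integral>\<omega>. f (\<lambda>r\<in>{1..k}. \<Sum>d | d dvd r. real d * real (\<xi> d \<omega>)) \<partial>N) =
          measure_pmf.expectation (Pi_pmf {1..k} undefined (\<lambda>d. poisson_pmf (1 / real d))) h"
      proof -
        interpret N: prob_space N by (rule N)
        have ind: "N.indep_vars (\<lambda>_. count_space UNIV) \<xi> {1..k}"
          by (rule N.indep_vars_subset[OF \<xi>_indep]) auto
        have meas: "\<xi> d \<in> measurable N (count_space UNIV)" if "d \<in> {1..k}" for d
          using ind that unfolding N.indep_vars_def by blast
        note joint = N.joint_law_pmf[OF finite_atLeastAtMost _ _ meas ind, where p = "\<lambda>d. poisson_pmf (1 / real d)"]
        have ne: "{1..k} \<noteq> {}" using k by simp
        have J: "(\<lambda>\<omega>. \<lambda>d\<in>{1..k}. \<xi> d \<omega>) \<in> measurable N (count_space UNIV)"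
          "distr N (count_space UNIV) (\<lambda>\<omega>. \<lambda>d\<in>{1..k}. \<xi> d \<omega>) =
             measure_pmf (Pi_pmf {1..k} undefined (\<lambda>d. poisson_pmf (1 / real d)))"
          by (rule joint[OF ne]; simp add: \<xi>_poisson)+
        have "(\<integral>\<omega>. f (\<lambda>r\<in>{1..k}. \<Sum>d | d dvd r. real d * real (\<xi> d \<omega>)) \<partial>N) = (\<integral>\<omega>. h (\<lambda>d\<in>{1..k}. \<xi> d \<omega>) \<partial>N)"
        proof (intro Bochner_Integration.integral_cong refl)
          fix \<omega>
          have "T (\<lambda>d. \<xi> d \<omega>) = T (\<lambda>d\<in>{1..k}. \<xi> d \<omega>)" by (rule T_cong) simp
          then show "f (\<lambda>r\<in>{1..k}. \<Sum>d | d dvd r. real d * real (\<xi> d \<omega>)) = h (\<lambda>d\<in>{1..k}. \<xi> d \<omega>)"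
            unfolding h_def by (simp add: T_def)
        qed
        also have "\<dots> = measure_pmf.expectation (Pi_pmf {1..k} undefined (\<lambda>d. poisson_pmf (1 / real d))) h"
          by (rule expectation_distr_pmf[OF J(2)[symmetric] J(1), symmetric])
        finally show ?thesis .
      qed
      show "(\<lambda>n. \<integral>\<omega>. f (\<lambda>r\<in>{1..k}. real (perm_tr n ((perm_prod m (\<lambda>l. \<sigma> n l \<omega>)) ^^ r))) \<partial>M n)
          \<longlonglongrightarrow> (\<integral>\<omega>. f (\<lambda>r\<in>{1..k}. \<Sum>d | d dvd r. real d * real (\<xi> d \<omega>)) \<partial>N)"
        unfolding rhs
      proof (rule Lim_transform_eventually)
        show "(\<lambda>n. measure_pmf.expectation (conv_pmf (a n) (b n)) (\<lambda>s. h (cycle_vec k n s)))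
          \<longlonglongrightarrow> measure_pmf.expectation (Pi_pmf {1..k} undefined (\<lambda>d. poisson_pmf (1 / real d))) h"
          by (rule cycle_counts_converge[OF few_a a_sub few_b b_sub inv_ab hB])
        show "\<forall>\<^sub>F n in sequentially. measure_pmf.expectation (conv_pmf (a n) (b n)) (\<lambda>s. h (cycle_vec k n s)) =
            (\<integral>\<omega>. f (\<lambda>r\<in>{1..k}. real (perm_tr n ((perm_prod m (\<lambda>l. \<sigma> n l \<omega>)) ^^ r))) \<partial>M n)"
          using eventually_ge_at_top[of 1] by eventually_elim (rule lhs[symmetric])
      qed
    qed
  qed
qed

end
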